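(* Let $p:(\mathcal G(\mathbb D),K)\to(\mathcal C,J)$ and $p':(\mathcal G(\mathbb D'),K')\to(\mathcal C,J)$ be two relative sites and $A:(\mathcal G(\mathbb D),K)\to(\mathcal G(\mathbb D'),K')$ a functor such that $p'A\simeq p$. Then $A$ is a morphism of local fibrations if and only if the two following conditions are satisfied: 1. For every vertical arrow $(1,u)$ in $\mathcal G(\mathbb D)$ such that $l_K(1,u)$ is an isomorphism, $l_{K'}(A(1,u))$ is an isomorphism. 2. For every arrow $f:c'\to c$ in $\mathcal C$, all the components $v_f^x$ ($x\in\mathbb D(c)$) of the canonical natural transformation $v_f:A_{c'}\mathbb D(f)\Rightarrow\mathbb D'(f)A_c$ are such that $l_{K'}(v_f^x)$ is an isomorphism. If moreover $A$ is continuous, the first condition is automatically satisfied; thus $A$ being a morphism of local fibrations reduces to the second condition.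
   Context: Sites are such that their categories of sheaves are Grothendieck toposes. For a site $(\mathcal C,J)$: $\widehat{\mathcal C}_J$ is the topos of sheaves, $a_J$ sheafification, $l_J:\mathcal C\to\widehat{\mathcal C}_J$ is Yoneda followed by $a_J$. A functor between sites is continuous if precomposition with it sends sheaves to sheaves. For an indexed category $\mathbb D:\mathcal C^{op}\to\mathbf{CAT}$, $p:\mathcal G(\mathbb D)\to\mathcal C$ is the associated fibration: objects are pairs $(x,c)$ with $x\in\mathbb D(c)$; arrows $(x',c')\to(x,c)$ are pairs $(f:c'\to c,\ u:x'\to\mathbb D(f)(x))$. An arrow $(1,u)$ is called vertical; each arrow factors as $(f,u)=(f,1)(1,u)$, its cartesian part following its vertical part. The Giraud topology on $\mathcal G(\mathbb D)$ has as covering sieves those containing a family of cartesian arrows whose projections form a $J$-covering family; a relative site is such a fibration with a topology $K$ containing the Giraud topology. Then $p$ is a comorphism of sites (every $J$-covering sieve on $p(d)$ contains the image of a $K$-covering sieve on $d$), inducing a geometric morphism $C_p:\widehat{\mathcal G(\mathbb D)}_K\to\widehat{\mathcal C}_J$ with $C_p^*(E)=a_K(E\circ p^{op})$. An arrow $g:d'\to d$ of $\mathcal G(\mathbb D)$ is locally cartesian if the square with sides $l_K(g):l_K(d')\to l_K(d)$, $C_p^*l_Jp(g)$, and the arrows $\eta(d'),\eta(d)$ is a pullback in $\widehat{\mathcal G(\mathbb D)}_K$, where $\eta(d):l_K(d)\to C_p^*l_Jp(d)\simeq a_K(\mathrm{Hom}_{\mathcal C}(p(-),p(d)))$ is the sheafification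 of $h\mapsto p(h)$ (equivalently, its image in the comma category $(\widehat{\mathcal G(\mathbb D)}_K/C_p^* )$ fibred over $\widehat{\mathcal C}_J$ is cartesian). $A$ is a morphism of local fibrations if $p'A\simeq p$ and $A$ sends locally cartesian arrows to locally cartesian arrows. $A_c:\mathbb D(c)\to\mathbb D'(c)$ is the functor induced by $A$ on the fibers over $c$ (using $p'A\simeq p$). For $f:c'\to c$ and $x\in\mathbb D(c)$, $v_f^x:A_{c'}(\mathbb D(f)(x))\to\mathbb D'(f)(A_c(x))$ is the vertical part of $A(f,1_{\mathbb D(f)(x)}):(A_{c'}(\mathbb D(f)(x)),c')\to(A_c(x),c)$; it is natural in $x$, and $l_{K'}(v^x_f)$ means $l_{K'}(1_{c'},v^x_f)$. *)

theory Defs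
  imports Main
begin

section \<open>Categories, functors, natural isomorphisms\<close>

record ('o, 'a) cat =
  Obj :: "'o set"
  Arr :: "'a set"
  Dom :: "'a \<Rightarrow> 'o"
  Cod :: "'a \<Rightarrow> 'o"
  Idn :: "'o \<Rightarrow> 'a"
  Comp :: "'a \<Rightarrow> 'a \<Rightarrow> 'a" (infixl "\<cdot>\<index>" 70)

definition hom :: "('o, 'a) cat \<Rightarrow> 'o \<Rightarrow> 'o \<Rightarrow> 'a set" where
  "hom C a b = {f \<in> Arr C. Dom C f = a \<and> Cod C f = b}"

locale category =
  fixes C :: "('o, 'a) cat" (structure)
  assumes dom_obj: "f \<in> Arr C \<Longrightarrow> Dom C f \<in> Obj C"
    and cod_obj: "f \<in> Arr C \<Longrightarrow> Cod C f \<in> Obj C"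
    and id_hom: "c \<in> Obj C \<Longrightarrow> Idn C c \<in> hom C c c"
    and comp_hom: "f \<in> Arr C \<Longrightarrow> g \<in> Arr C \<Longrightarrow> Cod C g = Dom C f \<Longrightarrow> f \<cdot> g \<in> hom C (Dom C g) (Cod C f)"
    and id_left: "f \<in> Arr C \<Longrightarrow> Idn C (Cod C f) \<cdot> f = f"
    and id_right: "f \<in> Arr C \<Longrightarrow> f \<cdot> Idn C (Dom C f) = f"
    and assoc: "f \<in> Arr C \<Longrightarrow> g \<in> Arr C \<Longrightarrow> h \<in> Arr C \<Longrightarrow> Cod C g = Dom C f \<Longrightarrow> Cod C h = Dom C g \<Longrightarrow>
      (f \<cdot> g) \<cdot> h = f \<cdot> (g \<cdot> h)"

definition inverse_arrows :: "('o, 'a) cat \<Rightarrow> 'a \<Rightarrow> 'a \<Rightarrow> bool" where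
  "inverse_arrows C f g \<longleftrightarrow> f \<in> Arr C \<and> g \<in> hom C (Cod C f) (Dom C f) \<and>
     f \<cdot>\<^bsub>C\<^esub> g = Idn C (Cod C f) \<and> g \<cdot>\<^bsub>C\<^esub> f = Idn C (Dom C f)"

definition iso_arr :: "('o, 'a) cat \<Rightarrow> 'a \<Rightarrow> bool" where
  "iso_arr C f \<longleftrightarrow> (\<exists>g. inverse_arrows C f g)"

definition inv_arr :: "('o, 'a) cat \<Rightarrow> 'a \<Rightarrow> 'a" where
  "inv_arr C f = (THE g. inverse_arrows C f g)"

record ('o, 'a, 'p, 'b) ftr =
  fob :: "'o \<Rightarrow> 'p"
  far :: "'a \<Rightarrow> 'b"

definition id_ftr :: "('o, 'a, 'o, 'a) ftr" where
  "id_ftr = \<lparr>fob = (\<lambda>c. c), far = (\<lambda>f. f)\<rparr>"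

definition comp_ftr :: "('p, 'b, 'q, 'd) ftr \<Rightarrow> ('o, 'a, 'p, 'b) ftr \<Rightarrow> ('o, 'a, 'q, 'd) ftr" where
  "comp_ftr G F = \<lparr>fob = (\<lambda>c. fob G (fob F c)), far = (\<lambda>f. far G (far F f))\<rparr>"

locale functor_between = source: category A + target: category B
  for A :: "('o, 'a) cat" and B :: "('p, 'b) cat" +
  fixes F :: "('o, 'a, 'p, 'b) ftr"
  assumes fob_obj: "c \<in> Obj A \<Longrightarrow> fob F c \<in> Obj B"
    and far_hom: "f \<in> Arr A \<Longrightarrow> far F f \<in> hom B (fob F (Dom A f)) (fob F (Cod A f))"
    and far_id: "c \<in> Obj A \<Longrightarrow> far F (Idn A c) = Idn B (fob F c)"
    and far_comp: "f \<in> Arr A \<Longrightarrow> g \<in> Arr A \<Longrightarrow> Cod A g = Dom A f \<Longrightarrow>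
      far F (f \<cdot>\<^bsub>A\<^esub> g) = far F f \<cdot>\<^bsub>B\<^esub> far F g"

definition natural_iso ::
  "('o, 'a) cat \<Rightarrow> ('p, 'b) cat \<Rightarrow> ('o, 'a, 'p, 'b) ftr \<Rightarrow> ('o, 'a, 'p, 'b) ftr \<Rightarrow> ('o \<Rightarrow> 'b) \<Rightarrow> bool" where
  "natural_iso A B F G \<theta> \<longleftrightarrow>
     (\<forall>c\<in>Obj A. \<theta> c \<in> hom B (fob F c) (fob G c) \<and> iso_arr B (\<theta> c)) \<and>
     (\<forall>f\<in>Arr A. \<theta> (Cod A f) \<cdot>\<^bsub>B\<^esub> far F f = far G f \<cdot>\<^bsub>B\<^esub> \<theta> (Dom A f))"

section \<open>Sites, presheaves and sheaves\<close>

definition sieve :: "('o, 'a) cat \<Rightarrow> 'o \<Rightarrow> 'a set \<Rightarrow> bool" where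
  "sieve C c S \<longleftrightarrow> S \<subseteq> {f \<in> Arr C. Cod C f = c} \<and>
     (\<forall>f\<in>S. \<forall>g\<in>Arr C. Cod C g = Dom C f \<longrightarrow> f \<cdot>\<^bsub>C\<^esub> g \<in> S)"

definition max_sieve :: "('o, 'a) cat \<Rightarrow> 'o \<Rightarrow> 'a set" where
  "max_sieve C c = {f \<in> Arr C. Cod C f = c}"

definition pull_sieve :: "('o, 'a) cat \<Rightarrow> 'a \<Rightarrow> 'a set \<Rightarrow> 'a set" where
  "pull_sieve C f S = {g \<in> Arr C. Cod C g = Dom C f \<and> f \<cdot>\<^bsub>C\<^esub> g \<in> S}"

definition gen_sieve :: "('o, 'a) cat \<Rightarrow> 'a set \<Rightarrow> 'a set" where
  "gen_sieve C T = {f \<cdot>\<^bsub>C\<^esub> g | f g. f \<in> T \<and> g \<in> Arr C \<and> Cod C g = Dom C f}"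

text \<open>A topology assigns to every object its set of covering sieves.\<close>

locale site = category C for C :: "('o, 'a) cat" (structure) +
  fixes J :: "'o \<Rightarrow> 'a set set"
  assumes cover_sieve: "c \<in> Obj C \<Longrightarrow> S \<in> J c \<Longrightarrow> sieve C c S"
    and cover_max: "c \<in> Obj C \<Longrightarrow> max_sieve C c \<in> J c"
    and cover_pull: "f \<in> Arr C \<Longrightarrow> S \<in> J (Cod C f) \<Longrightarrow> pull_sieve C f S \<in> J (Dom C f)"
    and cover_trans: "c \<in> Obj C \<Longrightarrow> S \<in> J c \<Longrightarrow> sieve C c R \<Longrightarrow>
      (\<And>f. f \<in> S \<Longrightarrow> pull_sieve C f R \<in> J (Dom C f)) \<Longrightarrow> R \<in> J c"

record ('o, 'a, 'v) psh =
  val :: "'o \<Rightarrow> 'v set"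
  res :: "'a \<Rightarrow> 'v \<Rightarrow> 'v"

locale presheaf = category C for C :: "('o, 'a) cat" (structure) +
  fixes P :: "('o, 'a, 'v) psh"
  assumes res_val: "f \<in> Arr C \<Longrightarrow> x \<in> val P (Cod C f) \<Longrightarrow> res P f x \<in> val P (Dom C f)"
    and res_id: "c \<in> Obj C \<Longrightarrow> x \<in> val P c \<Longrightarrow> res P (Idn C c) x = x"
    and res_comp: "f \<in> Arr C \<Longrightarrow> g \<in> Arr C \<Longrightarrow> Cod C g = Dom C f \<Longrightarrow> x \<in> val P (Cod C f) \<Longrightarrow>
      res P (f \<cdot> g) x = res P g (res P f x)"

text \<open>Morphisms of presheaves are compared on the elements of the source only (\<open>psh_eq\<close>):
  the values of the representing functions elsewhere carry no information.\<close>

definition psh_mor ::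
  "('o, 'a) cat \<Rightarrow> ('o, 'a, 'v) psh \<Rightarrow> ('o, 'a, 'w) psh \<Rightarrow> ('o \<Rightarrow> 'v \<Rightarrow> 'w) \<Rightarrow> bool" where
  "psh_mor C P Q \<tau> \<longleftrightarrow>
     (\<forall>c\<in>Obj C. \<forall>x\<in>val P c. \<tau> c x \<in> val Q c) \<and>
     (\<forall>f\<in>Arr C. \<forall>x\<in>val P (Cod C f). \<tau> (Dom C f) (res P f x) = res Q f (\<tau> (Cod C f) x))"

definition psh_eq ::
  "('o, 'a) cat \<Rightarrow> ('o, 'a, 'v) psh \<Rightarrow> ('o \<Rightarrow> 'v \<Rightarrow> 'w) \<Rightarrow> ('o \<Rightarrow> 'v \<Rightarrow> 'w) \<Rightarrow> bool" where
  "psh_eq C P \<sigma> \<tau> \<longleftrightarrow> (\<forall>c\<in>Obj C. \<forall>x\<in>val P c. \<sigma> c x = \<tau> c x)"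

definition psh_comp :: "('o \<Rightarrow> 'v \<Rightarrow> 'w) \<Rightarrow> ('o \<Rightarrow> 'u \<Rightarrow> 'v) \<Rightarrow> 'o \<Rightarrow> 'u \<Rightarrow> 'w" where
  "psh_comp \<sigma> \<tau> = (\<lambda>c x. \<sigma> c (\<tau> c x))"

definition psh_iso ::
  "('o, 'a) cat \<Rightarrow> ('o, 'a, 'v) psh \<Rightarrow> ('o, 'a, 'w) psh \<Rightarrow> ('o \<Rightarrow> 'v \<Rightarrow> 'w) \<Rightarrow> bool" where
  "psh_iso C P Q \<tau> \<longleftrightarrow> psh_mor C P Q \<tau> \<and>
     (\<exists>\<sigma>. psh_mor C Q P \<sigma> \<and> psh_eq C P (psh_comp \<sigma> \<tau>) (\<lambda>c x. x) \<and> psh_eq C Q (psh_comp \<tau> \<sigma>) (\<lambda>c x. x))"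

text \<open>A matching family on a sieve \<open>S\<close> is encoded as a partial function with domain \<open>S\<close>
  (\<open>dom\<close> is the domain of a partial function, \<open>Dom\<close> that of an arrow).\<close>

definition matching :: "('o, 'a) cat \<Rightarrow> ('o, 'a, 'v) psh \<Rightarrow> ('a \<rightharpoonup> 'v) \<Rightarrow> bool" where
  "matching C P m \<longleftrightarrow>
     (\<forall>f\<in>dom m. the (m f) \<in> val P (Dom C f)) \<and>
     (\<forall>f\<in>dom m. \<forall>g\<in>Arr C. Cod C g = Dom C f \<longrightarrow> m (f \<cdot>\<^bsub>C\<^esub> g) = map_option (res P g) (m f))"

locale sheaf = site C J + presheaf C P
  for C :: "('o, 'a) cat" (structure) and J :: "'o \<Rightarrow> 'a set set" and P :: "('o, 'a, 'v) psh" +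
  assumes glue: "c \<in> Obj C \<Longrightarrow> dom m \<in> J c \<Longrightarrow> matching C P m \<Longrightarrow>
    \<exists>!x. x \<in> val P c \<and> (\<forall>f\<in>dom m. m f = Some (res P f x))"

section \<open>Sheafification: the plus construction, applied twice\<close>

definition mfam :: "('o, 'a) cat \<Rightarrow> ('o \<Rightarrow> 'a set set) \<Rightarrow> ('o, 'a, 'v) psh \<Rightarrow> 'o \<Rightarrow> ('a \<rightharpoonup> 'v) set" where
  "mfam C J P c = {m. dom m \<in> J c \<and> matching C P m}"

definition mrel ::
  "('o, 'a) cat \<Rightarrow> ('o \<Rightarrow> 'a set set) \<Rightarrow> ('o, 'a, 'v) psh \<Rightarrow> 'o \<Rightarrow> (('a \<rightharpoonup> 'v) \<times> ('a \<rightharpoonup> 'v)) set" where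
  "mrel C J P c = {(m, m'). m \<in> mfam C J P c \<and> m' \<in> mfam C J P c \<and>
     (\<exists>R\<in>J c. R \<subseteq> dom m \<inter> dom m' \<and> (\<forall>f\<in>R. m f = m' f))}"

definition pull_fam :: "('o, 'a) cat \<Rightarrow> 'a \<Rightarrow> ('a \<rightharpoonup> 'v) \<Rightarrow> ('a \<rightharpoonup> 'v)" where
  "pull_fam C f m = (\<lambda>g. if g \<in> Arr C \<and> Cod C g = Dom C f then m (f \<cdot>\<^bsub>C\<^esub> g) else None)"

definition plus ::
  "('o, 'a) cat \<Rightarrow> ('o \<Rightarrow> 'a set set) \<Rightarrow> ('o, 'a, 'v) psh \<Rightarrow> ('o, 'a, ('a \<rightharpoonup> 'v) set) psh" where
  "plus C J P = \<lparr>val = (\<lambda>c. mfam C J P c // mrel C J P c),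
                 res = (\<lambda>f X. mrel C J P (Dom C f) `` (pull_fam C f ` X))\<rparr>"

text \<open>\<open>plus_arr C J Q \<tau>\<close> is the action of the plus construction on \<open>\<tau>\<close>, where \<open>Q\<close> is the target of \<open>\<tau>\<close>.\<close>

definition plus_arr ::
  "('o, 'a) cat \<Rightarrow> ('o \<Rightarrow> 'a set set) \<Rightarrow> ('o, 'a, 'w) psh \<Rightarrow> ('o \<Rightarrow> 'v \<Rightarrow> 'w) \<Rightarrow>
   'o \<Rightarrow> ('a \<rightharpoonup> 'v) set \<Rightarrow> ('a \<rightharpoonup> 'w) set" where
  "plus_arr C J Q \<tau> = (\<lambda>c X. mrel C J Q c `` ((\<lambda>m f. map_option (\<tau> (Dom C f)) (m f)) ` X))"

definition plus_unit ::
  "('o, 'a) cat \<Rightarrow> ('o \<Rightarrow> 'a set set) \<Rightarrow> ('o, 'a, 'v) psh \<Rightarrow> 'o \<Rightarrow> 'v \<Rightarrow> ('a \<rightharpoonup> 'v) set" where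
  "plus_unit C J P = (\<lambda>c x. mrel C J P c `` {\<lambda>f. if f \<in> max_sieve C c then Some (res P f x) else None})"

type_synonym ('a, 'v) plus_val = "('a \<rightharpoonup> 'v) set"
type_synonym ('a, 'v) shf_val = "('a, ('a, 'v) plus_val) plus_val"

definition sheafify ::
  "('o, 'a) cat \<Rightarrow> ('o \<Rightarrow> 'a set set) \<Rightarrow> ('o, 'a, 'v) psh \<Rightarrow> ('o, 'a, ('a, 'v) shf_val) psh" where
  "sheafify C J P = plus C J (plus C J P)"

definition sheafify_arr ::
  "('o, 'a) cat \<Rightarrow> ('o \<Rightarrow> 'a set set) \<Rightarrow> ('o, 'a, 'w) psh \<Rightarrow> ('o \<Rightarrow> 'v \<Rightarrow> 'w) \<Rightarrow>
   'o \<Rightarrow> ('a, 'v) shf_val \<Rightarrow> ('a, 'w) shf_val" where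
  "sheafify_arr C J Q \<tau> = plus_arr C J (plus C J Q) (plus_arr C J Q \<tau>)"

definition sheafify_unit ::
  "('o, 'a) cat \<Rightarrow> ('o \<Rightarrow> 'a set set) \<Rightarrow> ('o, 'a, 'v) psh \<Rightarrow> 'o \<Rightarrow> 'v \<Rightarrow> ('a, 'v) shf_val" where
  "sheafify_unit C J P = psh_comp (plus_unit C J (plus C J P)) (plus_unit C J P)"

definition yo :: "('o, 'a) cat \<Rightarrow> 'o \<Rightarrow> ('o, 'a, 'a) psh" where
  "yo C d = \<lparr>val = (\<lambda>c. hom C c d), res = (\<lambda>f h. h \<cdot>\<^bsub>C\<^esub> f)\<rparr>"

definition yo_arr :: "('o, 'a) cat \<Rightarrow> 'a \<Rightarrow> 'o \<Rightarrow> 'a \<Rightarrow> 'a" where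
  "yo_arr C g = (\<lambda>c h. g \<cdot>\<^bsub>C\<^esub> h)"

definition l_obj :: "('o, 'a) cat \<Rightarrow> ('o \<Rightarrow> 'a set set) \<Rightarrow> 'o \<Rightarrow> ('o, 'a, ('a, 'a) shf_val) psh" where
  "l_obj C J d = sheafify C J (yo C d)"

definition l_arr :: "('o, 'a) cat \<Rightarrow> ('o \<Rightarrow> 'a set set) \<Rightarrow> 'a \<Rightarrow> 'o \<Rightarrow> ('a, 'a) shf_val \<Rightarrow> ('a, 'a) shf_val" where
  "l_arr C J g = sheafify_arr C J (yo C (Cod C g)) (yo_arr C g)"

definition l_iso :: "('o, 'a) cat \<Rightarrow> ('o \<Rightarrow> 'a set set) \<Rightarrow> 'a \<Rightarrow> bool" where
  "l_iso C J g \<longleftrightarrow> psh_iso C (l_obj C J (Dom C g)) (l_obj C J (Cod C g)) (l_arr C J g)"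

section \<open>Pullbacks of sheaves\<close>

text \<open>The universal property of the square \<open>f \<circ> a = g \<circ> b\<close> is tested on sheaves whose elements live in
  the type \<open>'t + 'u \<times> 'v\<close>, since a definition cannot quantify over all types.
  The summand \<open>'t\<close> admits the candidate pullback itself as a test object.
  By \<open>sheaf_pullback_universal\<close> below the property then holds for sheaves with elements in any type.\<close>

definition sheaf_pullback ::
  "('o, 'a) cat \<Rightarrow> ('o \<Rightarrow> 'a set set) \<Rightarrow>
   ('o, 'a, 't) psh \<Rightarrow> ('o, 'a, 'u) psh \<Rightarrow> ('o, 'a, 'v) psh \<Rightarrow> ('o, 'a, 'w) psh \<Rightarrow>
   ('o \<Rightarrow> 't \<Rightarrow> 'u) \<Rightarrow> ('o \<Rightarrow> 't \<Rightarrow> 'v) \<Rightarrow> ('o \<Rightarrow> 'u \<Rightarrow> 'w) \<Rightarrow> ('o \<Rightarrow> 'v \<Rightarrow> 'w) \<Rightarrow> bool" where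
  "sheaf_pullback C J P A B E a b f g \<longleftrightarrow>
     sheaf C J P \<and> sheaf C J A \<and> sheaf C J B \<and> sheaf C J E \<and>
     psh_mor C P A a \<and> psh_mor C P B b \<and> psh_mor C A E f \<and> psh_mor C B E g \<and>
     psh_eq C P (psh_comp f a) (psh_comp g b) \<and>
     (\<forall>(Z :: ('o, 'a, 't + 'u \<times> 'v) psh) s t.
        sheaf C J Z \<and> psh_mor C Z A s \<and> psh_mor C Z B t \<and> psh_eq C Z (psh_comp f s) (psh_comp g t) \<longrightarrow>
        (\<exists>r. psh_mor C Z P r \<and> psh_eq C Z (psh_comp a r) s \<and> psh_eq C Z (psh_comp b r) t \<and>
          (\<forall>r'. psh_mor C Z P r' \<and> psh_eq C Z (psh_comp a r') s \<and> psh_eq C Z (psh_comp b r') t \<longrightarrow>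
             psh_eq C Z r' r)))"

section \<open>Comorphisms and continuous functors\<close>

definition precomp :: "('o, 'a, 'p, 'b) ftr \<Rightarrow> ('p, 'b, 'v) psh \<Rightarrow> ('o, 'a, 'v) psh" where
  "precomp F P = \<lparr>val = (\<lambda>c. val P (fob F c)), res = (\<lambda>f. res P (far F f))\<rparr>"

definition precomp_arr :: "('o, 'a, 'p, 'b) ftr \<Rightarrow> ('p \<Rightarrow> 'v \<Rightarrow> 'w) \<Rightarrow> 'o \<Rightarrow> 'v \<Rightarrow> 'w" where
  "precomp_arr F \<tau> = (\<lambda>c. \<tau> (fob F c))"

text \<open>The inverse image along the geometric morphism induced by a comorphism \<open>p : (G, K) \<rightarrow> (C, J)\<close>.\<close>

definition inv_img ::
  "('g, 'h) cat \<Rightarrow> ('g \<Rightarrow> 'h set set) \<Rightarrow> ('g, 'h, 'o, 'a) ftr \<Rightarrow> ('o, 'a, 'v) psh \<Rightarrow>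
   ('g, 'h, ('h, 'v) shf_val) psh" where
  "inv_img G K p E = sheafify G K (precomp p E)"

definition inv_img_arr ::
  "('g, 'h) cat \<Rightarrow> ('g \<Rightarrow> 'h set set) \<Rightarrow> ('g, 'h, 'o, 'a) ftr \<Rightarrow> ('o, 'a, 'w) psh \<Rightarrow>
   ('o \<Rightarrow> 'v \<Rightarrow> 'w) \<Rightarrow> 'g \<Rightarrow> ('h, 'v) shf_val \<Rightarrow> ('h, 'w) shf_val" where
  "inv_img_arr G K p E \<tau> = sheafify_arr G K (precomp p E) (precomp_arr p \<tau>)"

text \<open>\<open>\<eta>(d)\<close> is the sheafification of \<open>h \<mapsto> p(h)\<close>, followed by the isomorphism from the sheafification of
  \<open>Hom(p(-), p(d))\<close> to the inverse image of \<open>l(p(d))\<close>, which is the sheafification of the unit at \<open>Hom(-, p(d))\<close>.\<close>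

definition eta ::
  "('g, 'h) cat \<Rightarrow> ('g \<Rightarrow> 'h set set) \<Rightarrow> ('o, 'a) cat \<Rightarrow> ('o \<Rightarrow> 'a set set) \<Rightarrow> ('g, 'h, 'o, 'a) ftr \<Rightarrow>
   'g \<Rightarrow> 'g \<Rightarrow> ('h, 'h) shf_val \<Rightarrow> ('h, ('a, 'a) shf_val) shf_val" where
  "eta G K C J p d = psh_comp
     (inv_img_arr G K p (l_obj C J (fob p d)) (sheafify_unit C J (yo C (fob p d))))
     (sheafify_arr G K (precomp p (yo C (fob p d))) (\<lambda>e h. far p h))"

definition locally_cartesian ::
  "('g, 'h) cat \<Rightarrow> ('g \<Rightarrow> 'h set set) \<Rightarrow> ('o, 'a) cat \<Rightarrow> ('o \<Rightarrow> 'a set set) \<Rightarrow> ('g, 'h, 'o, 'a) ftr \<Rightarrow>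
   'h \<Rightarrow> bool" where
  "locally_cartesian G K C J p g \<longleftrightarrow> g \<in> Arr G \<and>
     sheaf_pullback G K
       (l_obj G K (Dom G g)) (l_obj G K (Cod G g))
       (inv_img G K p (l_obj C J (fob p (Dom G g)))) (inv_img G K p (l_obj C J (fob p (Cod G g))))
       (l_arr G K g) (eta G K C J p (Dom G g))
       (eta G K C J p (Cod G g)) (inv_img_arr G K p (l_obj C J (fob p (Cod G g))) (l_arr C J (far p g)))"

text \<open>Continuity is tested on sheaves whose elements live in the type \<open>('b \<times> 'a option \<times> 'b) set\<close>.
  By \<open>continuous_ftr_all\<close> below it then holds for sheaves with elements in any type.\<close>

definition continuous_ftr ::
  "('o, 'a) cat \<Rightarrow> ('o \<Rightarrow> 'a set set) \<Rightarrow> ('p, 'b) cat \<Rightarrow> ('p \<Rightarrow> 'b set set) \<Rightarrow> ('o, 'a, 'p, 'b) ftr \<Rightarrow> bool" where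
  "continuous_ftr C J D K F \<longleftrightarrow>
     (\<forall>P :: ('p, 'b, ('b \<times> 'a option \<times> 'b) set) psh. sheaf D K P \<longrightarrow> sheaf C J (precomp F P))"

section \<open>Indexed categories and relative sites\<close>

record ('o, 'a, 'x, 'm) indexed =
  fib :: "'o \<Rightarrow> ('x, 'm) cat"
  reix :: "'a \<Rightarrow> ('x, 'm, 'x, 'm) ftr"
  coh_id :: "'o \<Rightarrow> 'x \<Rightarrow> 'm"
  coh_comp :: "'a \<Rightarrow> 'a \<Rightarrow> 'x \<Rightarrow> 'm"

text \<open>Indexed categories are pseudofunctors, with coherence isomorphisms
  \<open>coh_id c x : x \<rightarrow> D(1\<^sub>c)(x)\<close> and \<open>coh_comp f g x : D(g)(D(f)(x)) \<rightarrow> D(f g)(x)\<close>.\<close>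

locale indexed_category = category C for C :: "('o, 'a) cat" (structure) +
  fixes D :: "('o, 'a, 'x, 'm) indexed"
  assumes fib_category: "c \<in> Obj C \<Longrightarrow> category (fib D c)"
    and reix_functor: "f \<in> Arr C \<Longrightarrow> functor_between (fib D (Cod C f)) (fib D (Dom C f)) (reix D f)"
    and coh_id_natural_iso: "c \<in> Obj C \<Longrightarrow>
      natural_iso (fib D c) (fib D c) id_ftr (reix D (Idn C c)) (coh_id D c)"
    and coh_comp_natural_iso: "f \<in> Arr C \<Longrightarrow> g \<in> Arr C \<Longrightarrow> Cod C g = Dom C f \<Longrightarrow>
      natural_iso (fib D (Cod C f)) (fib D (Dom C g))
        (comp_ftr (reix D g) (reix D f)) (reix D (f \<cdot> g)) (coh_comp D f g)"
    and coh_unit_right: "f \<in> Arr C \<Longrightarrow> x \<in> Obj (fib D (Cod C f)) \<Longrightarrow>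
      coh_comp D f (Idn C (Dom C f)) x \<cdot>\<^bsub>fib D (Dom C f)\<^esub> coh_id D (Dom C f) (fob (reix D f) x)
        = Idn (fib D (Dom C f)) (fob (reix D f) x)"
    and coh_unit_left: "f \<in> Arr C \<Longrightarrow> x \<in> Obj (fib D (Cod C f)) \<Longrightarrow>
      coh_comp D (Idn C (Cod C f)) f x \<cdot>\<^bsub>fib D (Dom C f)\<^esub> far (reix D f) (coh_id D (Cod C f) x)
        = Idn (fib D (Dom C f)) (fob (reix D f) x)"
    and coh_assoc: "f \<in> Arr C \<Longrightarrow> g \<in> Arr C \<Longrightarrow> h \<in> Arr C \<Longrightarrow> Cod C g = Dom C f \<Longrightarrow> Cod C h = Dom C g \<Longrightarrow>
      x \<in> Obj (fib D (Cod C f)) \<Longrightarrow>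
      coh_comp D (f \<cdot> g) h x \<cdot>\<^bsub>fib D (Dom C h)\<^esub> far (reix D h) (coh_comp D f g x)
        = coh_comp D f (g \<cdot> h) x \<cdot>\<^bsub>fib D (Dom C h)\<^esub> coh_comp D g h (fob (reix D f) x)"

text \<open>\<open>GArr f u x\<close> is the arrow \<open>(f, u) : (x', c') \<rightarrow> (x, c)\<close>; its target \<open>x\<close> has to be recorded,
  as it is not determined by \<open>f\<close> and \<open>u : x' \<rightarrow> D(f)(x)\<close>.\<close>

datatype ('a, 'm, 'x) garr = GArr (base: 'a) (fpart: 'm) (tgt: 'x)

definition gcat :: "('o, 'a) cat \<Rightarrow> ('o, 'a, 'x, 'm) indexed \<Rightarrow> ('x \<times> 'o, ('a, 'm, 'x) garr) cat" where
  "gcat C D = \<lparr>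
     Obj = {(x, c). c \<in> Obj C \<and> x \<in> Obj (fib D c)},
     Arr = {GArr f u x | f u x. f \<in> Arr C \<and> x \<in> Obj (fib D (Cod C f)) \<and>
              u \<in> Arr (fib D (Dom C f)) \<and> Cod (fib D (Dom C f)) u = fob (reix D f) x},
     Dom = (\<lambda>g. (Dom (fib D (Dom C (base g))) (fpart g), Dom C (base g))),
     Cod = (\<lambda>g. (tgt g, Cod C (base g))),
     Idn = (\<lambda>(x, c). GArr (Idn C c) (coh_id D c x) x),
     Comp = (\<lambda>g h. let B = fib D (Dom C (base h)) in
       GArr (base g \<cdot>\<^bsub>C\<^esub> base h)
         (coh_comp D (base g) (base h) (tgt g) \<cdot>\<^bsub>B\<^esub> far (reix D (base h)) (fpart g) \<cdot>\<^bsub>B\<^esub> fpart h)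
         (tgt g))\<rparr>"

definition proj :: "('x \<times> 'o, ('a, 'm, 'x) garr, 'o, 'a) ftr" where
  "proj = \<lparr>fob = snd, far = base\<rparr>"

definition vertical :: "('o, 'a) cat \<Rightarrow> ('o, 'a, 'x, 'm) indexed \<Rightarrow> ('a, 'm, 'x) garr \<Rightarrow> bool" where
  "vertical C D g \<longleftrightarrow> g \<in> Arr (gcat C D) \<and> (\<exists>c\<in>Obj C. base g = Idn C c)"

text \<open>\<open>u : x' \<rightarrow> x\<close> in the fibre over \<open>c\<close> is regarded as a vertical arrow by composing it with \<open>x \<rightarrow> D(1\<^sub>c)(x)\<close>.\<close>

definition vert_arr :: "('o, 'a) cat \<Rightarrow> ('o, 'a, 'x, 'm) indexed \<Rightarrow> 'o \<Rightarrow> 'm \<Rightarrow> ('a, 'm, 'x) garr" where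
  "vert_arr C D c u = (let x = Cod (fib D c) u in GArr (Idn C c) (coh_id D c x \<cdot>\<^bsub>fib D c\<^esub> u) x)"

text \<open>The cartesian arrow \<open>(f, 1) : (D(f)(x), c') \<rightarrow> (x, c)\<close>.\<close>

definition cart_arr :: "('o, 'a) cat \<Rightarrow> ('o, 'a, 'x, 'm) indexed \<Rightarrow> 'a \<Rightarrow> 'x \<Rightarrow> ('a, 'm, 'x) garr" where
  "cart_arr C D f x = GArr f (Idn (fib D (Dom C f)) (fob (reix D f) x)) x"

definition cartesian :: "('g, 'h) cat \<Rightarrow> ('o, 'a) cat \<Rightarrow> ('g, 'h, 'o, 'a) ftr \<Rightarrow> 'h \<Rightarrow> bool" where
  "cartesian G C p g \<longleftrightarrow> g \<in> Arr G \<and>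
     (\<forall>h\<in>Arr G. \<forall>k\<in>hom C (fob p (Dom G h)) (fob p (Dom G g)).
        Cod G h = Cod G g \<and> far p g \<cdot>\<^bsub>C\<^esub> k = far p h \<longrightarrow>
        (\<exists>!h'. h' \<in> hom G (Dom G h) (Dom G g) \<and> far p h' = k \<and> g \<cdot>\<^bsub>G\<^esub> h' = h))"

definition giraud ::
  "('o, 'a) cat \<Rightarrow> ('o \<Rightarrow> 'a set set) \<Rightarrow> ('o, 'a, 'x, 'm) indexed \<Rightarrow> 'x \<times> 'o \<Rightarrow> ('a, 'm, 'x) garr set set" where
  "giraud C J D d = {S. sieve (gcat C D) d S \<and>
     (\<exists>T\<subseteq>S. (\<forall>g\<in>T. cartesian (gcat C D) C proj g) \<and> gen_sieve C (base ` T) \<in> J (snd d))}"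

definition relative_site ::
  "('o, 'a) cat \<Rightarrow> ('o \<Rightarrow> 'a set set) \<Rightarrow> ('o, 'a, 'x, 'm) indexed \<Rightarrow>
   ('x \<times> 'o \<Rightarrow> ('a, 'm, 'x) garr set set) \<Rightarrow> bool" where
  "relative_site C J D K \<longleftrightarrow> site C J \<and> indexed_category C D \<and> site (gcat C D) K \<and>
     (\<forall>d\<in>Obj (gcat C D). giraud C J D d \<subseteq> K d)"

section \<open>Morphisms of local fibrations\<close>

definition morphism_of_local_fibrations ::
  "('o, 'a) cat \<Rightarrow> ('o \<Rightarrow> 'a set set) \<Rightarrow>
   ('o, 'a, 'x, 'm) indexed \<Rightarrow> ('x \<times> 'o \<Rightarrow> ('a, 'm, 'x) garr set set) \<Rightarrow>
   ('o, 'a, 'y, 'n) indexed \<Rightarrow> ('y \<times> 'o \<Rightarrow> ('a, 'n, 'y) garr set set) \<Rightarrow>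
   ('x \<times> 'o, ('a, 'm, 'x) garr, 'y \<times> 'o, ('a, 'n, 'y) garr) ftr \<Rightarrow> bool" where
  "morphism_of_local_fibrations C J D K D' K' A \<longleftrightarrow>
     functor_between (gcat C D) (gcat C D') A \<and>
     (\<exists>\<theta>. natural_iso (gcat C D) C (comp_ftr proj A) proj \<theta>) \<and>
     (\<forall>g. locally_cartesian (gcat C D) K C J proj g \<longrightarrow> locally_cartesian (gcat C D') K' C J proj (far A g))"

text \<open>Given \<open>\<theta> : p' A \<cong> p\<close>, the object \<open>A(d)\<close> lies over \<open>p'(A(d))\<close> rather than over \<open>p(d)\<close>. It is moved over
  \<open>p(d)\<close> along the cartesian lift of the inverse of \<open>\<theta>(d)\<close>, which is an isomorphism with target \<open>A(d)\<close>;
  conjugating with these isomorphisms turns \<open>A\<close> into a functor which commutes with the projections strictly.\<close>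

definition theta_lift ::
  "('o, 'a) cat \<Rightarrow> ('o, 'a, 'y, 'n) indexed \<Rightarrow> ('x \<times> 'o, ('a, 'm, 'x) garr, 'y \<times> 'o, ('a, 'n, 'y) garr) ftr \<Rightarrow>
   ('x \<times> 'o \<Rightarrow> 'a) \<Rightarrow> 'x \<times> 'o \<Rightarrow> ('a, 'n, 'y) garr" where
  "theta_lift C D' A \<theta> d = cart_arr C D' (inv_arr C (\<theta> d)) (fst (fob A d))"

definition strictify ::
  "('o, 'a) cat \<Rightarrow> ('o, 'a, 'x, 'm) indexed \<Rightarrow> ('o, 'a, 'y, 'n) indexed \<Rightarrow>
   ('x \<times> 'o, ('a, 'm, 'x) garr, 'y \<times> 'o, ('a, 'n, 'y) garr) ftr \<Rightarrow> ('x \<times> 'o \<Rightarrow> 'a) \<Rightarrow>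
   ('x \<times> 'o, ('a, 'm, 'x) garr, 'y \<times> 'o, ('a, 'n, 'y) garr) ftr" where
  "strictify C D D' A \<theta> = \<lparr>
     fob = (\<lambda>d. Dom (gcat C D') (theta_lift C D' A \<theta> d)),
     far = (\<lambda>g. inv_arr (gcat C D') (theta_lift C D' A \<theta> (Cod (gcat C D) g)) \<cdot>\<^bsub>gcat C D'\<^esub> far A g
                  \<cdot>\<^bsub>gcat C D'\<^esub> theta_lift C D' A \<theta> (Dom (gcat C D) g))\<rparr>"

text \<open>The component \<open>v\<^sub>f\<^sup>x : A\<^sub>c\<^sub>'(D(f)(x)) \<rightarrow> D'(f)(A\<^sub>c(x))\<close>, an arrow of the fibre of \<open>D'\<close> over the source of \<open>f\<close>.\<close>

definition v_comp ::
  "('o, 'a) cat \<Rightarrow> ('o, 'a, 'x, 'm) indexed \<Rightarrow> ('o, 'a, 'y, 'n) indexed \<Rightarrow>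
   ('x \<times> 'o, ('a, 'm, 'x) garr, 'y \<times> 'o, ('a, 'n, 'y) garr) ftr \<Rightarrow> ('x \<times> 'o \<Rightarrow> 'a) \<Rightarrow>
   'a \<Rightarrow> 'x \<Rightarrow> 'n" where
  "v_comp C D D' A \<theta> f x = fpart (far (strictify C D D' A \<theta>) (cart_arr C D f x))"

section \<open>Adequacy: the category of an indexed category\<close>

context category begin

lemma comp_simps:
  assumes "f \<in> Arr C" "g \<in> Arr C" "Cod C g = Dom C f"
  shows "f \<cdot> g \<in> Arr C" "Dom C (f \<cdot> g) = Dom C g" "Cod C (f \<cdot> g) = Cod C f"
  using comp_hom[OF assms] by (auto simp: hom_def)

lemma id_simps:
  assumes "c \<in> Obj C"
  shows "Idn C c \<in> Arr C" "Dom C (Idn C c) = c" "Cod C (Idn C c) = c"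
  using id_hom[OF assms] by (auto simp: hom_def)

lemma inverse_unique:
  assumes "inverse_arrows C f g" "inverse_arrows C f h" shows "g = h"
proof -
  have a: "f \<in> Arr C" "g \<in> Arr C" "h \<in> Arr C" "Dom C g = Cod C f" "Cod C g = Dom C f" "Dom C h = Cod C f" "Cod C h = Dom C f"
    "f \<cdot> h = Idn C (Cod C f)" "g \<cdot> f = Idn C (Dom C f)" using assms by (auto simp: inverse_arrows_def hom_def)
  have "g = g \<cdot> (f \<cdot> h)" using a id_right[of g] by simp
  also have "\<dots> = (g \<cdot> f) \<cdot> h" using a assoc[of g f h] by simp
  also have "\<dots> = h" using a id_left[of h] by simp
  finally show ?thesis .
qed

lemma inv_arrI:
  assumes "iso_arr C f" shows "inverse_arrows C f (inv_arr C f)"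
proof -
  obtain g where g: "inverse_arrows C f g" using assms by (auto simp: iso_arr_def)
  then show ?thesis unfolding inv_arr_def by (rule theI) (rule inverse_unique[OF _ g])
qed

lemma inv_arr_eq: "inverse_arrows C f g \<Longrightarrow> inv_arr C f = g"
  using inverse_unique inv_arrI by (metis iso_arr_def)

end

context indexed_category begin

lemma gcat_simps:
  "(x, c) \<in> Obj (gcat C D) \<longleftrightarrow> c \<in> Obj C \<and> x \<in> Obj (fib D c)"
  "GArr f u x \<in> Arr (gcat C D) \<longleftrightarrow> f \<in> Arr C \<and> x \<in> Obj (fib D (Cod C f)) \<and>
              u \<in> Arr (fib D (Dom C f)) \<and> Cod (fib D (Dom C f)) u = fob (reix D f) x"
  "Dom (gcat C D) (GArr f u x) = (Dom (fib D (Dom C f)) u, Dom C f)"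
  "Cod (gcat C D) (GArr f u x) = (x, Cod C f)"
  "Idn (gcat C D) (x, c) = GArr (Idn C c) (coh_id D c x) x"
  "GArr f u x \<cdot>\<^bsub>gcat C D\<^esub> GArr g w y = GArr (f \<cdot> g)
     (coh_comp D f g x \<cdot>\<^bsub>fib D (Dom C g)\<^esub> far (reix D g) u \<cdot>\<^bsub>fib D (Dom C g)\<^esub> w) x"
  by (simp_all add: gcat_def Let_def)

lemmas fdom = category.dom_obj[OF fib_category]
lemmas fcod = category.cod_obj[OF fib_category]

lemma fcomp:
  assumes "c \<in> Obj C" "u \<in> Arr (fib D c)" "w \<in> Arr (fib D c)" "Cod (fib D c) w = Dom (fib D c) u"
  shows "u \<cdot>\<^bsub>fib D c\<^esub> w \<in> Arr (fib D c)"
    "Dom (fib D c) (u \<cdot>\<^bsub>fib D c\<^esub> w) = Dom (fib D c) w"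
    "Cod (fib D c) (u \<cdot>\<^bsub>fib D c\<^esub> w) = Cod (fib D c) u"
  using category.comp_hom[OF fib_category[OF assms(1)] assms(2-4)] by (auto simp: hom_def)

lemma reix_simps:
  assumes "f \<in> Arr C" 
  shows "x \<in> Obj (fib D (Cod C f)) \<Longrightarrow> fob (reix D f) x \<in> Obj (fib D (Dom C f))"
    "u \<in> Arr (fib D (Cod C f)) \<Longrightarrow> far (reix D f) u \<in> Arr (fib D (Dom C f))"
    "u \<in> Arr (fib D (Cod C f)) \<Longrightarrow> Dom (fib D (Dom C f)) (far (reix D f) u) = fob (reix D f) (Dom (fib D (Cod C f)) u)"
    "u \<in> Arr (fib D (Cod C f)) \<Longrightarrow> Cod (fib D (Dom C f)) (far (reix D f) u) = fob (reix D f) (Cod (fib D (Cod C f)) u)"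
  using functor_between.fob_obj[OF reix_functor[OF assms]] functor_between.far_hom[OF reix_functor[OF assms]]
  by (auto simp: hom_def)

lemma coh_id_simps:
  assumes "c \<in> Obj C" "x \<in> Obj (fib D c)"
  shows "coh_id D c x \<in> Arr (fib D c)" "Dom (fib D c) (coh_id D c x) = x"
     "Cod (fib D c) (coh_id D c x) = fob (reix D (Idn C c)) x"
  using coh_id_natural_iso[OF assms(1)] assms(2) by (auto simp: natural_iso_def hom_def id_ftr_def)

lemma coh_comp_simps:
  assumes "f \<in> Arr C" "g \<in> Arr C" "Cod C g = Dom C f" "x \<in> Obj (fib D (Cod C f))"
  shows "coh_comp D f g x \<in> Arr (fib D (Dom C g))" 
    "Dom (fib D (Dom C g)) (coh_comp D f g x) = fob (reix D g) (fob (reix D f) x)"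
     "Cod (fib D (Dom C g)) (coh_comp D f g x) = fob (reix D (f \<cdot> g)) x"
  using coh_comp_natural_iso[OF assms(1-3)] assms(4) by (auto simp: natural_iso_def hom_def comp_ftr_def)

lemma natural_isoD:
  assumes "natural_iso A B F G t" "f \<in> Arr A"
  shows "t (Cod A f) \<cdot>\<^bsub>B\<^esub> far F f = far G f \<cdot>\<^bsub>B\<^esub> t (Dom A f)"
  using assms by (auto simp: natural_iso_def)

lemma gcat_comp_arr:
  assumes g: "g \<in> Arr (gcat C D)" and h: "h \<in> Arr (gcat C D)" and e: "Cod (gcat C D) h = Dom (gcat C D) g"
  shows "g \<cdot>\<^bsub>gcat C D\<^esub> h \<in> hom (gcat C D) (Dom (gcat C D) h) (Cod (gcat C D) g)"
proof -
  obtain f u x where G: "g = GArr f u x" by (cases g)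
  obtain k w y where H: "h = GArr k w y" by (cases h)
  have a: "f \<in> Arr C" "k \<in> Arr C" "Cod C k = Dom C f" "x \<in> Obj (fib D (Cod C f))" "y = Dom (fib D (Dom C f)) u"
    "u \<in> Arr (fib D (Dom C f))" "Cod (fib D (Dom C f)) u = fob (reix D f) x"
    "w \<in> Arr (fib D (Dom C k))" "Cod (fib D (Dom C k)) w = fob (reix D k) y"
    using g h e by (auto simp: G H gcat_simps)
  have d: "Dom C k \<in> Obj C" using a dom_obj by auto
  note m = coh_comp_simps[OF a(1-4)]
  have r: "far (reix D k) u \<in> Arr (fib D (Dom C k))" 
    "Dom (fib D (Dom C k)) (far (reix D k) u) = fob (reix D k) y"
    "Cod (fib D (Dom C k)) (far (reix D k) u) = fob (reix D k) (fob (reix D f) x)"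
    using reix_simps[OF a(2)] a by auto
  have p: "coh_comp D f k x \<cdot>\<^bsub>fib D (Dom C k)\<^esub> far (reix D k) u \<in> Arr (fib D (Dom C k))" 
    "Dom (fib D (Dom C k)) (coh_comp D f k x \<cdot>\<^bsub>fib D (Dom C k)\<^esub> far (reix D k) u) = fob (reix D k) y"
    "Cod (fib D (Dom C k)) (coh_comp D f k x \<cdot>\<^bsub>fib D (Dom C k)\<^esub> far (reix D k) u) = fob (reix D (f \<cdot> k)) x"
    using fcomp[OF d m(1) r(1)] m r by auto
  have q: "(coh_comp D f k x \<cdot>\<^bsub>fib D (Dom C k)\<^esub> far (reix D k) u) \<cdot>\<^bsub>fib D (Dom C k)\<^esub> w \<in> Arr (fib D (Dom C k))" 
    "Dom (fib D (Dom C k)) ((coh_comp D f k x \<cdot>\<^bsub>fib D (Dom C k)\<^esub> far (reix D k) u)\<cdot>\<^bsub>fib D (Dom C k)\<^esub> w) = Dom (fib D (Dom C k)) w"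
    "Cod (fib D (Dom C k)) ((coh_comp D f k x \<cdot>\<^bsub>fib D (Dom C k)\<^esub> far (reix D k) u)\<cdot>\<^bsub>fib D (Dom C k)\<^esub> w) = fob (reix D (f \<cdot> k)) x"
    using fcomp[OF d p(1) a(8)] p a by auto
  show ?thesis using q comp_simps[OF a(1-3)] a(4) by (simp add: G H gcat_simps hom_def)
qed

lemma gcat_assoc:
  assumes "g \<in> Arr (gcat C D)" "h \<in> Arr (gcat C D)" "i \<in> Arr (gcat C D)"
   "Cod (gcat C D) h = Dom (gcat C D) g" "Cod (gcat C D) i = Dom (gcat C D) h"
  shows "(g \<cdot>\<^bsub>gcat C D\<^esub> h) \<cdot>\<^bsub>gcat C D\<^esub> i = g \<cdot>\<^bsub>gcat C D\<^esub> (h \<cdot>\<^bsub>gcat C D\<^esub> i)"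
proof -
  obtain f u x where G: "g = GArr f u x" by (cases g)
  obtain k w y where H: "h = GArr k w y" by (cases h)
  obtain l v z where I: "i = GArr l v z" by (cases i)
  have a: "f \<in> Arr C" "k \<in> Arr C" "l \<in> Arr C" "Cod C k = Dom C f" "Cod C l = Dom C k"
     "x \<in> Obj (fib D (Cod C f))" and  y: "y = Dom (fib D (Dom C f)) u" and
    u: "u \<in> Arr (fib D (Dom C f))" "Cod (fib D (Dom C f)) u = fob (reix D f) x" and
    w: "w \<in> Arr (fib D (Dom C k))" "Cod (fib D (Dom C k)) w = fob (reix D k) y" and
    z: "z = Dom (fib D (Dom C k)) w" and
    v: "v \<in> Arr (fib D (Dom C l))" "Cod (fib D (Dom C l)) v = fob (reix D l) z"
    using assms by (auto simp: G H I gcat_simps)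
  have y': "y \<in> Obj (fib D (Cod C k))" using fdom[OF dom_obj[OF a(1)] u(1)] a y by simp
  let ?B = "fib D (Dom C l)"
  interpret B: category ?B using fib_category dom_obj a by blast
  interpret L: functor_between "fib D (Cod C l)" ?B "reix D l" using reix_functor a by blast
  have dl: "Dom C l \<in> Obj C" "Dom C k \<in> Obj C" using a dom_obj by auto
  have bcomp: "p \<in> Arr ?B \<Longrightarrow> q \<in> Arr ?B \<Longrightarrow> Cod ?B q = Dom ?B p \<Longrightarrow> p \<cdot>\<^bsub>?B\<^esub> q \<in> Arr ?B \<and> Dom ?B (p \<cdot>\<^bsub>?B\<^esub> q) = Dom ?B q \<and> Cod ?B (p \<cdot>\<^bsub>?B\<^esub> q) = Cod ?B p" for p q
    using fcomp[OF dl(1)] by auto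
  note ck = comp_simps[OF a(1,2,4)] and kl = comp_simps[OF a(2,3,5)]
  have m1: "coh_comp D f k x \<in> Arr (fib D (Cod C l))" 
    "Dom (fib D (Cod C l)) (coh_comp D f k x) = fob (reix D k) (fob (reix D f) x)"
     "Cod (fib D (Cod C l)) (coh_comp D f k x) = fob (reix D (f \<cdot> k)) x"
    using coh_comp_simps[OF a(1,2,4,6)] a by auto
  have m2: "coh_comp D (f \<cdot> k) l x \<in> Arr ?B" "Dom ?B (coh_comp D (f \<cdot> k) l x) = fob (reix D l) (fob (reix D (f \<cdot> k)) x)"
    using coh_comp_simps[OF ck(1) a(3), of x] ck a by auto
  have m3: "coh_comp D f (k \<cdot> l) x \<in> Arr ?B" "Dom ?B (coh_comp D f (k \<cdot> l) x) = fob (reix D (k \<cdot> l)) (fob (reix D f) x)"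
    using coh_comp_simps[OF a(1) kl(1), of x] kl a by auto
  have fx: "fob (reix D f) x \<in> Obj (fib D (Cod C k))" using reix_simps[OF a(1)] a by simp
  have m4: "coh_comp D k l (fob (reix D f) x) \<in> Arr ?B" "Dom ?B (coh_comp D k l (fob (reix D f) x)) = fob (reix D l) (fob (reix D k) (fob (reix D f) x))"
     "Cod ?B (coh_comp D k l (fob (reix D f) x)) = fob (reix D (k \<cdot> l)) (fob (reix D f) x)"
    using coh_comp_simps[OF a(2,3,5) fx] by auto
  have m5: "coh_comp D k l y \<in> Arr ?B" "Dom ?B (coh_comp D k l y) = fob (reix D l) (fob (reix D k) y)"
     "Cod ?B (coh_comp D k l y) = fob (reix D (k \<cdot> l)) y"
    using coh_comp_simps[OF a(2,3,5) y'] by auto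
  have uk: "u \<in> Arr (fib D (Cod C k))" using u a by simp
  have ku: "far (reix D k) u \<in> Arr (fib D (Cod C l))" "Dom (fib D (Cod C l)) (far (reix D k) u) = fob (reix D k) y"
     "Cod (fib D (Cod C l)) (far (reix D k) u) = fob (reix D k) (fob (reix D f) x)"
    using reix_simps[OF a(2)] uk u y a by auto
  have w': "w \<in> Arr (fib D (Cod C l))" "Cod (fib D (Cod C l)) w = fob (reix D k) y" "Dom (fib D (Cod C l)) w = z"
    using w z a by auto
  have lku: "far (reix D l) (far (reix D k) u) \<in> Arr ?B" "Dom ?B (far (reix D l) (far (reix D k) u)) = fob (reix D l) (fob (reix D k) y)"
     "Cod ?B (far (reix D l) (far (reix D k) u)) = fob (reix D l) (fob (reix D k) (fob (reix D f) x))"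
    using reix_simps[OF a(3)] ku by auto
  have lw: "far (reix D l) w \<in> Arr ?B" "Cod ?B (far (reix D l) w) = fob (reix D l) (fob (reix D k) y)"
      "Dom ?B (far (reix D l) w) = fob (reix D l) z"
    using reix_simps[OF a(3)] w' by auto
  have lm: "far (reix D l) (coh_comp D f k x) \<in> Arr ?B" 
      "Dom ?B (far (reix D l) (coh_comp D f k x)) = fob (reix D l) (fob (reix D k) (fob (reix D f) x))"
      "Cod ?B (far (reix D l) (coh_comp D f k x)) = fob (reix D l) (fob (reix D (f \<cdot> k)) x)"
    using reix_simps[OF a(3)] m1 by auto
  have klu: "far (reix D (k \<cdot> l)) u \<in> Arr ?B" "Dom ?B (far (reix D (k \<cdot> l)) u) = fob (reix D (k \<cdot> l)) y"
      "Cod ?B (far (reix D (k \<cdot> l)) u) = fob (reix D (k \<cdot> l)) (fob (reix D f) x)"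
    using reix_simps[OF kl(1)] kl uk u y a by auto
  have nat: "coh_comp D k l (fob (reix D f) x) \<cdot>\<^bsub>?B\<^esub> far (reix D l) (far (reix D k) u)
     = far (reix D (k \<cdot> l)) u \<cdot>\<^bsub>?B\<^esub> coh_comp D k l y"
    using natural_isoD[OF coh_comp_natural_iso[OF a(2,3,5)] uk] u y a by (simp add: comp_ftr_def)
  have c1: "coh_comp D f k x \<cdot>\<^bsub>fib D (Cod C l)\<^esub> far (reix D k) u \<in> Arr (fib D (Cod C l))"
     "Dom (fib D (Cod C l)) (coh_comp D f k x \<cdot>\<^bsub>fib D (Cod C l)\<^esub> far (reix D k) u) = fob (reix D k) y"
    using fcomp[OF cod_obj[OF a(3)] m1(1) ku(1)] m1 ku by auto
  have F: "far (reix D l) ((coh_comp D f k x \<cdot>\<^bsub>fib D (Cod C l)\<^esub> far (reix D k) u) \<cdot>\<^bsub>fib D (Cod C l)\<^esub> w)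
     = (far (reix D l) (coh_comp D f k x) \<cdot>\<^bsub>?B\<^esub> far (reix D l) (far (reix D k) u)) \<cdot>\<^bsub>?B\<^esub> far (reix D l) w"
    using L.far_comp[OF m1(1) ku(1)] L.far_comp[OF c1(1) w'(1)] m1 ku c1 w' by simp
  have A: "coh_comp D (f \<cdot> k) l x \<cdot>\<^bsub>?B\<^esub> far (reix D l) (coh_comp D f k x) = coh_comp D f (k \<cdot> l) x \<cdot>\<^bsub>?B\<^esub> coh_comp D k l (fob (reix D f) x)"
    using coh_assoc a by blast
  have "(coh_comp D (f \<cdot> k) l x \<cdot>\<^bsub>?B\<^esub> far (reix D l) ((coh_comp D f k x \<cdot>\<^bsub>fib D (Cod C l)\<^esub> far (reix D k) u) \<cdot>\<^bsub>fib D (Cod C l)\<^esub> w)) \<cdot>\<^bsub>?B\<^esub> v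
     = (coh_comp D (f \<cdot> k) l x \<cdot>\<^bsub>?B\<^esub> far (reix D l) (coh_comp D f k x)) \<cdot>\<^bsub>?B\<^esub> (far (reix D l) (far (reix D k) u) \<cdot>\<^bsub>?B\<^esub> (far (reix D l) w \<cdot>\<^bsub>?B\<^esub> v))"
    unfolding F by (simp add: B.assoc bcomp m2 lm lku lw v)
  also have "\<dots> = coh_comp D f (k \<cdot> l) x \<cdot>\<^bsub>?B\<^esub> ((coh_comp D k l (fob (reix D f) x) \<cdot>\<^bsub>?B\<^esub> far (reix D l) (far (reix D k) u)) \<cdot>\<^bsub>?B\<^esub> (far (reix D l) w \<cdot>\<^bsub>?B\<^esub> v))"
    unfolding A by (simp add: B.assoc bcomp m3 m4 lku lw v)
  also have "\<dots> = (coh_comp D f (k \<cdot> l) x \<cdot>\<^bsub>?B\<^esub> far (reix D (k \<cdot> l)) u) \<cdot>\<^bsub>?B\<^esub> ((coh_comp D k l y \<cdot>\<^bsub>?B\<^esub> far (reix D l) w) \<cdot>\<^bsub>?B\<^esub> v)"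
    unfolding nat by (simp add: B.assoc bcomp m3 m5 klu lw v)
  finally show ?thesis using assoc[OF a(1-5)] ck kl a(5)
    by (simp add: G H I gcat_simps)
qed

lemma category_gcat: "category (gcat C D)"
proof
  fix g assume "g \<in> Arr (gcat C D)"
  then obtain f u x where G: "g = GArr f u x" and f: "f \<in> Arr C" and x: "x \<in> Obj (fib D (Cod C f))" 
    and u: "u \<in> Arr (fib D (Dom C f))" "Cod (fib D (Dom C f)) u = fob (reix D f) x"
    by (cases g) (auto simp: gcat_simps)
  let ?B = "fib D (Dom C f)"
  interpret B: category ?B using fib_category dom_obj f by blast
  show "Dom (gcat C D) g \<in> Obj (gcat C D)" "Cod (gcat C D) g \<in> Obj (gcat C D)"
    using f x u by (auto simp: G gcat_simps dom_obj cod_obj intro: B.dom_obj)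
  note c = id_simps[OF cod_obj[OF f]] and d = id_simps[OF dom_obj[OF f]]
  have fx: "fob (reix D f) x \<in> Obj ?B" using reix_simps(1)[OF f x] .
  show "Idn (gcat C D) (Cod (gcat C D) g) \<cdot>\<^bsub>gcat C D\<^esub> g = g"
    using coh_unit_left[OF f x] id_left[OF f] B.id_left[OF u(1)] u
    by (simp add: G gcat_simps)
  have m: "coh_comp D f (Idn C (Dom C f)) x \<in> Arr ?B"
    "Dom ?B (coh_comp D f (Idn C (Dom C f)) x) = fob (reix D (Idn C (Dom C f))) (fob (reix D f) x)"
    using coh_comp_simps[OF f d(1) d(3) x] d by auto
  have ru: "far (reix D (Idn C (Dom C f))) u \<in> Arr ?B" 
    "Dom ?B (far (reix D (Idn C (Dom C f))) u) = fob (reix D (Idn C (Dom C f))) (Dom ?B u)"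
    "Cod ?B (far (reix D (Idn C (Dom C f))) u) = fob (reix D (Idn C (Dom C f))) (fob (reix D f) x)"
    using reix_simps[OF d(1)] d u by auto
  have n: "coh_id D (Dom C f) (fob (reix D f) x) \<cdot>\<^bsub>?B\<^esub> u = far (reix D (Idn C (Dom C f))) u \<cdot>\<^bsub>?B\<^esub> coh_id D (Dom C f) (Dom ?B u)"
    using natural_isoD[OF coh_id_natural_iso[OF dom_obj[OF f]] u(1)] u by (simp add: id_ftr_def)
  note i1 = coh_id_simps[OF dom_obj[OF f] fx] and i2 = coh_id_simps[OF dom_obj[OF f] B.dom_obj[OF u(1)]]
  have "(coh_comp D f (Idn C (Dom C f)) x \<cdot>\<^bsub>?B\<^esub> far (reix D (Idn C (Dom C f))) u) \<cdot>\<^bsub>?B\<^esub> coh_id D (Dom C f) (Dom ?B u)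
     = coh_comp D f (Idn C (Dom C f)) x \<cdot>\<^bsub>?B\<^esub> (coh_id D (Dom C f) (fob (reix D f) x) \<cdot>\<^bsub>?B\<^esub> u)"
    unfolding n using B.assoc[OF m(1) ru(1) i2(1)] m ru i2 by simp
  also have "\<dots> = (coh_comp D f (Idn C (Dom C f)) x \<cdot>\<^bsub>?B\<^esub> coh_id D (Dom C f) (fob (reix D f) x)) \<cdot>\<^bsub>?B\<^esub> u"
    using B.assoc[OF m(1) i1(1) u(1)] m i1 u by simp
  also have "\<dots> = u" using coh_unit_right[OF f x] B.id_left[OF u(1)] u by simp
  finally show "g \<cdot>\<^bsub>gcat C D\<^esub> Idn (gcat C D) (Dom (gcat C D) g) = g"
    using id_right[OF f] d by (simp add: G gcat_simps)
next
  fix d assume "d \<in> Obj (gcat C D)"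
  then obtain x c where "d = (x, c)" "c \<in> Obj C" "x \<in> Obj (fib D c)" by (cases d) (auto simp: gcat_simps)
  then show "Idn (gcat C D) d \<in> hom (gcat C D) d d"
    using id_simps[of c] coh_id_simps[of c x] by (simp add: gcat_simps hom_def)
qed (fact gcat_comp_arr gcat_assoc)+

lemma functor_between_proj: "functor_between (gcat C D) C proj"
proof -
  interpret G: category "gcat C D" by (rule category_gcat)
  show ?thesis
    by unfold_locales (auto simp: proj_def hom_def gcat_def Let_def)
qed

end

context indexed_category begin

lemma cart_arr_arr:
  assumes "f \<in> Arr C" "x \<in> Obj (fib D (Cod C f))"
  shows "cart_arr C D f x \<in> hom (gcat C D) (fob (reix D f) x, Dom C f) (x, Cod C f)" "base (cart_arr C D f x) = f"
  using assms category.id_simps[OF fib_category[OF dom_obj[OF assms(1)]] reix_simps(1)[OF assms]]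
  by (auto simp: cart_arr_def gcat_simps hom_def)

lemma comp_cart:
  assumes f: "f \<in> Arr C" "x \<in> Obj (fib D (Cod C f))" and k: "k \<in> Arr C" "Cod C k = Dom C f"
   and u: "u \<in> Arr (fib D (Dom C k))" "Cod (fib D (Dom C k)) u = fob (reix D k) (fob (reix D f) x)"
  shows "cart_arr C D f x \<cdot>\<^bsub>gcat C D\<^esub> GArr k u (fob (reix D f) x) = GArr (f \<cdot> k) (coh_comp D f k x \<cdot>\<^bsub>fib D (Dom C k)\<^esub> u) x"
proof -
  note m = coh_comp_simps[OF f(1) k f(2)]
  have "far (reix D k) (Idn (fib D (Dom C f)) (fob (reix D f) x)) = Idn (fib D (Dom C k)) (fob (reix D k) (fob (reix D f) x))"
    using functor_between.far_id[OF reix_functor[OF k(1)]] reix_simps(1)[OF f] k by simp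
  then show ?thesis
    using category.id_right[OF fib_category[OF dom_obj[OF k(1)]] m(1)] m by (simp add: cart_arr_def gcat_simps)
qed

lemma cartesian_cart_arr:
  assumes f: "f \<in> Arr C" "x \<in> Obj (fib D (Cod C f))"
  shows "cartesian (gcat C D) C proj (cart_arr C D f x)"
proof -
  have c: "cart_arr C D f x \<in> Arr (gcat C D)" "Cod (gcat C D) (cart_arr C D f x) = (x, Cod C f)"
    "Dom (gcat C D) (cart_arr C D f x) = (fob (reix D f) x, Dom C f)"
    using cart_arr_arr[OF f] by (auto simp: hom_def)
  show ?thesis unfolding cartesian_def c(2,3)
  proof (intro conjI ballI impI c(1))
    fix h k assume h: "h \<in> Arr (gcat C D)" and k: "k \<in> hom C (fob proj (Dom (gcat C D) h)) (fob proj (fob (reix D f) x, Dom C f))"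
      and e: "Cod (gcat C D) h = (x, Cod C f) \<and> far proj (cart_arr C D f x) \<cdot> k = far proj h"
    obtain b w z where H: "h = GArr b w z" by (cases h)
    have hb: "z = x" "b = f \<cdot> k" "k \<in> Arr C" "Dom C k = Dom C b" "Cod C k = Dom C f" "w \<in> Arr (fib D (Dom C b))"
      "Cod (fib D (Dom C b)) w = fob (reix D b) z"
      using h k e cart_arr_arr(2)[OF f] by (auto simp: H gcat_simps proj_def hom_def)
    note m = coh_comp_simps[OF f(1) hb(3,5) f(2)]
    let ?B = "fib D (Dom C k)" let ?m = "coh_comp D f k x"
    interpret B: category ?B using fib_category dom_obj hb by blast
    have "iso_arr ?B ?m" using coh_comp_natural_iso[OF f(1) hb(3,5)] f(2) by (auto simp: natural_iso_def)
    then have i: "inverse_arrows ?B ?m (inv_arr ?B ?m)" by (rule B.inv_arrI)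
    let ?u = "inv_arr ?B ?m \<cdot>\<^bsub>?B\<^esub> w"
    have ii: "inv_arr ?B ?m \<in> Arr ?B" "Dom ?B (inv_arr ?B ?m) = fob (reix D b) x" "Cod ?B (inv_arr ?B ?m) = fob (reix D k) (fob (reix D f) x)"
      "?m \<cdot>\<^bsub>?B\<^esub> inv_arr ?B ?m = Idn ?B (fob (reix D b) x)" "inv_arr ?B ?m \<cdot>\<^bsub>?B\<^esub> ?m = Idn ?B (fob (reix D k) (fob (reix D f) x))"
      using i m hb by (auto simp: inverse_arrows_def hom_def)
    have w: "w \<in> Arr ?B" "Cod ?B w = fob (reix D b) x" using hb by auto
    have u: "?u \<in> Arr ?B" "Cod ?B ?u = fob (reix D k) (fob (reix D f) x)" "Dom ?B ?u = Dom ?B w"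
      using B.comp_simps[OF ii(1) w(1)] ii w by auto
    have mu: "?m \<cdot>\<^bsub>?B\<^esub> ?u = w" using B.assoc[OF m(1) ii(1) w(1)] m ii w B.id_left[OF w(1)] by simp
    show "\<exists>!h'. h' \<in> hom (gcat C D) (Dom (gcat C D) h) (fob (reix D f) x, Dom C f) \<and> far proj h' = k \<and> cart_arr C D f x \<cdot>\<^bsub>gcat C D\<^esub> h' = h"
    proof (rule ex1I[of _ "GArr k ?u (fob (reix D f) x)"])
      show "GArr k ?u (fob (reix D f) x) \<in> hom (gcat C D) (Dom (gcat C D) h) (fob (reix D f) x, Dom C f) \<and>
        far proj (GArr k ?u (fob (reix D f) x)) = k \<and> cart_arr C D f x \<cdot>\<^bsub>gcat C D\<^esub> GArr k ?u (fob (reix D f) x) = h"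
        using u hb comp_cart[OF f hb(3,5) u(1,2)] mu reix_simps(1)[OF f]
        by (auto simp: hom_def H gcat_simps proj_def)
      fix h' assume h': "h' \<in> hom (gcat C D) (Dom (gcat C D) h) (fob (reix D f) x, Dom C f) \<and> far proj h' = k \<and> cart_arr C D f x \<cdot>\<^bsub>gcat C D\<^esub> h' = h"
      obtain k' v y where H': "h' = GArr k' v y" by (cases h')
      have v: "k' = k" "y = fob (reix D f) x" "v \<in> Arr ?B" "Cod ?B v = fob (reix D k) (fob (reix D f) x)"
        using h' by (auto simp: H' gcat_simps hom_def proj_def)
      have "?m \<cdot>\<^bsub>?B\<^esub> v = w" using h' hb(1) comp_cart[OF f hb(3,5) v(3,4)] by (auto simp: H' H v)
      then have "v = ?u" using B.assoc[OF ii(1) m(1) v(3)] ii m v B.id_left[OF v(3)] hb by simp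
      then show "h' = GArr k ?u (fob (reix D f) x)" by (simp add: H' v)
    qed
  qed
qed

lemma base_comp: "g \<in> Arr (gcat C D) \<Longrightarrow> h \<in> Arr (gcat C D) \<Longrightarrow> base (g \<cdot>\<^bsub>gcat C D\<^esub> h) = base g \<cdot> base h"
  by (cases g; cases h) (simp add: gcat_simps)

lemma iso_cart_arr:
  assumes f: "iso_arr C f" "x \<in> Obj (fib D (Cod C f))"
  shows "iso_arr (gcat C D) (cart_arr C D f x)" 
proof -
  interpret G: category "gcat C D" by (rule category_gcat)
  have i: "inverse_arrows C f (inv_arr C f)" using inv_arrI[OF f(1)] .
  let ?k = "inv_arr C f" let ?c = "cart_arr C D f x"
  have k: "f \<in> Arr C" "?k \<in> Arr C" "Dom C ?k = Cod C f" "Cod C ?k = Dom C f" "f \<cdot> ?k = Idn C (Cod C f)" "?k \<cdot> f = Idn C (Dom C f)"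
    using i by (auto simp: inverse_arrows_def hom_def)
  have c: "?c \<in> Arr (gcat C D)" "Cod (gcat C D) ?c = (x, Cod C f)" "Dom (gcat C D) ?c = (fob (reix D f) x, Dom C f)" "base ?c = f"
    using cart_arr_arr[OF k(1) f(2)] by (auto simp: hom_def)
  have U: "h \<in> Arr (gcat C D) \<Longrightarrow> k \<in> hom C (snd (Dom (gcat C D) h)) (snd (Dom (gcat C D) ?c)) \<Longrightarrow>
    Cod (gcat C D) h = Cod (gcat C D) ?c \<Longrightarrow> far proj ?c \<cdot> k = far proj h \<Longrightarrow>
    (\<exists>!h'. h' \<in> hom (gcat C D) (Dom (gcat C D) h) (Dom (gcat C D) ?c) \<and> far proj h' = k \<and> ?c \<cdot>\<^bsub>gcat C D\<^esub> h' = h)" for h k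
    using cartesian_cart_arr[OF k(1) f(2)] unfolding cartesian_def by (simp add: proj_def)
  have xo: "(x, Cod C f) \<in> Obj (gcat C D)" using G.cod_obj[OF c(1)] c by simp
  note I = G.id_simps[OF xo]
  have bI: "base (Idn (gcat C D) (y, d)) = Idn C d" for y d by (simp add: gcat_simps)
  have "\<exists>!h'. h' \<in> hom (gcat C D) (Dom (gcat C D) (Idn (gcat C D) (x, Cod C f))) (Dom (gcat C D) ?c) \<and> far proj h' = ?k \<and> ?c \<cdot>\<^bsub>gcat C D\<^esub> h' = Idn (gcat C D) (x, Cod C f)"
    by (rule U) (use I c k in \<open>auto simp: proj_def hom_def bI\<close>)
  then obtain s where s: "s \<in> hom (gcat C D) (x, Cod C f) (Dom (gcat C D) ?c)" "base s = ?k" "?c \<cdot>\<^bsub>gcat C D\<^esub> s = Idn (gcat C D) (x, Cod C f)"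
    unfolding I by (auto simp: proj_def)
  have S: "s \<in> Arr (gcat C D)" "Dom (gcat C D) s = (x, Cod C f)" "Cod (gcat C D) s = Dom (gcat C D) ?c" using s by (auto simp: hom_def)
  have sc: "s \<cdot>\<^bsub>gcat C D\<^esub> ?c \<in> Arr (gcat C D)" "Dom (gcat C D) (s \<cdot>\<^bsub>gcat C D\<^esub> ?c) = Dom (gcat C D) ?c" "Cod (gcat C D) (s \<cdot>\<^bsub>gcat C D\<^esub> ?c) = Dom (gcat C D) ?c"
    using G.comp_simps[OF S(1) c(1)] S c by auto
  have csc: "?c \<cdot>\<^bsub>gcat C D\<^esub> (s \<cdot>\<^bsub>gcat C D\<^esub> ?c) = ?c"
    using G.assoc[OF c(1) S(1) c(1)] S c s G.id_left[OF c(1)] by simp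
  note Ic = G.id_simps[OF G.dom_obj[OF c(1)]]
  have "\<exists>!h'. h' \<in> hom (gcat C D) (Dom (gcat C D) ?c) (Dom (gcat C D) ?c) \<and> far proj h' = Idn C (Dom C f) \<and> ?c \<cdot>\<^bsub>gcat C D\<^esub> h' = ?c"
    by (rule U) (use c k id_right[OF k(1)] id_simps[OF dom_obj[OF k(1)]] in \<open>auto simp: proj_def hom_def\<close>)
  moreover have "s \<cdot>\<^bsub>gcat C D\<^esub> ?c \<in> hom (gcat C D) (Dom (gcat C D) ?c) (Dom (gcat C D) ?c) \<and> far proj (s \<cdot>\<^bsub>gcat C D\<^esub> ?c) = Idn C (Dom C f) \<and> ?c \<cdot>\<^bsub>gcat C D\<^esub> (s \<cdot>\<^bsub>gcat C D\<^esub> ?c) = ?c"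
    using sc csc base_comp[OF S(1) c(1)] s c k by (simp add: hom_def proj_def)
  moreover have "Idn (gcat C D) (Dom (gcat C D) ?c) \<in> hom (gcat C D) (Dom (gcat C D) ?c) (Dom (gcat C D) ?c) \<and> far proj (Idn (gcat C D) (Dom (gcat C D) ?c)) = Idn C (Dom C f) \<and> ?c \<cdot>\<^bsub>gcat C D\<^esub> Idn (gcat C D) (Dom (gcat C D) ?c) = ?c"
    using Ic G.id_right[OF c(1)] c(3) bI by (simp add: hom_def proj_def)
  ultimately have "s \<cdot>\<^bsub>gcat C D\<^esub> ?c = Idn (gcat C D) (Dom (gcat C D) ?c)" by blast
  then have "inverse_arrows (gcat C D) ?c s" using s S c by (simp add: inverse_arrows_def hom_def)
  then show ?thesis by (auto simp: iso_arr_def)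
qed

lemma vert_arr_arr:
  assumes "c \<in> Obj C" "u \<in> Arr (fib D c)"
  shows "vert_arr C D c u \<in> hom (gcat C D) (Dom (fib D c) u, c) (Cod (fib D c) u, c)" "vertical C D (vert_arr C D c u)"
proof -
  interpret B: category "fib D c" using fib_category assms by blast
  note i = coh_id_simps[OF assms(1) B.cod_obj[OF assms(2)]]
  show "vert_arr C D c u \<in> hom (gcat C D) (Dom (fib D c) u, c) (Cod (fib D c) u, c)"
    using assms B.comp_simps[OF i(1) assms(2)] i id_simps[OF assms(1)] B.cod_obj[OF assms(2)]
    by (simp add: hom_def vert_arr_def Let_def gcat_simps)
  then show "vertical C D (vert_arr C D c u)" using assms(1)
    by (auto simp: vertical_def hom_def vert_arr_def Let_def)
qed

lemma factorization:
  assumes g: "g \<in> Arr (gcat C D)"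
  shows "g = cart_arr C D (base g) (tgt g) \<cdot>\<^bsub>gcat C D\<^esub> vert_arr C D (Dom C (base g)) (fpart g)"
proof -
  obtain f u x where G: "g = GArr f u x" by (cases g)
  have a: "f \<in> Arr C" "x \<in> Obj (fib D (Cod C f))" "u \<in> Arr (fib D (Dom C f))" "Cod (fib D (Dom C f)) u = fob (reix D f) x"
    using g by (auto simp: G gcat_simps)
  let ?B = "fib D (Dom C f)"
  interpret B: category ?B using fib_category dom_obj a by blast
  note d = id_simps[OF dom_obj[OF a(1)]]
  note i = coh_id_simps[OF dom_obj[OF a(1)] B.cod_obj[OF a(3)]]
  note iu = B.comp_simps[OF i(1) a(3)]
  note m = coh_comp_simps[OF a(1) d(1) d(3) a(2)]
  have "cart_arr C D f x \<cdot>\<^bsub>gcat C D\<^esub> vert_arr C D (Dom C f) u = GArr f (coh_comp D f (Idn C (Dom C f)) x \<cdot>\<^bsub>?B\<^esub> (coh_id D (Dom C f) (fob (reix D f) x) \<cdot>\<^bsub>?B\<^esub> u)) x"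
    using comp_cart[OF a(1,2) d(1) d(3), of "coh_id D (Dom C f) (fob (reix D f) x) \<cdot>\<^bsub>?B\<^esub> u"] d iu i a(4) id_right[OF a(1)]
    by (simp add: vert_arr_def Let_def)
  also have "coh_comp D f (Idn C (Dom C f)) x \<cdot>\<^bsub>?B\<^esub> (coh_id D (Dom C f) (fob (reix D f) x) \<cdot>\<^bsub>?B\<^esub> u) = u"
    using B.assoc[OF m(1)[unfolded d] i(1) a(3)] m i a d coh_unit_right[OF a(1,2)] B.id_left[OF a(3)] by simp
  finally show ?thesis by (simp add: G)
qed

end

section \<open>Adequacy: pullbacks of sheaves\<close>

lemma psh_morD:
  assumes "psh_mor C P Q t"
  shows "c \<in> Obj C \<Longrightarrow> x \<in> val P c \<Longrightarrow> t c x \<in> val Q c"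
    and "f \<in> Arr C \<Longrightarrow> x \<in> val P (Cod C f) \<Longrightarrow> t (Dom C f) (res P f x) = res Q f (t (Cod C f) x)"
  using assms by (auto simp: psh_mor_def)

lemma psh_mor_comp:
  assumes "category C" "presheaf C P" "psh_mor C P Q s" "psh_mor C Q R t" shows "psh_mor C P R (psh_comp t s)"
  using assms(3,4) category.dom_obj[OF assms(1)] category.cod_obj[OF assms(1)] 
  by (auto simp: psh_mor_def psh_comp_def)

definition transport :: "('o, 'a) cat \<Rightarrow> ('o, 'a, 'v) psh \<Rightarrow> ('o \<Rightarrow> 'v \<Rightarrow> 'w) \<Rightarrow> ('o, 'a, 'w) psh" where
  "transport C P e = \<lparr>val = (\<lambda>c. e c ` val P c),
     res = (\<lambda>f y. e (Dom C f) (res P f (inv_into (val P (Cod C f)) (e (Cod C f)) y)))\<rparr>"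

lemma transport_simps:
  assumes "inj_on (e (Cod C f)) (val P (Cod C f))"
  shows "x \<in> val P (Cod C f) \<Longrightarrow> res (transport C P e) f (e (Cod C f) x) = e (Dom C f) (res P f x)"
  using assms by (simp add: transport_def inv_into_f_f)

lemma val_transport: "val (transport C P e) c = e c ` val P c"
  by (simp add: transport_def)


context site begin

lemma cover_arr:
  assumes "c \<in> Obj C" "S \<in> J c" "f \<in> S"
  shows "f \<in> Arr C" "Cod C f = c" "Dom C f \<in> Obj C"
  using cover_sieve[OF assms(1,2)] assms(3) dom_obj by (auto simp: sieve_def)

lemma cover_comp:
  assumes "c \<in> Obj C" "S \<in> J c" "f \<in> S" "g \<in> Arr C" "Cod C g = Dom C f"
  shows "f \<cdot> g \<in> S"
  using cover_sieve[OF assms(1,2)] assms(3-) by (auto simp: sieve_def)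

lemma sieve_pull:
  assumes "sieve C c S" "f \<in> Arr C" "Cod C f = c" shows "sieve C (Dom C f) (pull_sieve C f S)"
  unfolding sieve_def
proof safe
  fix g assume "g \<in> pull_sieve C f S"
  then show "g \<in> Arr C" "Cod C g = Dom C f" by (auto simp: pull_sieve_def)
next
  fix g h assume g: "g \<in> pull_sieve C f S" and h: "h \<in> Arr C" "Cod C h = Dom C g"
  then have "g \<in> Arr C" "Cod C g = Dom C f" "f \<cdot> g \<in> S" by (auto simp: pull_sieve_def)
  moreover have "(f \<cdot> g) \<cdot> h \<in> S" using calculation assms h comp_simps[of f g] by (auto simp: sieve_def)
  ultimately show "g \<cdot> h \<in> pull_sieve C f S"
    using assoc[of f g h] h assms comp_simps[of g h] by (auto simp: pull_sieve_def)
qed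

lemma cover_superset:
  assumes "c \<in> Obj C" "S \<in> J c" "sieve C c R" "S \<subseteq> R" shows "R \<in> J c"
proof (rule cover_trans[OF assms(1-3)])
  fix f assume f: "f \<in> S"
  have "pull_sieve C f R = max_sieve C (Dom C f)"
    using f cover_comp[OF assms(1,2) f] assms(4) by (auto simp: pull_sieve_def max_sieve_def)
  then show "pull_sieve C f R \<in> J (Dom C f)" using cover_max cover_arr[OF assms(1,2) f] by simp
qed

lemma cover_inter:
  assumes "c \<in> Obj C" "S \<in> J c" "R \<in> J c" shows "S \<inter> R \<in> J c"
proof (rule cover_trans[OF assms(1,2)])
  show "sieve C c (S \<inter> R)" using cover_sieve[OF assms(1,2)] cover_sieve[OF assms(1,3)] by (auto simp: sieve_def)
  fix f assume f: "f \<in> S"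
  note a = cover_arr[OF assms(1,2) f]
  have "pull_sieve C f (S \<inter> R) = pull_sieve C f R"
    using cover_comp[OF assms(1,2) f] by (auto simp: pull_sieve_def)
  then show "pull_sieve C f (S \<inter> R) \<in> J (Dom C f)" using cover_pull[OF a(1)] assms(3) a by simp
qed

end

lemma (in sheaf) separated:
  assumes "c \<in> Obj C" "S \<in> J c" "x \<in> val P c" "y \<in> val P c" "\<And>f. f \<in> S \<Longrightarrow> res P f x = res P f y"
  shows "x = y"
proof -
  note ca = cover_arr[OF assms(1,2)]
  let ?m = "\<lambda>f. if f \<in> S then Some (res P f x) else None"
  have d: "dom ?m = S" by (auto simp: dom_def split: if_splits)
  have M: "matching C P ?m" unfolding matching_def d
    using cover_comp[OF assms(1,2)] ca res_val res_comp assms(3) by auto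
  have "\<exists>!z. z \<in> val P c \<and> (\<forall>f\<in>S. ?m f = Some (res P f z))"
    using glue[OF assms(1), of ?m, unfolded d, OF assms(2) M] .
  moreover have "\<forall>f\<in>S. ?m f = Some (res P f x)" "\<forall>f\<in>S. ?m f = Some (res P f y)" using assms(5) by auto
  ultimately show ?thesis using assms(3,4) by metis
qed

lemma (in sheaf) glue_obtain:
  assumes "c \<in> Obj C" "dom m \<in> J c" "matching C P m"
  obtains x where "x \<in> val P c" "\<And>f. f \<in> dom m \<Longrightarrow> m f = Some (res P f x)"
  using ex1_implies_ex[OF glue[OF assms]] by (elim exE conjE) (rule that, auto)

lemma (in sheaf) glue_unique:
  assumes "c \<in> Obj C" "dom m \<in> J c" "x \<in> val P c" "\<And>f. f \<in> dom m \<Longrightarrow> m f = Some (res P f x)"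
    "y \<in> val P c" "\<And>f. f \<in> dom m \<Longrightarrow> m f = Some (res P f y)"
  shows "x = y"
proof (rule separated[OF assms(1,2,3,5)])
  fix f assume "f \<in> dom m" then show "res P f x = res P f y" using assms(4,6)[of f] by simp
qed

lemma (in sheaf) sheaf_transport:
  assumes inj: "\<And>c. c \<in> Obj C \<Longrightarrow> inj_on (e c) (val P c)"
  shows "sheaf C J (transport C P e)"
proof unfold_locales
  note T = transport_simps[where e = e and C = C and P = P, OF inj[OF cod_obj]]
  show "res (transport C P e) f x \<in> val (transport C P e) (Dom C f)"
    if "f \<in> Arr C" "x \<in> val (transport C P e) (Cod C f)" for f x
    using that res_val by (auto simp: val_transport T)
  show "res (transport C P e) (Idn C c) x = x" if "c \<in> Obj C" "x \<in> val (transport C P e) c" for c x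
    using that T[of "Idn C c"] id_hom[of c] res_id[of c] by (auto simp: val_transport hom_def)
  show "res (transport C P e) (f \<cdot> g) x = res (transport C P e) g (res (transport C P e) f x)"
    if fg: "f \<in> Arr C" "g \<in> Arr C" "Cod C g = Dom C f" and xx: "x \<in> val (transport C P e) (Cod C f)" for f g x
  proof -
    obtain y where y: "x = e (Cod C f) y" "y \<in> val P (Cod C f)" using xx by (auto simp: val_transport)
    have c: "f \<cdot> g \<in> Arr C" "Dom C (f \<cdot> g) = Dom C g" "Cod C (f \<cdot> g) = Cod C f"
      using comp_hom[OF fg] by (auto simp: hom_def)
    show ?thesis using y T[OF fg(1), of y] T[OF c(1), of y] T[OF fg(2), of "res P f y"] c fg
      res_val[OF fg(1), of y] res_comp[OF fg, of y] by simp
  qed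
  fix c m assume c: "c \<in> Obj C" and m: "dom m \<in> J c" "matching C (transport C P e) m"
  note ca = cover_arr[OF c m(1)]
  define n where "n = (\<lambda>f. map_option (inv_into (val P (Dom C f)) (e (Dom C f))) (m f))"
  have d: "dom n = dom m" by (auto simp: n_def dom_def)
  have n: "\<exists>x. n f = Some x \<and> x \<in> val P (Dom C f) \<and> m f = Some (e (Dom C f) x)" if "f \<in> dom m" for f
  proof -
    have "the (m f) \<in> e (Dom C f) ` val P (Dom C f)" using m(2) that by (auto simp: matching_def val_transport)
    then show ?thesis using that inj[OF ca(3)[OF that]] by (auto simp: n_def inv_into_f_f)
  qed
  have "matching C P n" unfolding matching_def d
  proof safe
    fix f g y assume f: "m f = Some y" and g: "g \<in> Arr C" "Cod C g = Dom C f"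
    then have fd: "f \<in> dom m" by auto
    obtain x where x: "n f = Some x" "x \<in> val P (Dom C f)" "m f = Some (e (Dom C f) x)" using n[OF fd] by auto
    have fg: "f \<cdot> g \<in> dom m" "Dom C (f \<cdot> g) = Dom C g"
      using cover_comp[OF c m(1) fd g] comp_simps[OF ca(1)[OF fd] g] by auto
    obtain x' where x': "n (f \<cdot> g) = Some x'" "x' \<in> val P (Dom C g)" "m (f \<cdot> g) = Some (e (Dom C g) x')"
      using n[OF fg(1)] fg by auto
    have "e (Dom C g) x' = e (Dom C g) (res P g x)"
      using m(2) fd g x x' T[OF g(1), of x] by (auto simp: matching_def)
    then have "x' = res P g x" using inj[OF dom_obj[OF g(1)]] x' x res_val[OF g(1), of x] g
      by (auto dest: inj_onD)
    then show "n (f \<cdot> g) = map_option (res P g) (n f)" using x x' by simp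
  qed (use n in fastforce)
  then obtain x where x: "x \<in> val P c" "\<And>f. f \<in> dom m \<Longrightarrow> n f = Some (res P f x)"
    using glue_obtain[OF c, of n, unfolded d, OF m(1)] by blast
  have u: "x' = x" if "x' \<in> val P c" "\<And>f. f \<in> dom m \<Longrightarrow> n f = Some (res P f x')" for x'
    using glue_unique[OF c, of n, unfolded d, OF m(1) that x] by blast
  show "\<exists>!x. x \<in> val (transport C P e) c \<and> (\<forall>f\<in>dom m. m f = Some (res (transport C P e) f x))"
  proof (rule ex1I[of _ "e c x"], safe)
    show "e c x \<in> val (transport C P e) c" using x by (simp add: val_transport)
    fix f y assume f: "m f = Some y"
    then have fd: "f \<in> dom m" by auto
    show "m f = Some (res (transport C P e) f (e c x))" using n[OF fd] x(2)[OF fd] T[OF ca(1)[OF fd], of x] ca[OF fd] x(1) by auto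
  next
    fix y assume y: "y \<in> val (transport C P e) c" "\<forall>f\<in>dom m. m f = Some (res (transport C P e) f y)"
    then obtain x' where x': "y = e c x'" "x' \<in> val P c" by (auto simp: val_transport)
    have "n f = Some (res P f x')" if "f \<in> dom m" for f
    proof -
      have "m f = Some (e (Dom C f) (res P f x'))" using y(2) x' that T[OF ca(1)[OF that], of x'] ca[OF that] by auto
      then show ?thesis using n[OF that] inj[OF ca(3)[OF that]] res_val[OF ca(1)[OF that], of x'] x' ca[OF that] 
        by (auto dest: inj_onD)
    qed
    then show "y = e c x" using u x' by simp
  qed
qed

lemma psh_iso_transport:
  assumes "category C" and inj: "\<And>c. c \<in> Obj C \<Longrightarrow> inj_on (e c) (val P c)" and P: "presheaf C P"
  shows "psh_mor C P (transport C P e) e" "psh_mor C (transport C P e) P (\<lambda>c. inv_into (val P c) (e c))"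
    "c \<in> Obj C \<Longrightarrow> x \<in> val P c \<Longrightarrow> inv_into (val P c) (e c) (e c x) = x"
proof -
  interpret category C by fact
  interpret presheaf C P by fact
  note T = transport_simps[where e = e and C = C and P = P, OF inj[OF cod_obj]]
  show "psh_mor C P (transport C P e) e" by (auto simp: psh_mor_def val_transport T)
  have I: "inv_into (val P c) (e c) (e c x) = x" if "c \<in> Obj C" "x \<in> val P c" for c x
    using inj[OF that(1)] that(2) by (rule inv_into_f_f)
  show "psh_mor C (transport C P e) P (\<lambda>c. inv_into (val P c) (e c))"
    unfolding psh_mor_def val_transport using I T res_val dom_obj cod_obj by force
  show "c \<in> Obj C \<Longrightarrow> x \<in> val P c \<Longrightarrow> inv_into (val P c) (e c) (e c x) = x" by (rule I)
qed

definition fibre_prod :: "('o, 'a, 'u) psh \<Rightarrow> ('o, 'a, 'v) psh \<Rightarrow> ('o \<Rightarrow> 'u \<Rightarrow> 'w) \<Rightarrow> ('o \<Rightarrow> 'v \<Rightarrow> 'w) \<Rightarrow> ('o, 'a, 'u \<times> 'v) psh" where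
  "fibre_prod A B f g = \<lparr>val = (\<lambda>c. {(x, y). x \<in> val A c \<and> y \<in> val B c \<and> f c x = g c y}), res = (\<lambda>h (x, y). (res A h x, res B h y))\<rparr>"

lemma sheaf_fibre_prod:
  assumes A: "sheaf C J A" and B: "sheaf C J B" and E: "sheaf C J E" and f: "psh_mor C A E f" and g: "psh_mor C B E g"
  shows "sheaf C J (fibre_prod A B f g)"
proof -
  interpret A: sheaf C J A by fact
  interpret B: sheaf C J B by fact
  interpret E: sheaf C J E by fact
  note fD = psh_morD[OF f] and gD = psh_morD[OF g]
  show ?thesis
  proof unfold_locales
    fix c m assume c: "c \<in> Obj C" and d: "dom m \<in> J c" and m: "matching C (fibre_prod A B f g) m"
    note ca = A.cover_arr[OF c d]
    let ?a = "\<lambda>f. map_option fst (m f)" and ?b = "\<lambda>f. map_option snd (m f)"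
    have da: "dom ?a = dom m" "dom ?b = dom m" by (auto simp: dom_def)
    have v: "the (m h) \<in> val (fibre_prod A B f g) (Dom C h)" if "h \<in> dom m" for h 
      using m that by (auto simp: matching_def)
    have r: "m (h \<cdot>\<^bsub>C\<^esub> k) = map_option (res (fibre_prod A B f g) k) (m h)" if "h \<in> dom m" "k \<in> Arr C" "Cod C k = Dom C h" for h k
      using m that by (auto simp: matching_def)
    have M: "matching C A ?a" "matching C B ?b" unfolding matching_def da
      using v r by (fastforce simp: fibre_prod_def)+
    obtain x where x: "x \<in> val A c" "\<And>f. f \<in> dom m \<Longrightarrow> ?a f = Some (res A f x)"
      using A.glue_obtain[OF c, of ?a, unfolded da, OF d M(1)] by blast
    obtain y where y: "y \<in> val B c" "\<And>f. f \<in> dom m \<Longrightarrow> ?b f = Some (res B f y)"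
      using B.glue_obtain[OF c, of ?b, unfolded da, OF d M(2)] by blast
    have ux: "x' = x" if "x' \<in> val A c" "\<And>f. f \<in> dom m \<Longrightarrow> ?a f = Some (res A f x')" for x'
      using A.glue_unique[OF c, of ?a, unfolded da, OF d that x] by blast
    have uy: "y' = y" if "y' \<in> val B c" "\<And>f. f \<in> dom m \<Longrightarrow> ?b f = Some (res B f y')" for y'
      using B.glue_unique[OF c, of ?b, unfolded da, OF d that y] by blast
    have m1: "m h = Some (res A h x, res B h y)" if hd: "h \<in> dom m" for h
    proof -
      obtain z where z: "m h = Some z" using hd by auto
      show ?thesis using z x(2)[OF hd] y(2)[OF hd] by (cases z) auto
    qed
    have "f c x = g c y"
    proof (rule E.separated[OF c d])
      show "f c x \<in> val E c" "g c y \<in> val E c" using fD gD c x y by auto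
      fix h assume h: "h \<in> dom m"
      show "res E h (f c x) = res E h (g c y)"
        using fD(2)[OF ca(1)[OF h], of x] gD(2)[OF ca(1)[OF h], of y] ca[OF h] x y v[OF h] m1[OF h] by (simp add: fibre_prod_def)
    qed
    then have ex: "(x, y) \<in> val (fibre_prod A B f g) c" "\<forall>h\<in>dom m. m h = Some (res (fibre_prod A B f g) h (x, y))"
      using x(1) y(1) m1 by (auto simp: fibre_prod_def)
    show "\<exists>!x. x \<in> val (fibre_prod A B f g) c \<and> (\<forall>h\<in>dom m. m h = Some (res (fibre_prod A B f g) h x))"
    proof (rule ex1I[of _ "(x, y)"])
      fix z assume z: "z \<in> val (fibre_prod A B f g) c \<and> (\<forall>h\<in>dom m. m h = Some (res (fibre_prod A B f g) h z))"
      obtain x' y' where zz: "z = (x', y')" by (cases z)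
      have "x' = x" by (rule ux) (use z in \<open>auto simp: zz fibre_prod_def\<close>)
      moreover have "y' = y" by (rule uy) (use z in \<open>auto simp: zz fibre_prod_def\<close>)
      ultimately show "z = (x, y)" by (simp add: zz)
    qed (use ex in blast)
  qed (use fD gD A.res_val B.res_val A.res_id B.res_id A.res_comp B.res_comp in \<open>auto simp: fibre_prod_def\<close>)
qed

lemma sheaf_pullback_universal:
  fixes Z :: "('o, 'a, 'z) psh" and P :: "('o, 'a, 't) psh" and A :: "('o, 'a, 'u) psh" and B :: "('o, 'a, 'v) psh"
  assumes pb: "sheaf_pullback C J P A B E a b f g"
    and Z: "sheaf C J Z" "psh_mor C Z A s" "psh_mor C Z B t" "psh_eq C Z (psh_comp f s) (psh_comp g t)"
  shows "\<exists>r. psh_mor C Z P r \<and> psh_eq C Z (psh_comp a r) s \<and> psh_eq C Z (psh_comp b r) t \<and>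
          (\<forall>r'. psh_mor C Z P r' \<and> psh_eq C Z (psh_comp a r') s \<and> psh_eq C Z (psh_comp b r') t \<longrightarrow>
             psh_eq C Z r' r)"
proof -
  have sh: "sheaf C J P" "sheaf C J A" "sheaf C J B" "sheaf C J E"
    and mo: "psh_mor C P A a" "psh_mor C P B b" "psh_mor C A E f" "psh_mor C B E g"
    and co: "psh_eq C P (psh_comp f a) (psh_comp g b)"
    and un: "\<And>(Z :: ('o, 'a, 't + 'u \<times> 'v) psh) s t. sheaf C J Z \<Longrightarrow> psh_mor C Z A s \<Longrightarrow> psh_mor C Z B t \<Longrightarrow>
       psh_eq C Z (psh_comp f s) (psh_comp g t) \<Longrightarrow> 
        (\<exists>r. psh_mor C Z P r \<and> psh_eq C Z (psh_comp a r) s \<and> psh_eq C Z (psh_comp b r) t \<and>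
          (\<forall>r'. psh_mor C Z P r' \<and> psh_eq C Z (psh_comp a r') s \<and> psh_eq C Z (psh_comp b r') t \<longrightarrow>
             psh_eq C Z r' r))"
    using pb by (simp_all add: sheaf_pullback_def)
  interpret P: sheaf C J P by fact
  interpret Z: sheaf C J Z by fact
  define Q where "Q = fibre_prod A B f g"
  interpret Q: sheaf C J Q unfolding Q_def using sheaf_fibre_prod sh mo by blast
  have cat: "category C" by unfold_locales
  have vQ: "val Q c = {(x, y). x \<in> val A c \<and> y \<in> val B c \<and> f c x = g c y}"
    and rQ: "res Q h (x, y) = (res A h x, res B h y)" for c h x y by (auto simp: Q_def fibre_prod_def)
  \<comment> \<open>test on copies of \<open>Q\<close> and \<open>P\<close>\<close>
  define Q' where "Q' = transport C Q (\<lambda>c. (Inr :: _ \<Rightarrow> 't + 'u \<times> 'v))"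
  define P' where "P' = transport C P (\<lambda>c. (Inl :: _ \<Rightarrow> 't + 'u \<times> 'v))"
  have Q': "sheaf C J Q'" unfolding Q'_def by (rule Q.sheaf_transport) simp
  have P': "sheaf C J P'" unfolding P'_def by (rule P.sheaf_transport) simp
  interpret Q': sheaf C J Q' by fact
  interpret P': sheaf C J P' by fact
  have iQ: "psh_mor C Q Q' (\<lambda>c. Inr)" "psh_mor C Q' Q (\<lambda>c. inv_into (val Q c) Inr)"
     "\<And>c x. c \<in> Obj C \<Longrightarrow> x \<in> val Q c \<Longrightarrow> inv_into (val Q c) Inr (Inr x :: 't + 'u \<times> 'v) = x"
    using psh_iso_transport[OF cat _ Q.presheaf_axioms, of "\<lambda>c. Inr"] by (auto simp: Q'_def)
  have iP: "psh_mor C P P' (\<lambda>c. Inl)" "psh_mor C P' P (\<lambda>c. inv_into (val P c) Inl)"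
     "\<And>c x. c \<in> Obj C \<Longrightarrow> x \<in> val P c \<Longrightarrow> inv_into (val P c) Inl (Inl x :: 't + 'u \<times> 'v) = x"
    using psh_iso_transport[OF cat _ P.presheaf_axioms, of "\<lambda>c. Inl"] by (auto simp: P'_def)
  have pq: "psh_mor C Q A (\<lambda>c. fst)" "psh_mor C Q B (\<lambda>c. snd)" by (auto simp: psh_mor_def vQ rQ)
  let ?iQ = "\<lambda>c. inv_into (val Q c) (Inr :: _ \<Rightarrow> 't + 'u \<times> 'v)"
  let ?iP = "\<lambda>c. inv_into (val P c) (Inl :: _ \<Rightarrow> 't + 'u \<times> 'v)"
  have "psh_mor C Q' A (psh_comp (\<lambda>c. fst) ?iQ)" "psh_mor C Q' B (psh_comp (\<lambda>c. snd) ?iQ)"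
    using psh_mor_comp[OF cat Q'.presheaf_axioms iQ(2)] pq by auto
  moreover have "psh_eq C Q' (psh_comp f (psh_comp (\<lambda>c. fst) ?iQ)) (psh_comp g (psh_comp (\<lambda>c. snd) ?iQ))"
    using iQ(2) by (auto simp: psh_eq_def psh_comp_def psh_mor_def vQ split_beta)
  ultimately obtain r0 where r0: "psh_mor C Q' P r0" "psh_eq C Q' (psh_comp a r0) (psh_comp (\<lambda>c. fst) ?iQ)"
     "psh_eq C Q' (psh_comp b r0) (psh_comp (\<lambda>c. snd) ?iQ)" using un[OF Q'] by blast
  define q where "q = psh_comp r0 (\<lambda>c. Inr)"
  have q: "psh_mor C Q P q" unfolding q_def using psh_mor_comp[OF cat Q.presheaf_axioms iQ(1) r0(1)] .
  have aq: "a c (q c z) = fst z" "b c (q c z) = snd z" if "c \<in> Obj C" "z \<in> val Q c" for c z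
  proof -
    have "Inr z \<in> val Q' c" using that by (simp add: Q'_def val_transport)
    then show "a c (q c z) = fst z" "b c (q c z) = snd z"
      using r0(2,3) that iQ(3)[OF that] by (auto simp: psh_eq_def psh_comp_def q_def)
  qed
  have pQ: "psh_mor C P Q (\<lambda>c x. (a c x, b c x))"
    using mo(1,2) co by (auto simp: psh_mor_def vQ rQ psh_eq_def psh_comp_def)
  have qid: "q c (a c x, b c x) = x" if c: "c \<in> Obj C" "x \<in> val P c" for c x
  proof -
    let ?s = "psh_comp a ?iP" and ?t = "psh_comp b ?iP"
    have s: "psh_mor C P' A ?s" "psh_mor C P' B ?t"
      using psh_mor_comp[OF cat P'.presheaf_axioms iP(2)] mo by auto
    have "psh_eq C P' (psh_comp f ?s) (psh_comp g ?t)"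
      using iP(2) co by (auto simp: psh_eq_def psh_comp_def psh_mor_def)
    then obtain r where r: "\<And>r'. psh_mor C P' P r' \<Longrightarrow> psh_eq C P' (psh_comp a r') ?s \<Longrightarrow> psh_eq C P' (psh_comp b r') ?t \<Longrightarrow>
             psh_eq C P' r' r" using un[OF P' s] by blast
    let ?w = "psh_comp q (psh_comp (\<lambda>c x. (a c x, b c x)) ?iP)"
    have "psh_eq C P' ?iP r" using r[OF iP(2)] by (simp add: psh_eq_def)
    moreover have "psh_mor C P' P ?w"
      using psh_mor_comp[OF cat P'.presheaf_axioms psh_mor_comp[OF cat P'.presheaf_axioms iP(2) pQ] q] .
    moreover have "psh_eq C P' (psh_comp a ?w) ?s" "psh_eq C P' (psh_comp b ?w) ?t"
      using psh_morD(1)[OF psh_mor_comp[OF cat P'.presheaf_axioms iP(2) pQ]] aq by (auto simp: psh_eq_def psh_comp_def)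
    ultimately have "psh_eq C P' ?w r" "psh_eq C P' ?iP r" using r by auto
    moreover have "Inl x \<in> val P' c" using that by (simp add: P'_def val_transport)
    ultimately have "?w c (Inl x) = r c (Inl x)" "?iP c (Inl x) = r c (Inl x)" using c unfolding psh_eq_def by blast+
    then have "?w c (Inl x) = ?iP c (Inl x)" by simp
    then show ?thesis unfolding psh_comp_def iP(3)[OF c] .
  qed
  let ?r = "psh_comp q (\<lambda>c z. (s c z, t c z))"
  have zq: "psh_mor C Z Q (\<lambda>c z. (s c z, t c z))"
    using Z(2-4) by (auto simp: psh_mor_def vQ rQ psh_eq_def psh_comp_def)
  show ?thesis
  proof (intro exI[of _ ?r] conjI allI impI)
    show "psh_mor C Z P ?r" using psh_mor_comp[OF cat Z.presheaf_axioms zq q] .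
    show "psh_eq C Z (psh_comp a ?r) s" "psh_eq C Z (psh_comp b ?r) t"
      using aq psh_morD(1)[OF zq] by (auto simp: psh_eq_def psh_comp_def)
    fix r' assume r': "psh_mor C Z P r' \<and> psh_eq C Z (psh_comp a r') s \<and> psh_eq C Z (psh_comp b r') t"
    show "psh_eq C Z r' ?r" unfolding psh_eq_def
    proof safe
      fix c z assume c: "c \<in> Obj C" "z \<in> val Z c"
      have "r' c z \<in> val P c" "a c (r' c z) = s c z" "b c (r' c z) = t c z"
        using r' c by (auto simp: psh_mor_def psh_eq_def psh_comp_def)
      then show "r' c z = ?r c z" using qid[OF c(1), of "r' c z"] by (simp add: psh_comp_def)
    qed
  qed
qed

section \<open>Adequacy: continuous functors\<close>

context sheaf begin

definition gen_at :: "'i set \<Rightarrow> ('i \<Rightarrow> 'o) \<Rightarrow> ('i \<Rightarrow> 'v) \<Rightarrow> 'o \<Rightarrow> 'v \<Rightarrow> ('a \<times> 'i \<times> 'a) set" where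
  "gen_at I b x c y = {(h, i, g). i \<in> I \<and> h \<in> max_sieve C c \<and> g \<in> Arr C \<and> Cod C g = b i \<and> Dom C g = Dom C h \<and>
     res P h y = res P g (x i)}"

definition gen_sub :: "'i set \<Rightarrow> ('i \<Rightarrow> 'o) \<Rightarrow> ('i \<Rightarrow> 'v) \<Rightarrow> ('o, 'a, 'v) psh" where
  "gen_sub I b x = \<lparr>val = (\<lambda>c. {y \<in> val P c. fst ` gen_at I b x c y \<in> J c}), res = res P\<rparr>"

lemma small_subsheaf:
  fixes I :: "'i set"
  assumes b: "\<And>i. i \<in> I \<Longrightarrow> b i \<in> Obj C" "\<And>i. i \<in> I \<Longrightarrow> x i \<in> val P (b i)"
  obtains Q :: "('o, 'a, ('a \<times> 'i \<times> 'a) set) psh" and e where "sheaf C J Q" "psh_mor C Q P e"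
     "\<And>c. c \<in> Obj C \<Longrightarrow> inj_on (e c) (val Q c)" "\<And>i. i \<in> I \<Longrightarrow> x i \<in> e (b i) ` val Q (b i)"
proof -
  define RR where "RR = (\<lambda>c y. fst ` gen_at I b x c y)"
  have R: "h \<in> RR c y \<longleftrightarrow> h \<in> Arr C \<and> Cod C h = c \<and> (\<exists>i\<in>I. \<exists>g\<in>Arr C. Cod C g = b i \<and> Dom C g = Dom C h \<and> res P h y = res P g (x i))"
    for h c y by (force simp: RR_def gen_at_def max_sieve_def image_iff)
  have sv: "sieve C c (RR c y)" if c: "c \<in> Obj C" "y \<in> val P c" for c y
    unfolding sieve_def
  proof (intro conjI ballI impI)
    show "RR c y \<subseteq> {f \<in> Arr C. Cod C f = c}" using R by blast
    fix h k assume h: "h \<in> RR c y" and k: "k \<in> Arr C" "Cod C k = Dom C h"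
    then obtain i g where g: "h \<in> Arr C" "Cod C h = c" "i \<in> I" "g \<in> Arr C" "Cod C g = b i" "Dom C g = Dom C h" "res P h y = res P g (x i)"
      unfolding R by auto
    have "res P (h \<cdot> k) y = res P (g \<cdot> k) (x i)"
      using res_comp[of h k y] res_comp[of g k "x i"] g k c b by simp
    then show "h \<cdot> k \<in> RR c y" using comp_simps[of h k] comp_simps[of g k] g k unfolding R by auto
  qed
  have pullR: "pull_sieve C f (RR c y) = RR (Dom C f) (res P f y)" if f: "f \<in> Arr C" "Cod C f = c" "y \<in> val P c" for f c y
    using res_comp[of f _ y] comp_simps[of f] f by (auto simp: pull_sieve_def R) blast
  let ?F = "gen_sub I b x"
  have vF: "val ?F c = {y \<in> val P c. RR c y \<in> J c}" and rF: "res ?F = res P" for c by (auto simp: gen_sub_def RR_def)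
  have F: "sheaf C J ?F"
  proof unfold_locales
    fix f y assume "f \<in> Arr C" "y \<in> val ?F (Cod C f)"
    then show "res ?F f y \<in> val ?F (Dom C f)"
      using pullR[of f "Cod C f" y] cover_pull[of f "RR (Cod C f) y"] res_val[of f y] by (auto simp: vF rF)
  next
    fix c m assume c: "c \<in> Obj C" and d: "dom m \<in> J c" and m: "matching C ?F m"
    note ca = cover_arr[OF c d]
    have M: "matching C P m" using m by (auto simp: matching_def vF rF)
    obtain y where y: "y \<in> val P c" "\<And>f. f \<in> dom m \<Longrightarrow> m f = Some (res P f y)" using glue_obtain[OF c d M] by blast
    have "RR c y \<in> J c"
    proof (rule cover_trans[OF c d sv[OF c y(1)]])
      fix f assume f: "f \<in> dom m"
      have "the (m f) \<in> val ?F (Dom C f)" using m f unfolding matching_def by blast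
      then have "res P f y \<in> val ?F (Dom C f)" using y(2)[OF f] by simp
      then show "pull_sieve C f (RR c y) \<in> J (Dom C f)" using pullR[OF ca(1,2)[OF f] y(1)] by (simp add: vF)
    qed
    then have "y \<in> val ?F c" using y by (simp add: vF)
    then show "\<exists>!y. y \<in> val ?F c \<and> (\<forall>f\<in>dom m. m f = Some (res ?F f y))"
    proof (intro ex1I[of _ y])
      fix z assume *: "z \<in> val ?F c \<and> (\<forall>f\<in>dom m. m f = Some (res ?F f z))"
      have z: "z \<in> val P c" "\<And>f. f \<in> dom m \<Longrightarrow> m f = Some (res P f z)" using * unfolding vF rF by blast+
      show "z = y" by (rule glue_unique[OF c d z y])
    qed (use y in \<open>simp add: rF\<close>)
  qed (auto simp: vF rF res_id res_comp)
  interpret F: sheaf C J ?F by fact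
  let ?e = "gen_at I b x"
  have inj: "inj_on (?e c) (val ?F c)" if c: "c \<in> Obj C" for c
  proof (rule inj_onI)
    fix y z assume y: "y \<in> val ?F c" and z: "z \<in> val ?F c" and e: "?e c y = ?e c z"
    show "y = z"
    proof (rule separated[OF c])
      show "RR c y \<in> J c" "y \<in> val P c" "z \<in> val P c" using y z by (auto simp: vF)
      fix h assume "h \<in> RR c y"
      then obtain i g where g: "(h, i, g) \<in> ?e c y" by (auto simp: RR_def)
      then have "(h, i, g) \<in> ?e c z" using e by simp
      with g show "res P h y = res P h z" by (simp add: gen_at_def)
    qed
  qed
  define Q where "Q = transport C ?F ?e"
  define j where "j = (\<lambda>c. inv_into (val ?F c) (?e c))"
  have cat: "category C" by unfold_locales
  note T = psh_iso_transport[OF cat inj F.presheaf_axioms]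
  show ?thesis
  proof (rule that)
    show "sheaf C J Q" unfolding Q_def by (rule F.sheaf_transport[OF inj])
    have "psh_mor C Q ?F j" unfolding Q_def j_def by (rule T(2))
    then show "psh_mor C Q P j" by (auto simp: psh_mor_def vF rF)
    show "inj_on (j c) (val Q c)" if "c \<in> Obj C" for c
      using that T(3)[OF _ that] by (auto simp: inj_on_def Q_def val_transport j_def)
    fix i assume i: "i \<in> I"
    have "RR (b i) (x i) = max_sieve C (b i)" using i unfolding max_sieve_def set_eq_iff R by blast
    then have xi: "x i \<in> val ?F (b i)" using b[OF i] cover_max by (simp add: vF)
    then have "?e (b i) (x i) \<in> val Q (b i)" by (simp add: Q_def val_transport)
    moreover have "j (b i) (?e (b i) (x i)) = x i" using T(3)[OF _ b(1)[OF i] xi] unfolding j_def by blast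
    ultimately show "x i \<in> j (b i) ` val Q (b i)" by force
  qed
qed

end

lemma presheaf_precomp:
  assumes "functor_between C D F" "presheaf D P" shows "presheaf C (precomp F P)"
proof -
  interpret functor_between C D F by fact
  interpret P: presheaf D P by fact
  have H: "f \<in> Arr C \<Longrightarrow> far F f \<in> Arr D \<and> Dom D (far F f) = fob F (Dom C f) \<and> Cod D (far F f) = fob F (Cod C f)" for f
    using far_hom by (auto simp: hom_def)
  show ?thesis
    apply unfold_locales
    subgoal for f x using P.res_val[of "far F f" x] H[of f] by (simp add: precomp_def)
    subgoal for c x using P.res_id[of "fob F c" x] fob_obj far_id by (simp add: precomp_def)
    subgoal for f g x using P.res_comp[of "far F f" "far F g" x] H[of f] H[of g] far_comp by (simp add: precomp_def)
    done
qed

lemma continuous_ftr_all: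
  fixes C :: "('o, 'a) cat" and D :: "('p, 'b) cat" and P :: "('p, 'b, 'v) psh"
  assumes "site C J" "functor_between C D F" "continuous_ftr C J D K F" "sheaf D K P"
  shows "sheaf C J (precomp F P)"
proof -
  interpret site C J by fact
  interpret functor_between C D F by fact
  interpret P: sheaf D K P by fact
  interpret FP: presheaf C "precomp F P" by (rule presheaf_precomp[OF assms(2) P.presheaf_axioms])
  have cont: "sheaf C J (precomp F Q)" if "sheaf D K Q" for Q :: "('p, 'b, ('b \<times> 'a option \<times> 'b) set) psh"
    using assms(3) that by (auto simp: continuous_ftr_def)
  have H: "f \<in> Arr C \<Longrightarrow> far F f \<in> Arr D \<and> Dom D (far F f) = fob F (Dom C f) \<and> Cod D (far F f) = fob F (Cod C f)" for f
    using far_hom by (auto simp: hom_def)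
  have vF: "val (precomp F R) c = val R (fob F c)" and rF: "res (precomp F R) f = res R (far F f)" for R :: "('p, 'b, 'r) psh" and c f
    by (auto simp: precomp_def)
  show ?thesis
  proof unfold_locales
    fix c m assume c: "c \<in> Obj C" and d: "dom m \<in> J c" and m: "matching C (precomp F P) m"
    note ca = cover_arr[OF c d]
    have mv: "the (m f) \<in> val P (fob F (Dom C f))" if "f \<in> dom m" for f using m that by (auto simp: matching_def vF)
    have mr: "m (f \<cdot>\<^bsub>C\<^esub> g) = map_option (res P (far F g)) (m f)" if "f \<in> dom m" "g \<in> Arr C" "Cod C g = Dom C f" for f g
      using m that by (auto simp: matching_def rF)
    have "\<exists>y. y \<in> val P (fob F c) \<and> (\<forall>f\<in>dom m. m f = Some (res P (far F f) y))"
    proof -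
      have g1: "fob F (Dom C (the i)) \<in> Obj D" "the (m (the i)) \<in> val P (fob F (Dom C (the i)))"
        if i: "i \<in> Some ` dom m" for i
        using i ca(3) fob_obj mv by (elim imageE, simp)+
      obtain Q :: "('p, 'b, ('b \<times> 'a option \<times> 'b) set) psh" and e where Q: "sheaf D K Q" and e: "psh_mor D Q P e"
        and inj: "\<And>c. c \<in> Obj D \<Longrightarrow> inj_on (e c) (val Q c)"
        and gen: "\<And>i. i \<in> Some ` dom m \<Longrightarrow> the (m (the i)) \<in> e (fob F (Dom C (the i))) ` val Q (fob F (Dom C (the i)))"
        using P.small_subsheaf[of "Some ` dom m" "\<lambda>i. fob F (Dom C (the i))" "\<lambda>i. the (m (the i))", OF g1] by blast
      interpret Q: sheaf D K Q by fact
      interpret FQ: sheaf C J "precomp F Q" by (rule cont[OF Q])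
      have "\<exists>q. q \<in> val Q (fob F (Dom C f)) \<and> e (fob F (Dom C f)) q = the (m f)" if "f \<in> dom m" for f
        using gen[of "Some f"] that by force
      then obtain q where q: "\<And>f. f \<in> dom m \<Longrightarrow> q f \<in> val Q (fob F (Dom C f)) \<and> e (fob F (Dom C f)) (q f) = the (m f)"
        by metis
      define n where "n = (\<lambda>f. if f \<in> dom m then Some (q f) else None)"
      have dn: "dom n = dom m" by (auto simp: n_def dom_def)
      have "matching C (precomp F Q) n" unfolding matching_def dn
      proof (intro conjI ballI impI)
        fix f assume f: "f \<in> dom m"
        show "the (n f) \<in> val (precomp F Q) (Dom C f)" using q[OF f] f by (simp add: n_def vF)
        fix g assume g: "g \<in> Arr C" "Cod C g = Dom C f"
        have fg: "f \<cdot>\<^bsub>C\<^esub> g \<in> dom m" "Dom C (f \<cdot>\<^bsub>C\<^esub> g) = Dom C g" using cover_comp[OF c d f g] comp_simps[OF ca(1)[OF f] g] by auto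
        have "e (fob F (Dom C g)) (q (f \<cdot>\<^bsub>C\<^esub> g)) = res P (far F g) (the (m f))"
          using q[OF fg(1)] fg(2) mr[OF f g] f by auto
        also have "\<dots> = e (fob F (Dom C g)) (res Q (far F g) (q f))"
          using psh_morD(2)[OF e, of "far F g" "q f"] H[OF g(1)] q[OF f] g by simp
        finally have E: "e (fob F (Dom C g)) (q (f \<cdot>\<^bsub>C\<^esub> g)) = e (fob F (Dom C g)) (res Q (far F g) (q f))" .
        have "q (f \<cdot>\<^bsub>C\<^esub> g) \<in> val Q (fob F (Dom C g))" "res Q (far F g) (q f) \<in> val Q (fob F (Dom C g))"
          using q[OF fg(1)] q[OF f] fg(2) Q.res_val[of "far F g" "q f"] H[OF g(1)] g by simp_all
        then have "q (f \<cdot>\<^bsub>C\<^esub> g) = res Q (far F g) (q f)"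
          using inj_onD[OF inj[OF fob_obj[OF dom_obj[OF g(1)]]] E] by blast
        then show "n (f \<cdot>\<^bsub>C\<^esub> g) = map_option (res (precomp F Q) g) (n f)" using f fg by (simp add: n_def rF)
      qed
      then obtain z where z: "z \<in> val Q (fob F c)" "\<And>f. f \<in> dom m \<Longrightarrow> n f = Some (res Q (far F f) z)"
        using FQ.glue_obtain[OF c, of n, unfolded dn, OF d] unfolding vF rF by blast
      have "m f = Some (res P (far F f) (e (fob F c) z))" if "f \<in> dom m" for f
      proof -
        have "q f = res Q (far F f) z" using z(2)[OF that] that by (simp add: n_def)
        then have "the (m f) = res P (far F f) (e (fob F c) z)"
          using q[OF that] psh_morD(2)[OF e, of "far F f" z] H[OF ca(1)[OF that]] ca[OF that] z(1) by simp
        with that show ?thesis by auto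
      qed
      moreover have "e (fob F c) z \<in> val P (fob F c)" using psh_morD(1)[OF e fob_obj[OF c] z(1)] .
      ultimately show ?thesis by blast
    qed
    then obtain y where y: "y \<in> val P (fob F c)" "\<And>f. f \<in> dom m \<Longrightarrow> m f = Some (res P (far F f) y)" by blast
    show "\<exists>!x. x \<in> val (precomp F P) c \<and> (\<forall>f\<in>dom m. m f = Some (res (precomp F P) f x))" unfolding vF rF
    proof (rule ex1I[of _ y])
      show "y \<in> val P (fob F c) \<and> (\<forall>f\<in>dom m. m f = Some (res P (far F f) y))" using y by blast
      fix y' assume y': "y' \<in> val P (fob F c) \<and> (\<forall>f\<in>dom m. m f = Some (res P (far F f) y'))"
      let ?b = "\<lambda>i :: 'a option. fob F c" and ?x = "\<lambda>i :: 'a option. if i = None then y else y'"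
      obtain Q :: "('p, 'b, ('b \<times> 'a option \<times> 'b) set) psh" and e where Q: "sheaf D K Q" and e: "psh_mor D Q P e"
        and inj: "\<And>c. c \<in> Obj D \<Longrightarrow> inj_on (e c) (val Q c)" and gen: "\<And>i. i \<in> UNIV \<Longrightarrow> ?x i \<in> e (?b i) ` val Q (?b i)"
        by (rule P.small_subsheaf[of UNIV ?b ?x]) (use fob_obj[OF c] y(1) y' in auto)
      interpret Q: sheaf D K Q by fact
      interpret FQ: sheaf C J "precomp F Q" by (rule cont[OF Q])
      obtain z where z: "z \<in> val Q (fob F c)" "y = e (fob F c) z" using gen[of None] by auto
      obtain z' where z': "z' \<in> val Q (fob F c)" "y' = e (fob F c) z'" using gen[of "Some undefined"] by auto
      have "z' = z"
      proof (rule FQ.separated[OF c d])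
        fix f assume f: "f \<in> dom m"
        have "res P (far F f) y = res P (far F f) y'" using y(2)[OF f] y' f by simp
        then have "e (fob F (Dom C f)) (res Q (far F f) z') = e (fob F (Dom C f)) (res Q (far F f) z)"
          using psh_morD(2)[OF e, of "far F f" z] psh_morD(2)[OF e, of "far F f" z'] z z' H[OF ca(1)[OF f]] ca[OF f] by simp
        moreover have "res Q (far F f) z' \<in> val Q (fob F (Dom C f))" "res Q (far F f) z \<in> val Q (fob F (Dom C f))"
          using Q.res_val[of "far F f"] z z' H[OF ca(1)[OF f]] ca[OF f] by force+
        ultimately show "res (precomp F Q) f z' = res (precomp F Q) f z" unfolding rF
          using inj[OF fob_obj[OF ca(3)[OF f]]] by (blast dest: inj_onD)
      qed (use z z' in \<open>simp_all add: vF\<close>)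
      then show "y' = y" using z z' by simp
    qed
  qed
qed

section \<open>Adequacy: sheafification\<close>

locale presheaf_on_site = site C J + presheaf C P
  for C :: "('o, 'a) cat" (structure) and J :: "'o \<Rightarrow> 'a set set" and P :: "('o, 'a, 'v) psh"
begin

lemma val_plus: "val (plus C J P) c = mfam C J P c // mrel C J P c"
  by (simp add: plus_def)

lemma res_plus: "res (plus C J P) f X = mrel C J P (Dom C f) `` (pull_fam C f ` X)"
  by (simp add: plus_def)

lemma mfam_arr:
  assumes "c \<in> Obj C" "m \<in> mfam C J P c" "f \<in> dom m"
  shows "f \<in> Arr C" "Cod C f = c" "Dom C f \<in> Obj C" "the (m f) \<in> val P (Dom C f)"
  using cover_arr[OF assms(1) _ assms(3)] assms(2,3) by (auto simp: mfam_def matching_def)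

lemma mfam_comp:
  assumes "c \<in> Obj C" "m \<in> mfam C J P c" "f \<in> dom m" "g \<in> Arr C" "Cod C g = Dom C f"
  shows "f \<cdot> g \<in> dom m" "m (f \<cdot> g) = map_option (res P g) (m f)"
  using cover_comp[OF assms(1) _ assms(3-5)] assms(2-) by (auto simp: mfam_def matching_def)

lemma equiv_mrel: assumes "c \<in> Obj C" shows "equiv (mfam C J P c) (mrel C J P c)"
proof (rule equivI)
  show "refl_on (mfam C J P c) (mrel C J P c)" by (auto simp: refl_on_def mrel_def mfam_def)
  show "sym (mrel C J P c)" unfolding sym_def mrel_def
    by (clarsimp, rule bexI) auto
  show "trans (mrel C J P c)" 
  proof (rule transI)
    fix m n k assume "(m, n) \<in> mrel C J P c" "(n, k) \<in> mrel C J P c"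
    then obtain R S where "m \<in> mfam C J P c" "k \<in> mfam C J P c" "R \<in> J c" "S \<in> J c" "R \<subseteq> dom m \<inter> dom n" "S \<subseteq> dom n \<inter> dom k"
      "\<forall>f\<in>R. m f = n f" "\<forall>f\<in>S. n f = k f" by (auto simp: mrel_def)
    moreover have "R \<inter> S \<in> J c" using cover_inter[OF assms] calculation by blast
    moreover have "R \<inter> S \<subseteq> dom m \<inter> dom k" "\<forall>f\<in>R \<inter> S. m f = k f" using calculation by auto
    ultimately show "(m, k) \<in> mrel C J P c" unfolding mrel_def by blast
  qed
  show "mrel C J P c \<subseteq> mfam C J P c \<times> mfam C J P c" by (auto simp: mrel_def)
qed

lemma dom_pull_fam:
  assumes "c \<in> Obj C" "m \<in> mfam C J P c" "f \<in> Arr C" "Cod C f = c"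
  shows "dom (pull_fam C f m) = pull_sieve C f (dom m)"
  by (auto simp: pull_fam_def pull_sieve_def split: if_splits)

lemma pull_fam_mfam:
  assumes "c \<in> Obj C" "m \<in> mfam C J P c" "f \<in> Arr C" "Cod C f = c"
  shows "pull_fam C f m \<in> mfam C J P (Dom C f)"
proof -
  have "matching C P (pull_fam C f m)" unfolding matching_def dom_pull_fam[OF assms]
  proof (intro conjI ballI impI)
    fix g assume g: "g \<in> pull_sieve C f (dom m)"
    then have G: "g \<in> Arr C" "Cod C g = Dom C f" "f \<cdot> g \<in> dom m" by (auto simp: pull_sieve_def)
    note fg = comp_simps[OF assms(3) G(1,2)]
    show "the (pull_fam C f m g) \<in> val P (Dom C g)" using mfam_arr[OF assms(1,2) G(3)] fg G by (simp add: pull_fam_def)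
    fix h assume h: "h \<in> Arr C" "Cod C h = Dom C g"
    show "pull_fam C f m (g \<cdot> h) = map_option (res P h) (pull_fam C f m g)"
      using mfam_comp(2)[OF assms(1,2) G(3), of h] h fg G assoc[OF assms(3) G(1) h(1)] comp_simps[OF G(1) h] 
      by (simp add: pull_fam_def)
  qed
  moreover have "pull_sieve C f (dom m) \<in> J (Dom C f)" using cover_pull[OF assms(3)] assms by (simp add: mfam_def)
  ultimately show ?thesis using dom_pull_fam[OF assms] by (simp add: mfam_def)
qed

lemma pull_fam_mrel:
  assumes "(m, n) \<in> mrel C J P c" "f \<in> Arr C" "Cod C f = c"
  shows "(pull_fam C f m, pull_fam C f n) \<in> mrel C J P (Dom C f)"
proof -
  have c: "c \<in> Obj C" using cod_obj assms by auto
  have mn: "m \<in> mfam C J P c" "n \<in> mfam C J P c" using assms by (auto simp: mrel_def)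
  obtain R where R: "R \<in> J c" "R \<subseteq> dom m \<inter> dom n" "\<forall>f\<in>R. m f = n f" using assms by (auto simp: mrel_def)
  have "pull_sieve C f R \<in> J (Dom C f)" using cover_pull[OF assms(2)] assms(3) R(1) by simp
  moreover have "pull_sieve C f R \<subseteq> dom (pull_fam C f m) \<inter> dom (pull_fam C f n)"
    unfolding dom_pull_fam[OF c mn(1) assms(2,3)] dom_pull_fam[OF c mn(2) assms(2,3)] using R by (auto simp: pull_sieve_def)
  moreover have "\<forall>g\<in>pull_sieve C f R. pull_fam C f m g = pull_fam C f n g"
    using R by (auto simp: pull_sieve_def pull_fam_def)
  ultimately show ?thesis using pull_fam_mfam[OF c _ assms(2,3)] mn unfolding mrel_def by blast
qed

abbreviation cls where "cls c m \<equiv> mrel C J P c `` {m}"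

lemma cls_eq: "c \<in> Obj C \<Longrightarrow> m \<in> mfam C J P c \<Longrightarrow> n \<in> mfam C J P c \<Longrightarrow> cls c m = cls c n \<longleftrightarrow> (m, n) \<in> mrel C J P c"
  using eq_equiv_class_iff[OF equiv_mrel] .

lemma plus_cases:
  assumes "X \<in> val (plus C J P) c" obtains m where "m \<in> mfam C J P c" "X = cls c m"
  using assms unfolding val_plus by (auto elim: quotientE)

lemma cls_val: "m \<in> mfam C J P c \<Longrightarrow> cls c m \<in> val (plus C J P) c"
  unfolding val_plus by (rule quotientI)

lemma res_cls:
  assumes "f \<in> Arr C" "m \<in> mfam C J P (Cod C f)"
  shows "res (plus C J P) f (cls (Cod C f) m) = cls (Dom C f) (pull_fam C f m)"
proof -
  have E: "equiv (mfam C J P (Dom C f)) (mrel C J P (Dom C f))" using equiv_mrel dom_obj assms by auto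
  have m: "(m, m) \<in> mrel C J P (Cod C f)" using equiv_mrel[OF cod_obj[OF assms(1)]] assms(2) by (auto simp: equiv_def refl_on_def)
  show ?thesis unfolding res_plus
  proof (intro set_eqI iffI)
    fix n assume "n \<in> mrel C J P (Dom C f) `` (pull_fam C f ` cls (Cod C f) m)"
    then obtain k where "(m, k) \<in> mrel C J P (Cod C f)" "(pull_fam C f k, n) \<in> mrel C J P (Dom C f)" by auto
    then show "n \<in> cls (Dom C f) (pull_fam C f m)"
      using pull_fam_mrel[OF _ assms(1) refl] E by (auto simp: equiv_def dest: transD)
  qed (use m in auto)
qed

lemma presheaf_plus: "presheaf C (plus C J P)"
proof unfold_locales
  fix f X assume f: "f \<in> Arr C" and X: "X \<in> val (plus C J P) (Cod C f)"
  obtain m where m: "m \<in> mfam C J P (Cod C f)" "X = cls (Cod C f) m" using X by (rule plus_cases)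
  show "res (plus C J P) f X \<in> val (plus C J P) (Dom C f)"
    unfolding m(2) res_cls[OF f m(1)] by (rule cls_val[OF pull_fam_mfam[OF cod_obj[OF f] m(1) f refl]])
next
  fix c X assume c: "c \<in> Obj C" and X: "X \<in> val (plus C J P) c"
  obtain m where m: "m \<in> mfam C J P c" "X = cls c m" using X by (rule plus_cases)
  note i = id_simps[OF c]
  have "m g = None" if "\<not> (g \<in> Arr C \<and> Cod C g = c)" for g using mfam_arr[OF c m(1), of g] that by blast
  then have "pull_fam C (Idn C c) m = m" using id_left i by (auto simp: pull_fam_def fun_eq_iff)
  then show "res (plus C J P) (Idn C c) X = X" using res_cls[OF i(1), of m] m i by simp
next
  fix f g X assume f: "f \<in> Arr C" and g: "g \<in> Arr C" "Cod C g = Dom C f" and X: "X \<in> val (plus C J P) (Cod C f)"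
  obtain m where m: "m \<in> mfam C J P (Cod C f)" "X = cls (Cod C f) m" using X by (rule plus_cases)
  note fg = comp_simps[OF f g]
  have "pull_fam C (f \<cdot> g) m = pull_fam C g (pull_fam C f m)"
    using assoc[OF f g(1)] comp_simps[OF g(1)] fg g by (auto simp: pull_fam_def fun_eq_iff)
  then show "res (plus C J P) (f \<cdot> g) X = res (plus C J P) g (res (plus C J P) f X)"
    using res_cls[OF fg(1), of m] res_cls[OF f m(1)] res_cls[OF g(1), of "pull_fam C f m"] fg g m pull_fam_mfam[OF cod_obj[OF f] m(1) f refl] by simp
qed

definition is_separated where
  "is_separated \<longleftrightarrow> (\<forall>c\<in>Obj C. \<forall>S\<in>J c. \<forall>x\<in>val P c. \<forall>y\<in>val P c. (\<forall>f\<in>S. res P f x = res P f y) \<longrightarrow> x = y)"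

lemma plus_separated:
  assumes c: "c \<in> Obj C" "S \<in> J c" and X: "X \<in> val (plus C J P) c" and Y: "Y \<in> val (plus C J P) c"
   and e: "\<forall>f\<in>S. res (plus C J P) f X = res (plus C J P) f Y"
  shows "X = Y"
proof -
  obtain m where m: "m \<in> mfam C J P c" "X = cls c m" using X by (rule plus_cases)
  obtain n where n: "n \<in> mfam C J P c" "Y = cls c n" using Y by (rule plus_cases)
  note ca = cover_arr[OF c]
  define R where "R = {h \<in> dom m \<inter> dom n. m h = n h}"
  have sR: "sieve C c R" unfolding sieve_def R_def
    using mfam_arr[OF c(1) m(1)] mfam_comp[OF c(1) m(1)] mfam_comp[OF c(1) n(1)] by auto
  have "R \<in> J c"
  proof (rule cover_trans[OF c sR])
    fix f assume f: "f \<in> S"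
    have "cls (Dom C f) (pull_fam C f m) = cls (Dom C f) (pull_fam C f n)"
      using e f res_cls[OF ca(1)[OF f]] m n ca[OF f] by metis
    then have "(pull_fam C f m, pull_fam C f n) \<in> mrel C J P (Dom C f)"
      using cls_eq[OF ca(3)[OF f]] pull_fam_mfam[OF c(1) _ ca(1,2)[OF f]] m n by blast
    then obtain T where T: "T \<in> J (Dom C f)" "T \<subseteq> dom (pull_fam C f m) \<inter> dom (pull_fam C f n)" "\<forall>g\<in>T. pull_fam C f m g = pull_fam C f n g"
      by (auto simp: mrel_def)
    have "T \<subseteq> pull_sieve C f R"
    proof
      fix g assume g: "g \<in> T"
      then have "g \<in> Arr C" "Cod C g = Dom C f" using cover_arr[OF ca(3)[OF f] T(1)] by auto
      moreover have "g \<in> dom (pull_fam C f m)" "g \<in> dom (pull_fam C f n)" "pull_fam C f m g = pull_fam C f n g" using T g by auto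
      ultimately show "g \<in> pull_sieve C f R" by (auto simp: pull_fam_def pull_sieve_def R_def)
    qed
    then show "pull_sieve C f R \<in> J (Dom C f)"
      using cover_superset[OF ca(3)[OF f] T(1) sieve_pull[OF sR ca(1,2)[OF f]]] by simp
  qed
  then have "(m, n) \<in> mrel C J P c" using m n by (auto simp: mrel_def R_def intro!: bexI[of _ R])
  then show ?thesis using cls_eq[OF c(1)] m n by blast
qed

definition ufam where "ufam c x = (\<lambda>f. if f \<in> max_sieve C c then Some (res P f x) else None)"

lemma unit_ufam: "plus_unit C J P c x = cls c (ufam c x)"
  by (simp add: plus_unit_def ufam_def)

lemma ufam_mfam: assumes "c \<in> Obj C" "x \<in> val P c" shows "ufam c x \<in> mfam C J P c"
proof -
  have d: "dom (ufam c x) = max_sieve C c" by (auto simp: ufam_def dom_def split: if_splits)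
  show ?thesis unfolding mfam_def mem_Collect_eq matching_def d
    using cover_max assms res_val res_comp comp_simps by (auto simp: ufam_def max_sieve_def)
qed

lemma psh_mor_unit: "psh_mor C P (plus C J P) (plus_unit C J P)"
  unfolding psh_mor_def unit_ufam
proof (intro conjI ballI)
  fix f x assume f: "f \<in> Arr C" and x: "x \<in> val P (Cod C f)"
  have "pull_fam C f (ufam (Cod C f) x) = ufam (Dom C f) (res P f x)"
    using res_comp[OF f _ _ x] comp_simps[OF f] by (auto simp: pull_fam_def ufam_def max_sieve_def fun_eq_iff)
  then show "cls (Dom C f) (ufam (Dom C f) (res P f x)) = res (plus C J P) f (cls (Cod C f) (ufam (Cod C f) x))"
    using res_cls[OF f ufam_mfam[OF cod_obj[OF f] x]] by simp
qed (use cls_val ufam_mfam in blast)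

lemma unit_local:
  assumes "c \<in> Obj C" "m \<in> mfam C J P c" "f \<in> dom m"
  shows "res (plus C J P) f (cls c m) = plus_unit C J P (Dom C f) (the (m f))"
proof -
  note a = mfam_arr[OF assms]
  have "pull_fam C f m = ufam (Dom C f) (the (m f))"
    using mfam_comp[OF assms] assms(3) by (auto simp: pull_fam_def ufam_def max_sieve_def fun_eq_iff)
  then show ?thesis using res_cls[OF a(1), of m] assms(2) a(2) by (simp add: unit_ufam)
qed

lemma unit_inj:
  assumes is_separated "c \<in> Obj C" "x \<in> val P c" "y \<in> val P c" "plus_unit C J P c x = plus_unit C J P c y"
  shows "x = y"
proof -
  have "(ufam c x, ufam c y) \<in> mrel C J P c" using assms cls_eq ufam_mfam unfolding unit_ufam by blast
  then obtain R where R: "R \<in> J c" "\<forall>f\<in>R. ufam c x f = ufam c y f" by (auto simp: mrel_def)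
  have "\<forall>f\<in>R. res P f x = res P f y" using R cover_arr[OF assms(2) R(1)] by (auto simp: ufam_def max_sieve_def)
  then show ?thesis using assms R unfolding is_separated_def by blast
qed

lemma sheaf_plus:
  assumes sep: is_separated
  shows "sheaf C J (plus C J P)"
proof -
  interpret Q: presheaf C "plus C J P" by (rule presheaf_plus)
  note uD = psh_morD[OF psh_mor_unit]
  show ?thesis
  proof unfold_locales
    fix c M assume c: "c \<in> Obj C" and d: "dom M \<in> J c" and M: "matching C (plus C J P) M"
    note ca = cover_arr[OF c d]
    have Mv: "the (M f) \<in> val (plus C J P) (Dom C f)" if "f \<in> dom M" for f using M that by (auto simp: matching_def)
    have Mc: "f \<cdot> g \<in> dom M" "Dom C (f \<cdot> g) = Dom C g" "the (M (f \<cdot> g)) = res (plus C J P) g (the (M f))" if "f \<in> dom M" "g \<in> Arr C" "Cod C g = Dom C f" for f g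
      using M that cover_comp[OF c d that] comp_simps[OF ca(1)[OF that(1)] that(2,3)] by (auto simp: matching_def)
    define ok where "ok = (\<lambda>k v. k \<in> dom M \<and> v \<in> val P (Dom C k) \<and> the (M k) = plus_unit C J P (Dom C k) v)"
    have ok_uniq: "v = w" if "ok k v" "ok k w" for k v w
      using unit_inj[OF sep ca(3)] that by (auto simp: ok_def)
    define n where "n = (\<lambda>k. if \<exists>v. ok k v then Some (THE v. ok k v) else None)"
    have n: "n k = Some v \<longleftrightarrow> ok k v" for k v
    proof
      assume "ok k v" then show "n k = Some v" using ok_uniq by (auto simp: n_def intro: the_equality)
    next
      assume "n k = Some v"
      then obtain w where "ok k w" "v = (THE v. ok k v)" by (auto simp: n_def split: if_splits)
      then show "ok k v" using ok_uniq by (metis the_equality)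
    qed
    have okc: "ok (f \<cdot> g) (res P g v)" if "ok f v" "g \<in> Arr C" "Cod C g = Dom C f" for f g v
      using that Mc[of f g] res_val[of g v] uD(2)[of g v] by (auto simp: ok_def)
    have dn: "k \<in> dom n \<longleftrightarrow> (\<exists>v. ok k v)" for k using n by (auto simp: dom_def)
    have sn: "sieve C c (dom n)" unfolding sieve_def
    proof (intro conjI ballI impI)
      show "dom n \<subseteq> {f \<in> Arr C. Cod C f = c}" using dn ca unfolding ok_def by blast
    qed (use dn okc in blast)
    have loc: "dom m \<subseteq> pull_sieve C f (dom n) \<and> (\<forall>g\<in>dom m. n (f \<cdot> g) = m g)" 
      if f: "f \<in> dom M" and m: "m \<in> mfam C J P (Dom C f)" "the (M f) = cls (Dom C f) m" for f m
    proof -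
      have "g \<in> Arr C \<and> Cod C g = Dom C f \<and> ok (f \<cdot> g) (the (m g))" if g: "g \<in> dom m" for g
        using mfam_arr[OF ca(3)[OF f] m(1) g] Mc[OF f, of g] unit_local[OF ca(3)[OF f] m(1) g] m(2) by (auto simp: ok_def)
      then show ?thesis using dn n by (fastforce simp: pull_sieve_def)
    qed
    have "dom n \<in> J c"
    proof (rule cover_trans[OF c d sn])
      fix f assume f: "f \<in> dom M"
      obtain m where m: "m \<in> mfam C J P (Dom C f)" "the (M f) = cls (Dom C f) m" using Mv[OF f] by (rule plus_cases)
      then show "pull_sieve C f (dom n) \<in> J (Dom C f)"
        using loc[OF f m] cover_superset[OF ca(3)[OF f] _ sieve_pull[OF sn ca(1,2)[OF f]]] by (auto simp: mfam_def)
    qed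
    moreover have "matching C P n" unfolding matching_def
    proof (intro conjI ballI impI)
      fix f assume "f \<in> dom n"
      then obtain v where v: "n f = Some v" "ok f v" using n by auto
      show "the (n f) \<in> val P (Dom C f)" using v by (auto simp: ok_def)
      fix g assume "g \<in> Arr C" "Cod C g = Dom C f"
      then have "n (f \<cdot> g) = Some (res P g v)" using okc[OF v(2)] n by blast
      then show "n (f \<cdot> g) = map_option (res P g) (n f)" using v by simp
    qed
    ultimately have nf: "n \<in> mfam C J P c" by (simp add: mfam_def)
    let ?X = "cls c n"
    have X: "M f = Some (res (plus C J P) f ?X)" if f: "f \<in> dom M" for f
    proof -
      obtain m where m: "m \<in> mfam C J P (Dom C f)" "the (M f) = cls (Dom C f) m" using Mv[OF f] by (rule plus_cases)
      note l = loc[OF f m]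
      have p: "pull_fam C f n \<in> mfam C J P (Dom C f)" using pull_fam_mfam[OF c nf ca(1,2)[OF f]] .
      have "\<forall>g\<in>dom m. m g = pull_fam C f n g" using l mfam_arr[OF ca(3)[OF f] m(1)] by (auto simp: pull_fam_def)
      moreover have "dom m \<subseteq> dom (pull_fam C f n)" using l dom_pull_fam[OF c nf ca(1,2)[OF f]] by simp
      ultimately have "(m, pull_fam C f n) \<in> mrel C J P (Dom C f)" using m(1) p by (auto simp: mrel_def mfam_def)
      then have "the (M f) = res (plus C J P) f ?X"
        using m p cls_eq[OF ca(3)[OF f]] res_cls[OF ca(1)[OF f], of n] nf ca[OF f] by simp
      then show ?thesis using f by auto
    qed
    show "\<exists>!X. X \<in> val (plus C J P) c \<and> (\<forall>f\<in>dom M. M f = Some (res (plus C J P) f X))"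
    proof (rule ex1I[of _ ?X])
      show "?X \<in> val (plus C J P) c \<and> (\<forall>f\<in>dom M. M f = Some (res (plus C J P) f ?X))" using X cls_val[OF nf] by blast
      fix Y assume Y: "Y \<in> val (plus C J P) c \<and> (\<forall>f\<in>dom M. M f = Some (res (plus C J P) f Y))"
      then have "\<forall>f\<in>dom M. res (plus C J P) f Y = res (plus C J P) f ?X" using X by (metis option.inject)
      then show "Y = ?X" using plus_separated[OF c d] Y cls_val[OF nf] by blast
    qed
  qed
qed

lemma sheaf_sheafify: "sheaf C J (sheafify C J P)"
proof -
  interpret Q: presheaf C "plus C J P" by (rule presheaf_plus)
  interpret Q: presheaf_on_site C J "plus C J P" by unfold_locales
  have "Q.is_separated" unfolding Q.is_separated_def using plus_separated by blast
  then show ?thesis unfolding sheafify_def by (rule Q.sheaf_plus)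
qed

lemma plus_universal:
  assumes Q: "sheaf C J Q" and t: "psh_mor C P Q t"
  obtains s where "psh_mor C (plus C J P) Q s" "psh_eq C P (psh_comp s (plus_unit C J P)) t"
   "\<And>s'. psh_mor C (plus C J P) Q s' \<Longrightarrow> psh_eq C P (psh_comp s' (plus_unit C J P)) t \<Longrightarrow> psh_eq C (plus C J P) s' s"
proof -
  interpret Q: sheaf C J Q by fact
  interpret R: presheaf C "plus C J P" by (rule presheaf_plus)
  note tD = psh_morD[OF t]
  define G where "G = (\<lambda>c m z. z \<in> val Q c \<and> (\<forall>f\<in>dom m. res Q f z = t (Dom C f) (the (m f))))"
  have G_ex: "\<exists>z. G c m z" if c: "c \<in> Obj C" "m \<in> mfam C J P c" for c m
  proof -
    let ?n = "\<lambda>f. map_option (t (Dom C f)) (m f)"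
    have dn: "dom ?n = dom m" by (auto simp: dom_def)
    have d: "dom m \<in> J c" using c by (simp add: mfam_def)
    have "matching C Q ?n" unfolding matching_def dn
    proof (intro conjI ballI impI)
      fix f assume f: "f \<in> dom m"
      note a = mfam_arr[OF c f]
      show "the (?n f) \<in> val Q (Dom C f)" using tD(1)[OF a(3,4)] f by auto
      fix g assume g: "g \<in> Arr C" "Cod C g = Dom C f"
      show "?n (f \<cdot> g) = map_option (res Q g) (?n f)"
        using tD(2)[OF g(1), of "the (m f)"] mfam_comp[OF c f g] a comp_simps[OF a(1) g] f g by auto
    qed
    then obtain z where "z \<in> val Q c" "\<And>f. f \<in> dom m \<Longrightarrow> ?n f = Some (res Q f z)"
      using Q.glue_obtain[OF c(1), of ?n, unfolded dn, OF d] by blast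
    then have "G c m z" by (fastforce simp: G_def)
    then show ?thesis ..
  qed
  have G_uniq: "z = z'" if c: "c \<in> Obj C" and r: "(m, m') \<in> mrel C J P c" "G c m z" "G c m' z'" for c m m' z z'
  proof -
    obtain R where R: "R \<in> J c" "R \<subseteq> dom m \<inter> dom m'" "\<forall>f\<in>R. m f = m' f" using r(1) by (auto simp: mrel_def)
    show ?thesis
    proof (rule Q.separated[OF c R(1)])
      fix f assume "f \<in> R"
      then have "f \<in> dom m" "f \<in> dom m'" "m f = m' f" using R by auto
      then show "res Q f z = res Q f z'" using r unfolding G_def by metis
    qed (use r in \<open>auto simp: G_def\<close>)
  qed
  define s where "s = (\<lambda>c X. SOME z. \<exists>m\<in>X. G c m z)"
  have rfl: "(m, m) \<in> mrel C J P c" if "c \<in> Obj C" "m \<in> mfam C J P c" for c m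
    using equiv_mrel[OF that(1)] that(2) by (auto simp: equiv_def refl_on_def)
  have s: "G c m (s c (cls c m))" if c: "c \<in> Obj C" "m \<in> mfam C J P c" for c m
  proof -
    obtain z where z: "G c m z" using G_ex[OF c] by blast
    then have "\<exists>z. \<exists>m\<in>cls c m. G c m z" using rfl[OF c] by blast
    then have "\<exists>m'\<in>cls c m. G c m' (s c (cls c m))" unfolding s_def by (rule someI_ex)
    then show ?thesis using z G_uniq[OF c(1)] by blast
  qed
  have s_eq: "s c (cls c m) = z" if "c \<in> Obj C" "m \<in> mfam C J P c" "G c m z" for c m z
    using G_uniq[OF that(1) rfl] s that by blast
  have sm: "psh_mor C (plus C J P) Q s" unfolding psh_mor_def
  proof (intro conjI ballI)
    show "s c X \<in> val Q c" if "c \<in> Obj C" "X \<in> val (plus C J P) c" for c X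
      using that(2) by (rule plus_cases) (use s that(1) in \<open>auto simp: G_def\<close>)
    fix f X assume f: "f \<in> Arr C" and X: "X \<in> val (plus C J P) (Cod C f)"
    obtain m where m: "m \<in> mfam C J P (Cod C f)" "X = cls (Cod C f) m" using X by (rule plus_cases)
    note g = s[OF cod_obj[OF f] m(1), folded m(2)]
    have "G (Dom C f) (pull_fam C f m) (res Q f (s (Cod C f) X))"
      unfolding G_def
    proof (intro conjI ballI)
      have v: "s (Cod C f) X \<in> val Q (Cod C f)" using g by (simp add: G_def)
      show "res Q f (s (Cod C f) X) \<in> val Q (Dom C f)" using Q.res_val[OF f v] .
      fix h assume "h \<in> dom (pull_fam C f m)"
      then have h: "h \<in> Arr C" "Cod C h = Dom C f" "f \<cdot> h \<in> dom m" and e: "pull_fam C f m h = m (f \<cdot> h)"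
        by (auto simp: pull_fam_def split: if_splits)
      have "res Q (f \<cdot> h) (s (Cod C f) X) = t (Dom C (f \<cdot> h)) (the (m (f \<cdot> h)))" using g h(3) unfolding G_def by blast
      then show "res Q h (res Q f (s (Cod C f) X)) = t (Dom C h) (the (pull_fam C f m h))"
        using Q.res_comp[OF f h(1,2) v] comp_simps[OF f h(1,2)] e by simp
    qed
    then show "s (Dom C f) (res (plus C J P) f X) = res Q f (s (Cod C f) X)"
      using s_eq[OF dom_obj[OF f] pull_fam_mfam[OF cod_obj[OF f] m(1) f]] res_cls[OF f m(1)] m(2) by simp
  qed
  show ?thesis
  proof (rule that[OF sm])
    show "psh_eq C P (psh_comp s (plus_unit C J P)) t" unfolding psh_eq_def psh_comp_def unit_ufam
    proof (intro ballI)
      fix c x assume c: "c \<in> Obj C" "x \<in> val P c"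
      have "G c (ufam c x) (t c x)" using tD(1)[OF c] tD(2)[of _ x] c(2)
        by (auto simp: G_def ufam_def max_sieve_def split: if_splits)
      then show "s c (cls c (ufam c x)) = t c x" using s_eq[OF c(1) ufam_mfam[OF c]] by blast
    qed
    fix s' assume s': "psh_mor C (plus C J P) Q s'" "psh_eq C P (psh_comp s' (plus_unit C J P)) t"
    show "psh_eq C (plus C J P) s' s" unfolding psh_eq_def
    proof (intro ballI)
      fix c X assume c: "c \<in> Obj C" and X: "X \<in> val (plus C J P) c"
      obtain m where m: "m \<in> mfam C J P c" "X = cls c m" using X by (rule plus_cases)
      have "G c m (s' c X)" unfolding G_def
      proof (intro conjI ballI)
        show "s' c X \<in> val Q c" using psh_morD(1)[OF s'(1) c X] .
        fix f assume f: "f \<in> dom m"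
        note a = mfam_arr[OF c m(1) f]
        show "res Q f (s' c X) = t (Dom C f) (the (m f))"
          using psh_morD(2)[OF s'(1) a(1), of X] X a(2) unit_local[OF c m(1) f] m(2) s'(2) a(3,4)
          by (auto simp: psh_eq_def psh_comp_def)
      qed
      then show "s' c X = s c X" using s_eq[OF c m(1)] m(2) by simp
    qed
  qed
qed

end

lemma plus_arr_cls:
  assumes P: "presheaf_on_site C J P" and Q: "presheaf_on_site C J Q" and t: "psh_mor C P Q t"
    and c: "c \<in> Obj C" and m: "m \<in> mfam C J P c"
  shows "(\<lambda>f. map_option (t (Dom C f)) (m f)) \<in> mfam C J Q c" (is ?A)
   and "plus_arr C J Q t c (mrel C J P c `` {m}) = mrel C J Q c `` {\<lambda>f. map_option (t (Dom C f)) (m f)}" (is ?B)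
proof -
  interpret P: presheaf_on_site C J P by fact
  interpret Q: presheaf_on_site C J Q by fact
  let ?M = "\<lambda>m f. map_option (t (Dom C f)) (m f)"
  have dM: "dom (?M n) = dom n" for n by (auto simp: dom_def)
  have M: "?M n \<in> mfam C J Q c" if n: "n \<in> mfam C J P c" for n
    unfolding mfam_def mem_Collect_eq matching_def dM
  proof (intro conjI ballI impI)
    show "dom n \<in> J c" using n by (simp add: mfam_def)
    fix f assume f: "f \<in> dom n"
    note a = P.mfam_arr[OF c n f]
    show "the (?M n f) \<in> val Q (Dom C f)" using f a psh_morD(1)[OF t a(3,4)] by auto
    fix g assume g: "g \<in> Arr C" "Cod C g = Dom C f"
    show "?M n (f \<cdot>\<^bsub>C\<^esub> g) = map_option (res Q g) (?M n f)"
      using P.mfam_comp[OF c n f g] f P.comp_simps[OF a(1) g] psh_morD(2)[OF t g(1), of "the (n f)"] a g by auto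
  qed
  show ?A using M[OF m] .
  have r: "(?M n, ?M k) \<in> mrel C J Q c" if nk: "(n, k) \<in> mrel C J P c" for n k
  proof -
    obtain R where "n \<in> mfam C J P c" "k \<in> mfam C J P c" "R \<in> J c" "R \<subseteq> dom n \<inter> dom k" "\<forall>f\<in>R. n f = k f"
      using nk by (auto simp: mrel_def)
    moreover have "R \<subseteq> dom (?M n) \<inter> dom (?M k)" "\<forall>f\<in>R. ?M n f = ?M k f" using calculation unfolding dM by auto
    ultimately show ?thesis using M unfolding mrel_def by blast
  qed
  have E: "equiv (mfam C J Q c) (mrel C J Q c)" by (rule Q.equiv_mrel[OF c])
  have mm: "(m, m) \<in> mrel C J P c" using P.equiv_mrel[OF c] m by (auto simp: equiv_def refl_on_def)
  show ?B unfolding plus_arr_def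
  proof (intro set_eqI iffI)
    fix n assume "n \<in> mrel C J Q c `` (?M ` mrel C J P c `` {m})"
    then obtain k where "(m, k) \<in> mrel C J P c" "(?M k, n) \<in> mrel C J Q c" by auto
    then show "n \<in> mrel C J Q c `` {?M m}" using r E by (auto simp: equiv_def dest: transD)
  qed (use mm in auto)
qed

lemma plus_arr_mor:
  assumes P: "presheaf_on_site C J P" and Q: "presheaf_on_site C J Q" and t: "psh_mor C P Q t"
  shows "psh_mor C (plus C J P) (plus C J Q) (plus_arr C J Q t)" (is ?A)
   and "psh_eq C P (psh_comp (plus_arr C J Q t) (plus_unit C J P)) (psh_comp (plus_unit C J Q) t)" (is ?B)
proof -
  interpret P: presheaf_on_site C J P by fact
  interpret Q: presheaf_on_site C J Q by fact
  note pc = plus_arr_cls[OF P Q t]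
  show ?A unfolding psh_mor_def
  proof (intro conjI ballI)
    fix c X assume c: "c \<in> Obj C" and X: "X \<in> val (plus C J P) c"
    obtain m where m: "m \<in> mfam C J P c" "X = P.cls c m" using X by (rule P.plus_cases)
    show "plus_arr C J Q t c X \<in> val (plus C J Q) c" unfolding m(2) pc(2)[OF c m(1)] by (rule Q.cls_val[OF pc(1)[OF c m(1)]])
  next
    fix f X assume f: "f \<in> Arr C" and X: "X \<in> val (plus C J P) (Cod C f)"
    note c = P.cod_obj[OF f]
    obtain m where m: "m \<in> mfam C J P (Cod C f)" "X = P.cls (Cod C f) m" using X by (rule P.plus_cases)
    have "(\<lambda>h. map_option (t (Dom C h)) (pull_fam C f m h)) = pull_fam C f (\<lambda>h. map_option (t (Dom C h)) (m h))"
      using P.comp_simps[OF f] by (auto simp: pull_fam_def fun_eq_iff)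
    then show "plus_arr C J Q t (Dom C f) (res (plus C J P) f X) = res (plus C J Q) f (plus_arr C J Q t (Cod C f) X)"
      unfolding m(2) P.res_cls[OF f m(1)] pc(2)[OF c m(1)] Q.res_cls[OF f pc(1)[OF c m(1)]]
        pc(2)[OF P.dom_obj[OF f] P.pull_fam_mfam[OF c m(1) f refl]] by simp
  qed
  show ?B unfolding psh_eq_def psh_comp_def P.unit_ufam Q.unit_ufam
  proof (intro ballI)
    fix c x assume c: "c \<in> Obj C" and x: "x \<in> val P c"
    have "(\<lambda>f. map_option (t (Dom C f)) (P.ufam c x f)) = Q.ufam c (t c x)"
      using psh_morD(2)[OF t] x by (auto simp: P.ufam_def Q.ufam_def max_sieve_def fun_eq_iff)
    then show "plus_arr C J Q t c (P.cls c (P.ufam c x)) = Q.cls c (Q.ufam c (t c x))"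
      using pc(2)[OF c P.ufam_mfam[OF c x]] by simp
  qed
qed

section \<open>Adequacy: strictification\<close>

lemma strictify_properties:
  fixes C :: "('o, 'a) cat" and D :: "('o, 'a, 'x, 'm) indexed" and D' :: "('o, 'a, 'y, 'n) indexed"
  assumes D: "indexed_category C D" and D': "indexed_category C D'"
    and A: "functor_between (gcat C D) (gcat C D') A" and th: "natural_iso (gcat C D) C (comp_ftr proj A) proj \<theta>"
  defines "S \<equiv> strictify C D D' A \<theta>"
  shows "functor_between (gcat C D) (gcat C D') S" "d \<in> Obj (gcat C D) \<Longrightarrow> snd (fob S d) = snd d"
    "g \<in> Arr (gcat C D) \<Longrightarrow> base (far S g) = base g"
    "natural_iso (gcat C D) (gcat C D') S A (theta_lift C D' A \<theta>)"
    "f \<in> Arr C \<Longrightarrow> x \<in> Obj (fib D (Cod C f)) \<Longrightarrow> v_comp C D D' A \<theta> f x \<in>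
      hom (fib D' (Dom C f)) (fst (fob S (fob (reix D f) x, Dom C f))) (fob (reix D' f) (fst (fob S (x, Cod C f))))"
proof -
  interpret D: indexed_category C D by fact
  interpret D': indexed_category C D' by fact
  interpret G': category "gcat C D'" by (rule D'.category_gcat)
  interpret G: category "gcat C D" by (rule D.category_gcat)
  interpret A: functor_between "gcat C D" "gcat C D'" A by fact
  let ?G = "gcat C D" and ?G' = "gcat C D'"
  define k where "k = theta_lift C D' A \<theta>"
  have t: "inverse_arrows C (\<theta> d) (inv_arr C (\<theta> d))" "\<theta> d \<in> Arr C" "Dom C (\<theta> d) = snd (fob A d)" "Cod C (\<theta> d) = snd d"
    if "d \<in> Obj ?G" for d
    using th that D.inv_arrI[of "\<theta> d"] by (auto simp: natural_iso_def hom_def comp_ftr_def proj_def)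
  have ti: "inv_arr C (\<theta> d) \<in> Arr C" "Cod C (inv_arr C (\<theta> d)) = snd (fob A d)" "Dom C (inv_arr C (\<theta> d)) = snd d"
     "\<theta> d \<cdot>\<^bsub>C\<^esub> inv_arr C (\<theta> d) = Idn C (snd d)" "inv_arr C (\<theta> d) \<cdot>\<^bsub>C\<^esub> \<theta> d = Idn C (snd (fob A d))" "iso_arr C (inv_arr C (\<theta> d))"
    if "d \<in> Obj ?G" for d
    using t[OF that] by (auto simp: inverse_arrows_def hom_def iso_arr_def)
  have fA: "fst (fob A d) \<in> Obj (fib D' (snd (fob A d)))" if "d \<in> Obj ?G" for d
    using A.fob_obj[OF that] by (auto simp: gcat_def)
  have k: "k d \<in> Arr ?G'" "Cod ?G' (k d) = fob A d" "snd (Dom ?G' (k d)) = snd d" "base (k d) = inv_arr C (\<theta> d)" "iso_arr ?G' (k d)"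
    if d: "d \<in> Obj ?G" for d
    using D'.cart_arr_arr[OF ti(1)[OF d], of "fst (fob A d)"] D'.iso_cart_arr[OF ti(6)[OF d], of "fst (fob A d)"] fA[OF d] ti[OF d]
    by (auto simp: k_def theta_lift_def hom_def)
  define l where "l d = inv_arr ?G' (k d)" for d
  have l: "l d \<in> Arr ?G'" "Dom ?G' (l d) = fob A d" "Cod ?G' (l d) = Dom ?G' (k d)" "k d \<cdot>\<^bsub>?G'\<^esub> l d = Idn ?G' (fob A d)"
    "l d \<cdot>\<^bsub>?G'\<^esub> k d = Idn ?G' (Dom ?G' (k d))"
    if d: "d \<in> Obj ?G" for d
    using G'.inv_arrI[OF k(5)[OF d]] k[OF d] by (auto simp: inverse_arrows_def hom_def l_def)
  have bI: "base (Idn ?G' d) = Idn C (snd d)" for d by (cases d) (simp add: D'.gcat_simps)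
  have bl: "base (l d) = \<theta> d" if d: "d \<in> Obj ?G" for d
  proof -
    have "functor_between ?G' C proj" by (rule D'.functor_between_proj)
    then have "base (l d) \<in> hom C (snd (fob A d)) (snd d)"
      using functor_between.far_hom[of ?G' C proj "l d"] l[OF d] k[OF d] by (simp add: proj_def)
    moreover have "inv_arr C (\<theta> d) \<cdot>\<^bsub>C\<^esub> base (l d) = Idn C (snd (fob A d))" "base (l d) \<cdot>\<^bsub>C\<^esub> inv_arr C (\<theta> d) = Idn C (snd d)"
      using D'.base_comp[OF k(1)[OF d] l(1)[OF d]] D'.base_comp[OF l(1)[OF d] k(1)[OF d]] l[OF d] k[OF d] bI by auto
    ultimately have "inverse_arrows C (inv_arr C (\<theta> d)) (base (l d))" using ti[OF d] by (simp add: inverse_arrows_def)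
    moreover have "inverse_arrows C (inv_arr C (\<theta> d)) (\<theta> d)" using t[OF d] ti[OF d] by (simp add: inverse_arrows_def hom_def)
    ultimately show ?thesis by (rule D.inverse_unique)
  qed
  have So: "fob S d = Dom ?G' (k d)" and Sa: "far S g = l (Cod ?G g) \<cdot>\<^bsub>?G'\<^esub> far A g \<cdot>\<^bsub>?G'\<^esub> k (Dom ?G g)" for d g
    by (simp_all add: S_def strictify_def k_def l_def)
  have SH: "far S g \<in> hom ?G' (fob S (Dom ?G g)) (fob S (Cod ?G g))" 
    and Sb: "base (far S g) = base g" and nat: "k (Cod ?G g) \<cdot>\<^bsub>?G'\<^esub> far S g = far A g \<cdot>\<^bsub>?G'\<^esub> k (Dom ?G g)"
    if g: "g \<in> Arr ?G" for g
  proof -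
    note c = G.cod_obj[OF g] and d = G.dom_obj[OF g]
    have a: "far A g \<in> Arr ?G'" "Dom ?G' (far A g) = fob A (Dom ?G g)" "Cod ?G' (far A g) = fob A (Cod ?G g)"
      using A.far_hom[OF g] by (auto simp: hom_def)
    have la: "l (Cod ?G g) \<cdot>\<^bsub>?G'\<^esub> far A g \<in> Arr ?G'" "Dom ?G' (l (Cod ?G g) \<cdot>\<^bsub>?G'\<^esub> far A g) = fob A (Dom ?G g)"
       "Cod ?G' (l (Cod ?G g) \<cdot>\<^bsub>?G'\<^esub> far A g) = Dom ?G' (k (Cod ?G g))"
      using G'.comp_simps[OF l(1)[OF c] a(1)] a l[OF c] by auto
    show "far S g \<in> hom ?G' (fob S (Dom ?G g)) (fob S (Cod ?G g))"
      using G'.comp_simps[OF la(1) k(1)[OF d]] la k[OF d] by (simp add: Sa So hom_def)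
    have ak: "far A g \<cdot>\<^bsub>?G'\<^esub> k (Dom ?G g) \<in> Arr ?G'" "Cod ?G' (far A g \<cdot>\<^bsub>?G'\<^esub> k (Dom ?G g)) = fob A (Cod ?G g)"
      using G'.comp_simps[OF a(1) k(1)[OF d]] a k[OF d] by auto
    have "far S g = l (Cod ?G g) \<cdot>\<^bsub>?G'\<^esub> (far A g \<cdot>\<^bsub>?G'\<^esub> k (Dom ?G g))"
      using G'.assoc[OF l(1)[OF c] a(1) k(1)[OF d]] a l[OF c] k[OF d] by (simp add: Sa)
    then show "k (Cod ?G g) \<cdot>\<^bsub>?G'\<^esub> far S g = far A g \<cdot>\<^bsub>?G'\<^esub> k (Dom ?G g)"
      using G'.assoc[OF k(1)[OF c] l(1)[OF c] ak(1)] ak l[OF c] k[OF c] G'.id_left[OF ak(1)] by simp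
    have n: "\<theta> (Cod ?G g) \<cdot>\<^bsub>C\<^esub> base (far A g) = base g \<cdot>\<^bsub>C\<^esub> \<theta> (Dom ?G g)"
      using th g by (simp add: natural_iso_def comp_ftr_def proj_def)
    have bg: "base g \<in> Arr C" "Dom C (base g) = snd (Dom ?G g)" using g by (auto simp: gcat_def)
    have "base (far S g) = (base g \<cdot>\<^bsub>C\<^esub> \<theta> (Dom ?G g)) \<cdot>\<^bsub>C\<^esub> inv_arr C (\<theta> (Dom ?G g))"
      using D'.base_comp[OF la(1) k(1)[OF d]] D'.base_comp[OF l(1)[OF c] a(1)] bl[OF c] k[OF d] n by (simp add: Sa)
    also have "\<dots> = base g" using D.assoc[OF bg(1) t(2)[OF d] ti(1)[OF d]] t[OF d] ti[OF d] bg D.id_right[OF bg(1)] by simp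
    finally show "base (far S g) = base g" .
  qed
  have mono: "g = h" if "k d \<cdot>\<^bsub>?G'\<^esub> g = k d \<cdot>\<^bsub>?G'\<^esub> h" "d \<in> Obj ?G" "g \<in> Arr ?G'" "h \<in> Arr ?G'" "Cod ?G' g = Dom ?G' (k d)" "Cod ?G' h = Dom ?G' (k d)" for d g h
  proof -
    have "l d \<cdot>\<^bsub>?G'\<^esub> (k d \<cdot>\<^bsub>?G'\<^esub> g) = l d \<cdot>\<^bsub>?G'\<^esub> (k d \<cdot>\<^bsub>?G'\<^esub> h)" using that by simp
    then show ?thesis using G'.assoc[OF l(1)[OF that(2)] k(1)[OF that(2)]] that l[OF that(2)] k[OF that(2)] G'.id_left by metis
  qed
  show SF: "functor_between ?G ?G' S"
  proof unfold_locales
    show "fob S d \<in> Obj ?G'" if "d \<in> Obj ?G" for d using k[OF that] G'.dom_obj by (simp add: So)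
    show "far S g \<in> hom ?G' (fob S (Dom ?G g)) (fob S (Cod ?G g))" if "g \<in> Arr ?G" for g using SH[OF that] .
    fix d assume d: "d \<in> Obj ?G"
    show "far S (Idn ?G d) = Idn ?G' (fob S d)"
      using A.far_id[OF d] G.id_simps[OF d] l[OF d] G'.id_right[OF l(1)[OF d]] by (simp add: Sa So)
  next
    fix f g assume f: "f \<in> Arr ?G" and g: "g \<in> Arr ?G" and e: "Cod ?G g = Dom ?G f"
    note fg = G.comp_simps[OF f g e]
    have sf: "far S f \<in> Arr ?G'" "Dom ?G' (far S f) = fob S (Dom ?G f)" "Cod ?G' (far S f) = fob S (Cod ?G f)" using SH[OF f] by (auto simp: hom_def)
    have sg: "far S g \<in> Arr ?G'" "Dom ?G' (far S g) = fob S (Dom ?G g)" "Cod ?G' (far S g) = fob S (Cod ?G g)" using SH[OF g] by (auto simp: hom_def)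
    have sfg: "far S (f \<cdot>\<^bsub>?G\<^esub> g) \<in> Arr ?G'" "Cod ?G' (far S (f \<cdot>\<^bsub>?G\<^esub> g)) = fob S (Cod ?G f)" using SH[OF fg(1)] fg by (auto simp: hom_def)
    have af: "far A f \<in> Arr ?G'" "Dom ?G' (far A f) = fob A (Dom ?G f)" "Cod ?G' (far A f) = fob A (Cod ?G f)" using A.far_hom[OF f] by (auto simp: hom_def)
    have ag: "far A g \<in> Arr ?G'" "Dom ?G' (far A g) = fob A (Dom ?G g)" "Cod ?G' (far A g) = fob A (Cod ?G g)" using A.far_hom[OF g] by (auto simp: hom_def)
    note c = G.cod_obj[OF f] and d = G.dom_obj[OF f] and b = G.dom_obj[OF g]
    have "k (Cod ?G f) \<cdot>\<^bsub>?G'\<^esub> (far S f \<cdot>\<^bsub>?G'\<^esub> far S g) = (far A f \<cdot>\<^bsub>?G'\<^esub> k (Dom ?G f)) \<cdot>\<^bsub>?G'\<^esub> far S g"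
      using G'.assoc[OF k(1)[OF c] sf(1) sg(1)] sf sg e nat[OF f] by (simp add: So)
    also have "\<dots> = far A f \<cdot>\<^bsub>?G'\<^esub> (far A g \<cdot>\<^bsub>?G'\<^esub> k (Dom ?G g))"
      using G'.assoc[OF af(1) k(1)[OF d] sg(1)] af sg e nat[OF g] k[OF d] by (simp add: So)
    also have "\<dots> = k (Cod ?G f) \<cdot>\<^bsub>?G'\<^esub> far S (f \<cdot>\<^bsub>?G\<^esub> g)"
      using G'.assoc[OF af(1) ag(1) k(1)[OF b]] af ag e k[OF b] nat[OF fg(1)] fg A.far_comp[OF f g e] by simp
    finally show "far S (f \<cdot>\<^bsub>?G\<^esub> g) = far S f \<cdot>\<^bsub>?G'\<^esub> far S g"
      using mono[OF _ c sfg(1)] G'.comp_simps[OF sf(1) sg(1)] sf sg sfg e by (simp add: So)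
  qed
  show "d \<in> Obj ?G \<Longrightarrow> snd (fob S d) = snd d" using k by (simp add: So)
  show "g \<in> Arr ?G \<Longrightarrow> base (far S g) = base g" by (rule Sb)
  show "natural_iso ?G ?G' S A (theta_lift C D' A \<theta>)" unfolding natural_iso_def k_def[symmetric]
    using k nat by (simp add: So hom_def)
  fix f x assume f: "f \<in> Arr C" "x \<in> Obj (fib D (Cod C f))"
  have c: "cart_arr C D f x \<in> Arr ?G" "Dom ?G (cart_arr C D f x) = (fob (reix D f) x, Dom C f)" "Cod ?G (cart_arr C D f x) = (x, Cod C f)"
    "base (cart_arr C D f x) = f"
    using D.cart_arr_arr[OF f] by (auto simp: hom_def)
  obtain b u y where U: "far S (cart_arr C D f x) = GArr b u y" by (cases "far S (cart_arr C D f x)")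
  have "b = f" using Sb[OF c(1)] c U by simp
  then show "v_comp C D D' A \<theta> f x \<in>
      hom (fib D' (Dom C f)) (fst (fob S (fob (reix D f) x, Dom C f))) (fob (reix D' f) (fst (fob S (x, Cod C f))))"
    using SH[OF c(1)] c U unfolding v_comp_def S_def[symmetric]
    by (auto simp: hom_def D'.gcat_simps) (metis D'.gcat_simps(4) fst_conv)+
qed

end

theory Submission
  imports Defs
begin

text \<open>
  A morphism of presheaves is inverted by sheafification if and only if it is a local
  isomorphism: elements with the same image are equal on a cover, and every element of the target comes from the
  source on a cover. Sheafification moreover preserves fibre products. The conditions on sheaves in the theorem
  therefore become statements about arrows of the site itself, in which the sheaves have disappeared: \<open>l_iso g\<close>
  says that composition with \<open>g\<close> is locally bijective (\<open>l_iso_iff\<close>), and \<open>g\<close> is locally cartesian if and only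
  if locally it has the lifting property of a cartesian arrow: a pair of an arrow into the target of \<open>g\<close> and a
  factorization of its projection through \<open>p(g)\<close> lifts locally through \<open>g\<close>, and two lifts of the same pair agree
  locally (\<open>locally_cartesian_iff\<close>).
  The second equivalence uses that \<open>p\<close> is a comorphism of sites, so that \<open>Hom(p(-), c)\<close> and
  \<open>l_obj C J c\<close> composed with \<open>p\<close> have the same sheafification.

  Locally cartesian arrows behave like the squares that define them. Every cartesian arrow is one
  (\<open>cartesian_loc_cart\<close>), they compose and can be cancelled on the left (\<open>loc_cart_comp\<close>,
  \<open>loc_cart_cancel\<close>), and if \<open>p(g)\<close> is invertible, then \<open>g\<close> is locally cartesian if and only if \<open>l_iso g\<close>
  (\<open>loc_cart_iff_l_iso\<close>).

  An arrow of the total category is a cartesian arrow composed with a vertical one, so it is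
  locally cartesian if and only if \<open>l_iso\<close> holds for its vertical part. The functor \<open>A\<close> therefore preserves locally
  cartesian arrows if and only if it preserves those that are vertical, which is the first condition, and
  sends the chosen cartesian arrows to locally cartesian ones. The image of a cartesian arrow
  over \<open>f\<close> is, up to isomorphism, a cartesian arrow over \<open>f\<close> composed with the vertical arrow \<open>v\<^sub>f\<^sup>x\<close>, so the latter
  requirement is the second condition (\<open>loc_cart_image_cart_arr\<close>).

  By the Yoneda lemma \<open>l_iso g\<close> holds if and only if restriction along \<open>g\<close> is
  bijective for every sheaf (\<open>l_iso_res_bij\<close>, \<open>l_isoI_res_bij\<close>). If sheaves stay sheaves after precomposition
  with \<open>A\<close>, this property passes from \<open>g\<close> to \<open>A(g)\<close>, so that the first condition is automatic.
\<close>

section \<open>Properties that hold locally\<close>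

definition locally :: "('o, 'a) cat \<Rightarrow> ('o \<Rightarrow> 'a set set) \<Rightarrow> 'o \<Rightarrow> ('a \<Rightarrow> bool) \<Rightarrow> bool" where
  "locally C J c \<phi> \<longleftrightarrow> (\<exists>R\<in>J c. \<forall>f\<in>R. \<phi> f)"

context site begin

lemma locally_everywhere:
  assumes "c \<in> Obj C" "\<And>f. f \<in> Arr C \<Longrightarrow> Cod C f = c \<Longrightarrow> \<phi> f"
  shows "locally C J c \<phi>"
  unfolding locally_def using cover_max[OF assms(1)] assms(2) by (intro bexI[of _ "max_sieve C c"]) (auto simp: max_sieve_def)

text \<open>The transitivity axiom of a topology: the composites of an arrow \<open>f\<close> of the sieve for \<open>\<phi>\<close> with an arrow of
  the sieve chosen over \<open>Dom C f\<close> form a sieve, which is covering because its pullback along each \<open>f\<close> is.\<close>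

lemma locally_trans:
  assumes c: "c \<in> Obj C" and \<phi>: "locally C J c \<phi>"
    and \<psi>: "\<And>f. f \<in> Arr C \<Longrightarrow> Cod C f = c \<Longrightarrow> \<phi> f \<Longrightarrow> locally C J (Dom C f) (\<lambda>g. \<psi> (f \<cdot> g))"
  shows "locally C J c \<psi>"
proof -
  obtain R where R: "R \<in> J c" "\<forall>f\<in>R. \<phi> f" using \<phi> by (auto simp: locally_def)
  note ca = cover_arr[OF c R(1)]
  have "\<forall>f\<in>R. \<exists>S. S \<in> J (Dom C f) \<and> (\<forall>g\<in>S. \<psi> (f \<cdot> g))"
    using \<psi> R ca unfolding locally_def by blast
  then obtain S where S: "\<And>f. f \<in> R \<Longrightarrow> S f \<in> J (Dom C f)" "\<And>f g. f \<in> R \<Longrightarrow> g \<in> S f \<Longrightarrow> \<psi> (f \<cdot> g)"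
    by metis
  note sa = cover_arr[OF ca(3) S(1)]
  define T where "T = {f \<cdot> g | f g. f \<in> R \<and> g \<in> S f}"
  have fg: "f \<cdot> g \<in> Arr C" "Dom C (f \<cdot> g) = Dom C g" "Cod C (f \<cdot> g) = c" if "f \<in> R" "g \<in> S f" for f g
    using comp_simps[of f g] ca[OF that(1)] sa[OF that(1,1,2)] by auto
  have sT: "sieve C c T" unfolding sieve_def
  proof (intro conjI ballI impI)
    show "T \<subseteq> {f \<in> Arr C. Cod C f = c}" using fg by (auto simp: T_def)
    fix t h assume t: "t \<in> T" and h: "h \<in> Arr C" "Cod C h = Dom C t"
    obtain f g where f: "t = f \<cdot> g" "f \<in> R" "g \<in> S f" using t by (auto simp: T_def)
    have hg: "Cod C h = Dom C g" using h f fg by simp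
    have "t \<cdot> h = f \<cdot> (g \<cdot> h)"
      using assoc[of f g h] ca[OF f(2)] sa[OF f(2,2,3)] h(1) hg f(1) by simp
    moreover have "g \<cdot> h \<in> S f" using cover_comp[OF ca(3) S(1) f(3) h(1) hg] f(2) by blast
    ultimately show "t \<cdot> h \<in> T" using f(2) by (auto simp: T_def)
  qed
  have "T \<in> J c"
  proof (rule cover_trans[OF c R(1) sT])
    fix f assume f: "f \<in> R"
    have "S f \<subseteq> pull_sieve C f T" using sa[OF f f] f by (auto simp: pull_sieve_def T_def)
    then show "pull_sieve C f T \<in> J (Dom C f)"
      using cover_superset[OF ca(3)[OF f] S(1)[OF f] sieve_pull[OF sT ca(1,2)[OF f]]] by simp
  qed
  moreover have "\<forall>t\<in>T. \<psi> t" using S(2) by (auto simp: T_def)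
  ultimately show ?thesis by (auto simp: locally_def)
qed

lemma locally_mono:
  assumes "c \<in> Obj C" "locally C J c \<phi>" "\<And>f. f \<in> Arr C \<Longrightarrow> Cod C f = c \<Longrightarrow> \<phi> f \<Longrightarrow> \<psi> f"
  shows "locally C J c \<psi>"
proof -
  obtain R where R: "R \<in> J c" "\<forall>f\<in>R. \<phi> f" using assms(2) by (auto simp: locally_def)
  then have "\<forall>f\<in>R. \<psi> f" using assms(3) cover_arr[OF assms(1) R(1)] by blast
  then show ?thesis using R(1) by (auto simp: locally_def)
qed

lemma locally_conj:
  assumes "c \<in> Obj C" "locally C J c \<phi>" "locally C J c \<psi>"
  shows "locally C J c (\<lambda>f. \<phi> f \<and> \<psi> f)"
proof -
  obtain R S where R: "R \<in> J c" "\<forall>f\<in>R. \<phi> f" and S: "S \<in> J c" "\<forall>f\<in>S. \<psi> f"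
    using assms(2,3) by (auto simp: locally_def)
  then show ?thesis using cover_inter[OF assms(1) R(1) S(1)]
    unfolding locally_def by (intro bexI[of _ "R \<inter> S"]) auto
qed

end

section \<open>Local isomorphisms of presheaves\<close>

definition locally_inj ::
  "('o, 'a) cat \<Rightarrow> ('o \<Rightarrow> 'a set set) \<Rightarrow> ('o, 'a, 'v) psh \<Rightarrow> ('o \<Rightarrow> 'v \<Rightarrow> 'w) \<Rightarrow> bool" where
  "locally_inj C J P t \<longleftrightarrow> (\<forall>c\<in>Obj C. \<forall>x\<in>val P c. \<forall>y\<in>val P c. t c x = t c y \<longrightarrow>
     locally C J c (\<lambda>f. res P f x = res P f y))"

definition locally_surj ::
  "('o, 'a) cat \<Rightarrow> ('o \<Rightarrow> 'a set set) \<Rightarrow> ('o, 'a, 'v) psh \<Rightarrow> ('o, 'a, 'w) psh \<Rightarrow> ('o \<Rightarrow> 'v \<Rightarrow> 'w) \<Rightarrow> bool" where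
  "locally_surj C J P Q t \<longleftrightarrow> (\<forall>c\<in>Obj C. \<forall>y\<in>val Q c.
     locally C J c (\<lambda>f. res Q f y \<in> t (Dom C f) ` val P (Dom C f)))"

text \<open>These are the morphisms that sheafification inverts.\<close>

definition local_iso ::
  "('o, 'a) cat \<Rightarrow> ('o \<Rightarrow> 'a set set) \<Rightarrow> ('o, 'a, 'v) psh \<Rightarrow> ('o, 'a, 'w) psh \<Rightarrow> ('o \<Rightarrow> 'v \<Rightarrow> 'w) \<Rightarrow> bool" where
  "local_iso C J P Q t \<longleftrightarrow> locally_inj C J P t \<and> locally_surj C J P Q t"

lemma locally_injD:
  "locally_inj C J P t \<Longrightarrow> c \<in> Obj C \<Longrightarrow> x \<in> val P c \<Longrightarrow> y \<in> val P c \<Longrightarrow> t c x = t c y \<Longrightarrow>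
    locally C J c (\<lambda>f. res P f x = res P f y)"
  by (auto simp: locally_inj_def)

lemma locally_surjD:
  "locally_surj C J P Q t \<Longrightarrow> c \<in> Obj C \<Longrightarrow> y \<in> val Q c \<Longrightarrow>
    locally C J c (\<lambda>f. res Q f y \<in> t (Dom C f) ` val P (Dom C f))"
  by (auto simp: locally_surj_def)

context site begin

context
  fixes P :: "('o, 'a, 'u) psh" and Q :: "('o, 'a, 'v) psh" and R :: "('o, 'a, 'w) psh" and t s
  assumes P: "presheaf C P" and Q: "presheaf C Q" and R: "presheaf C R"
    and t: "psh_mor C P Q t" and s: "psh_mor C Q R s"
begin

interpretation P: presheaf C P by (rule P)
interpretation Q: presheaf C Q by (rule Q)
interpretation R: presheaf C R by (rule R)

text \<open>Local injectivity and local surjectivity of a composite and of its two factors; together they give the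
  two-out-of-three property of local isomorphisms.\<close>

lemma locally_inj_comp:
  assumes "locally_inj C J P t" "locally_inj C J Q s"
  shows "locally_inj C J P (psh_comp s t)"
  unfolding locally_inj_def psh_comp_def
proof (intro ballI impI)
  fix c x y assume c: "c \<in> Obj C" and x: "x \<in> val P c" and y: "y \<in> val P c" and e: "s c (t c x) = s c (t c y)"
  show "locally C J c (\<lambda>f. res P f x = res P f y)"
  proof (rule locally_trans[OF c locally_injD[OF assms(2) c _ _ e]])
    fix f assume f: "f \<in> Arr C" "Cod C f = c" "res Q f (t c x) = res Q f (t c y)"
    have "locally C J (Dom C f) (\<lambda>g. res P g (res P f x) = res P g (res P f y))"
      using locally_injD[OF assms(1) dom_obj[OF f(1)], of "res P f x" "res P f y"]
        psh_morD(2)[OF t f(1)] P.res_val[OF f(1)] x y f by simp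
    then show "locally C J (Dom C f) (\<lambda>g. res P (f \<cdot> g) x = res P (f \<cdot> g) y)"
      by (rule locally_mono[OF dom_obj[OF f(1)]]) (use P.res_comp[OF f(1)] f x y in simp)
  qed (use psh_morD(1)[OF t c] x y in auto)
qed

lemma locally_surj_comp:
  assumes "locally_surj C J P Q t" "locally_surj C J Q R s"
  shows "locally_surj C J P R (psh_comp s t)"
  unfolding locally_surj_def psh_comp_def
proof (intro ballI)
  fix c z assume c: "c \<in> Obj C" and z: "z \<in> val R c"
  show "locally C J c (\<lambda>f. res R f z \<in> (\<lambda>x. s (Dom C f) (t (Dom C f) x)) ` val P (Dom C f))"
  proof (rule locally_trans[OF c locally_surjD[OF assms(2) c z]])
    fix f assume f: "f \<in> Arr C" "Cod C f = c" "res R f z \<in> s (Dom C f) ` val Q (Dom C f)"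
    then obtain y where y: "y \<in> val Q (Dom C f)" "res R f z = s (Dom C f) y" by auto
    show "locally C J (Dom C f) (\<lambda>g. res R (f \<cdot> g) z \<in> (\<lambda>x. s (Dom C (f \<cdot> g)) (t (Dom C (f \<cdot> g)) x)) ` val P (Dom C (f \<cdot> g)))"
    proof (rule locally_mono[OF dom_obj[OF f(1)] locally_surjD[OF assms(1) dom_obj[OF f(1)] y(1)]])
      fix g assume g: "g \<in> Arr C" "Cod C g = Dom C f" "res Q g y \<in> t (Dom C g) ` val P (Dom C g)"
      have "res R (f \<cdot> g) z = s (Dom C g) (res Q g y)"
        using R.res_comp[OF f(1) g(1,2)] psh_morD(2)[OF s g(1)] z y f g by simp
      then show "res R (f \<cdot> g) z \<in> (\<lambda>x. s (Dom C (f \<cdot> g)) (t (Dom C (f \<cdot> g)) x)) ` val P (Dom C (f \<cdot> g))"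
        using g(3) comp_simps[OF f(1) g(1,2)] by auto
    qed
  qed
qed

lemma locally_inj_right_factor: "locally_inj C J P (psh_comp s t) \<Longrightarrow> locally_inj C J P t"
  by (simp add: locally_inj_def psh_comp_def)

lemma locally_surj_left_factor: 
  assumes "locally_surj C J P R (psh_comp s t)" shows "locally_surj C J Q R s"
  unfolding locally_surj_def
proof (intro ballI)
  fix c z assume c: "c \<in> Obj C" and z: "z \<in> val R c"
  show "locally C J c (\<lambda>f. res R f z \<in> s (Dom C f) ` val Q (Dom C f))"
    by (rule locally_mono[OF c locally_surjD[OF assms c z]]) (use psh_morD(1)[OF t dom_obj] in \<open>auto simp: psh_comp_def\<close>)
qed

lemma locally_inj_left_factor:
  assumes "locally_surj C J P Q t" "locally_inj C J P (psh_comp s t)"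
  shows "locally_inj C J Q s"
  unfolding locally_inj_def
proof (intro ballI impI)
  fix c x y assume c: "c \<in> Obj C" and x: "x \<in> val Q c" and y: "y \<in> val Q c" and e: "s c x = s c y"
  show "locally C J c (\<lambda>f. res Q f x = res Q f y)"
  proof (rule locally_trans[OF c locally_conj[OF c locally_surjD[OF assms(1) c x] locally_surjD[OF assms(1) c y]]])
    fix f assume f: "f \<in> Arr C" "Cod C f = c"
      and "res Q f x \<in> t (Dom C f) ` val P (Dom C f) \<and> res Q f y \<in> t (Dom C f) ` val P (Dom C f)"
    then obtain x' y' where x': "x' \<in> val P (Dom C f)" "res Q f x = t (Dom C f) x'"
      and y': "y' \<in> val P (Dom C f)" "res Q f y = t (Dom C f) y'" by auto
    note d = dom_obj[OF f(1)]
    have "s (Dom C f) (res Q f x) = s (Dom C f) (res Q f y)" using psh_morD(2)[OF s f(1)] f x y e by simp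
    then have "psh_comp s t (Dom C f) x' = psh_comp s t (Dom C f) y'" using x' y' by (simp add: psh_comp_def)
    then show "locally C J (Dom C f) (\<lambda>g. res Q (f \<cdot> g) x = res Q (f \<cdot> g) y)"
    proof (rule locally_mono[OF d locally_injD[OF assms(2) d x'(1) y'(1)]])
      fix g assume g: "g \<in> Arr C" "Cod C g = Dom C f" "res P g x' = res P g y'"
      show "res Q (f \<cdot> g) x = res Q (f \<cdot> g) y"
        using Q.res_comp[OF f(1) g(1,2)] f g x y x' y' psh_morD(2)[OF t g(1), symmetric] by simp
    qed
  qed
qed

lemma locally_surj_right_factor:
  assumes "locally_inj C J Q s" "locally_surj C J P R (psh_comp s t)"
  shows "locally_surj C J P Q t"
  unfolding locally_surj_def
proof (intro ballI)
  fix c y assume c: "c \<in> Obj C" and y: "y \<in> val Q c"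
  note sy = psh_morD(1)[OF s c y]
  show "locally C J c (\<lambda>f. res Q f y \<in> t (Dom C f) ` val P (Dom C f))"
  proof (rule locally_trans[OF c locally_surjD[OF assms(2) c sy]])
    fix f assume f: "f \<in> Arr C" "Cod C f = c" "res R f (s c y) \<in> psh_comp s t (Dom C f) ` val P (Dom C f)"
    then obtain x where x: "x \<in> val P (Dom C f)" "res R f (s c y) = s (Dom C f) (t (Dom C f) x)"
      by (auto simp: psh_comp_def)
    note d = dom_obj[OF f(1)]
    have e: "s (Dom C f) (res Q f y) = s (Dom C f) (t (Dom C f) x)" using psh_morD(2)[OF s f(1)] f y x by simp
    have "res Q f y \<in> val Q (Dom C f)" "t (Dom C f) x \<in> val Q (Dom C f)"
      using Q.res_val[OF f(1)] f y psh_morD(1)[OF t d x(1)] by auto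
    then show "locally C J (Dom C f) (\<lambda>g. res Q (f \<cdot> g) y \<in> t (Dom C (f \<cdot> g)) ` val P (Dom C (f \<cdot> g)))"
    proof (rule locally_mono[OF d locally_injD[OF assms(1) d _ _ e]])
      fix g assume g: "g \<in> Arr C" "Cod C g = Dom C f" "res Q g (res Q f y) = res Q g (t (Dom C f) x)"
      have "res Q (f \<cdot> g) y = t (Dom C g) (res P g x)"
        using Q.res_comp[OF f(1) g(1,2)] psh_morD(2)[OF t g(1)] f g y x by simp
      then show "res Q (f \<cdot> g) y \<in> t (Dom C (f \<cdot> g)) ` val P (Dom C (f \<cdot> g))"
        using P.res_val[OF g(1)] x g comp_simps[OF f(1) g(1,2)] by auto
    qed
  qed
qed

lemma local_iso_comp:
  "local_iso C J P Q t \<Longrightarrow> local_iso C J Q R s \<Longrightarrow> local_iso C J P R (psh_comp s t)"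
  unfolding local_iso_def by (blast intro: locally_inj_comp locally_surj_comp)

lemma local_iso_cancel_right:
  assumes "local_iso C J P Q t" shows "local_iso C J P R (psh_comp s t) \<longleftrightarrow> local_iso C J Q R s"
  using assms unfolding local_iso_def
  by (blast intro: locally_inj_left_factor locally_surj_left_factor locally_inj_comp locally_surj_comp)

lemma local_iso_cancel_left:
  assumes "local_iso C J Q R s" shows "local_iso C J P R (psh_comp s t) \<longleftrightarrow> local_iso C J P Q t"
  using assms unfolding local_iso_def
  by (blast intro: locally_inj_right_factor locally_surj_right_factor locally_inj_comp locally_surj_comp)

end

lemma local_iso_cong:
  assumes P: "presheaf C P" and e: "psh_eq C P s t" and s: "local_iso C J P Q s" shows "local_iso C J P Q t"
proof -
  have "s d ` val P d = t d ` val P d" if "d \<in> Obj C" for d using e that by (force simp: psh_eq_def)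
  moreover have "locally_inj C J P t" using s e by (simp add: local_iso_def locally_inj_def psh_eq_def)
  moreover have "locally_surj C J P Q t" unfolding locally_surj_def
  proof (intro ballI)
    fix c y assume c: "c \<in> Obj C" and y: "y \<in> val Q c"
    have "locally_surj C J P Q s" using s by (simp add: local_iso_def)
    then show "locally C J c (\<lambda>f. res Q f y \<in> t (Dom C f) ` val P (Dom C f))"
      by (rule locally_mono[OF c locally_surjD[OF _ c y]]) (use calculation(1)[OF dom_obj] in simp)
  qed
  ultimately show ?thesis by (simp add: local_iso_def)
qed

text \<open>This compares a morphism with its sheafification: the local isomorphisms \<open>u\<close> and \<open>v\<close> stand for the units.\<close>

lemma local_iso_square:
  assumes P: "presheaf C P" "presheaf C Q" "presheaf C P'" "presheaf C Q'"
    and m: "psh_mor C P Q t" "psh_mor C P' Q' t'" "psh_mor C P P' u" "psh_mor C Q Q' v"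
    and e: "psh_eq C P (psh_comp v t) (psh_comp t' u)"
    and uv: "local_iso C J P P' u" "local_iso C J Q Q' v"
  shows "local_iso C J P Q t \<longleftrightarrow> local_iso C J P' Q' t'"
proof -
  have "local_iso C J P Q t \<longleftrightarrow> local_iso C J P Q' (psh_comp v t)"
    using local_iso_cancel_left[OF P(1,2,4) m(1,4) uv(2)] by simp
  also have "\<dots> \<longleftrightarrow> local_iso C J P Q' (psh_comp t' u)"
  proof
    show "local_iso C J P Q' (psh_comp v t) \<Longrightarrow> local_iso C J P Q' (psh_comp t' u)"
      by (rule local_iso_cong[OF P(1) e])
    have "psh_eq C P (psh_comp t' u) (psh_comp v t)" using e by (simp add: psh_eq_def)
    then show "local_iso C J P Q' (psh_comp t' u) \<Longrightarrow> local_iso C J P Q' (psh_comp v t)"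
      by (rule local_iso_cong[OF P(1)])
  qed
  also have "\<dots> \<longleftrightarrow> local_iso C J P' Q' t'"
    using local_iso_cancel_right[OF P(1,3,4) m(3,2) uv(1)] by simp
  finally show ?thesis .
qed

text \<open>For a locally injective morphism of sheaves, which is injective because the source is separated, local preimages
  of a section are unique, so they match and can be glued.\<close>

lemma local_iso_sheaves_iff_bij:
  assumes P: "sheaf C J P" and Q: "sheaf C J Q" and t: "psh_mor C P Q t"
  shows "local_iso C J P Q t \<longleftrightarrow> (\<forall>c\<in>Obj C. bij_betw (t c) (val P c) (val Q c))"
proof -
  interpret P: sheaf C J P by fact
  interpret Q: sheaf C J Q by fact
  show ?thesis
  proof
    assume L: "local_iso C J P Q t"
    have inj: "x = y" if "c \<in> Obj C" "x \<in> val P c" "y \<in> val P c" "t c x = t c y" for c x y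
      using locally_injD[of C J P t, OF _ that] L P.separated[OF that(1) _ that(2,3)] by (auto simp: local_iso_def locally_def)
    have "\<exists>x\<in>val P c. t c x = y" if c: "c \<in> Obj C" and y: "y \<in> val Q c" for c y
    proof -
      obtain R where R: "R \<in> J c" "\<forall>f\<in>R. res Q f y \<in> t (Dom C f) ` val P (Dom C f)"
        using locally_surjD[of C J P Q t, OF _ c y] L unfolding local_iso_def locally_def by blast
      note ca = cover_arr[OF c R(1)]
      have "\<forall>f\<in>R. \<exists>x. x \<in> val P (Dom C f) \<and> t (Dom C f) x = res Q f y" using R(2) by (metis imageE)
      then obtain x where x: "\<And>f. f \<in> R \<Longrightarrow> x f \<in> val P (Dom C f)" "\<And>f. f \<in> R \<Longrightarrow> t (Dom C f) (x f) = res Q f y"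
        by metis
      define m where "m f = (if f \<in> R then Some (x f) else None)" for f
      have dm: "dom m = R" by (auto simp: m_def dom_def)
      have "matching C P m" unfolding matching_def dm
      proof (intro conjI ballI impI)
        fix f assume f: "f \<in> R"
        show "the (m f) \<in> val P (Dom C f)" using x f by (simp add: m_def)
        fix g assume g: "g \<in> Arr C" "Cod C g = Dom C f"
        note fg = cover_comp[OF c R(1) f g] comp_simps[OF ca(1)[OF f] g]
        have "x (f \<cdot> g) = res P g (x f)"
        proof (rule inj[OF dom_obj[OF g(1)]])
          show "t (Dom C g) (x (f \<cdot> g)) = t (Dom C g) (res P g (x f))"
            using x[OF fg(1)] fg x[OF f] psh_morD(2)[OF t g(1)] g ca[OF f] Q.res_comp[OF ca(1)[OF f] g] y by simp
        qed (use x[OF fg(1)] fg x[OF f] P.res_val[OF g(1)] g in auto)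
        then show "m (f \<cdot> g) = map_option (res P g) (m f)" using f fg by (simp add: m_def)
      qed
      then obtain z where z: "z \<in> val P c" "\<And>f. f \<in> R \<Longrightarrow> m f = Some (res P f z)"
        using P.glue_obtain[OF c, of m, unfolded dm, OF R(1)] by blast
      have "t c z = y"
      proof (rule Q.separated[OF c R(1) psh_morD(1)[OF t c z(1)] y])
        fix f assume f: "f \<in> R"
        have "x f = res P f z" using z(2)[OF f] f by (simp add: m_def)
        then show "res Q f (t c z) = res Q f y" using psh_morD(2)[OF t ca(1)[OF f]] ca[OF f] z(1) x(2)[OF f] by simp
      qed
      then show ?thesis using z by blast
    qed
    then show "\<forall>c\<in>Obj C. bij_betw (t c) (val P c) (val Q c)"
      unfolding bij_betw_def inj_on_def using inj psh_morD(1)[OF t] by (auto simp: image_iff)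
  next
    assume B: "\<forall>c\<in>Obj C. bij_betw (t c) (val P c) (val Q c)"
    have "locally_inj C J P t" unfolding locally_inj_def
    proof (intro ballI impI locally_everywhere)
      fix c x y f assume "c \<in> Obj C" "x \<in> val P c" "y \<in> val P c" "t c x = t c y"
      then have "x = y" using B by (auto simp: bij_betw_def dest: inj_onD)
      then show "res P f x = res P f y" by simp
    qed
    moreover have "locally_surj C J P Q t" unfolding locally_surj_def
    proof (intro ballI locally_everywhere)
      fix c y f assume "c \<in> Obj C" "y \<in> val Q c" and f: "f \<in> Arr C" "Cod C f = c"
      then have "res Q f y \<in> val Q (Dom C f)" using Q.res_val by auto
      then show "res Q f y \<in> t (Dom C f) ` val P (Dom C f)"
        using B dom_obj[OF f(1)] by (auto simp: bij_betw_def)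
    qed
    ultimately show "local_iso C J P Q t" by (simp add: local_iso_def)
  qed
qed

lemma psh_iso_iff_bij:
  assumes P: "presheaf C P" and t: "psh_mor C P Q t"
  shows "psh_iso C P Q t \<longleftrightarrow> (\<forall>c\<in>Obj C. bij_betw (t c) (val P c) (val Q c))"
proof
  interpret P: presheaf C P by fact
  assume "psh_iso C P Q t"
  then obtain s where s: "psh_mor C Q P s" "\<And>c x. c \<in> Obj C \<Longrightarrow> x \<in> val P c \<Longrightarrow> s c (t c x) = x"
     "\<And>c x. c \<in> Obj C \<Longrightarrow> x \<in> val Q c \<Longrightarrow> t c (s c x) = x" by (auto simp: psh_iso_def psh_eq_def psh_comp_def)
  show "\<forall>c\<in>Obj C. bij_betw (t c) (val P c) (val Q c)"
    using s psh_morD(1)[OF s(1)] psh_morD(1)[OF t] by (intro ballI bij_betw_byWitness[of _ "s _"]) auto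
next
  interpret P: presheaf C P by fact
  assume B: "\<forall>c\<in>Obj C. bij_betw (t c) (val P c) (val Q c)"
  define s where "s c = inv_into (val P c) (t c)" for c
  have s: "s c y \<in> val P c" "t c (s c y) = y" if "c \<in> Obj C" "y \<in> val Q c" for c y
    using B that by (auto simp: s_def bij_betw_def inv_into_into f_inv_into_f)
  have st: "s c (t c x) = x" if "c \<in> Obj C" "x \<in> val P c" for c x
    using B that by (auto simp: s_def bij_betw_def)
  have "s (Dom C f) (res Q f y) = res P f (s (Cod C f) y)" if f: "f \<in> Arr C" and y: "y \<in> val Q (Cod C f)" for f y
  proof -
    note sy = s[OF cod_obj[OF f] y]
    have "res Q f y = t (Dom C f) (res P f (s (Cod C f) y))" using psh_morD(2)[OF t f sy(1)] sy(2) by simp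
    then show ?thesis using st[OF dom_obj[OF f] P.res_val[OF f sy(1)]] by simp
  qed
  then have "psh_mor C Q P s" using s by (auto simp: psh_mor_def)
  then show "psh_iso C P Q t" using t s st by (auto simp: psh_iso_def psh_eq_def psh_comp_def)
qed

end

context presheaf_on_site begin

text \<open>Two elements with the same image in \<open>plus C J P\<close> are by construction equal on a cover, and every class is
  represented on a cover by a family of elements; the unit of the plus construction is therefore locally
  bijective.\<close>

lemma local_iso_plus_unit: "local_iso C J P (plus C J P) (plus_unit C J P)"
  unfolding local_iso_def
proof
  show "locally_inj C J P (plus_unit C J P)" unfolding locally_inj_def
  proof (intro ballI impI)
    fix c x y assume c: "c \<in> Obj C" and xy: "x \<in> val P c" "y \<in> val P c" "plus_unit C J P c x = plus_unit C J P c y"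
    have "(ufam c x, ufam c y) \<in> mrel C J P c" using c xy cls_eq ufam_mfam unfolding unit_ufam by blast
    then obtain R where R: "R \<in> J c" "\<forall>f\<in>R. ufam c x f = ufam c y f" by (auto simp: mrel_def)
    then show "locally C J c (\<lambda>f. res P f x = res P f y)"
      using cover_arr[OF c R(1)] by (auto simp: locally_def ufam_def max_sieve_def)
  qed
  show "locally_surj C J P (plus C J P) (plus_unit C J P)" unfolding locally_surj_def
  proof (intro ballI)
    fix c X assume c: "c \<in> Obj C" and X: "X \<in> val (plus C J P) c"
    obtain m where m: "m \<in> mfam C J P c" "X = cls c m" using X by (rule plus_cases)
    have "\<forall>f\<in>dom m. res (plus C J P) f X \<in> plus_unit C J P (Dom C f) ` val P (Dom C f)"
      using unit_local[OF c m(1)] mfam_arr(4)[OF c m(1)] m(2) by simp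
    then show "locally C J c (\<lambda>f. res (plus C J P) f X \<in> plus_unit C J P (Dom C f) ` val P (Dom C f))"
      using m(1) by (auto simp: locally_def mfam_def)
  qed
qed

lemma presheaf_on_site_plus: "presheaf_on_site C J (plus C J P)"
  using presheaf_plus by (simp add: presheaf_on_site_def site_axioms)

lemma sheafify_unit_properties:
  shows "psh_mor C P (sheafify C J P) (sheafify_unit C J P)"
    and "local_iso C J P (sheafify C J P) (sheafify_unit C J P)"
proof -
  interpret Q: presheaf_on_site C J "plus C J P" by (rule presheaf_on_site_plus)
  have cat: "category C" by unfold_locales
  show "psh_mor C P (sheafify C J P) (sheafify_unit C J P)"
    unfolding sheafify_def sheafify_unit_def
    by (rule psh_mor_comp[OF cat presheaf_axioms psh_mor_unit Q.psh_mor_unit])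
  show "local_iso C J P (sheafify C J P) (sheafify_unit C J P)"
    unfolding sheafify_def sheafify_unit_def
    by (rule local_iso_comp[OF presheaf_axioms presheaf_plus Q.presheaf_plus psh_mor_unit Q.psh_mor_unit
       local_iso_plus_unit Q.local_iso_plus_unit])
qed

end

lemma sheafify_arr_properties:
  assumes P: "presheaf_on_site C J P" and Q: "presheaf_on_site C J Q" and t: "psh_mor C P Q t"
  shows "psh_mor C (sheafify C J P) (sheafify C J Q) (sheafify_arr C J Q t)"
   and "psh_eq C P (psh_comp (sheafify_arr C J Q t) (sheafify_unit C J P)) (psh_comp (sheafify_unit C J Q) t)"
proof -
  interpret P: presheaf_on_site C J P by fact
  interpret Q: presheaf_on_site C J Q by fact
  note 1 = plus_arr_mor[OF P Q t]
  note 2 = plus_arr_mor[OF P.presheaf_on_site_plus Q.presheaf_on_site_plus 1(1)]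
  show "psh_mor C (sheafify C J P) (sheafify C J Q) (sheafify_arr C J Q t)"
    using 2(1) by (simp add: sheafify_def sheafify_arr_def)
  show "psh_eq C P (psh_comp (sheafify_arr C J Q t) (sheafify_unit C J P)) (psh_comp (sheafify_unit C J Q) t)"
    unfolding psh_eq_def psh_comp_def sheafify_arr_def sheafify_unit_def
  proof (intro ballI)
    fix c x assume c: "c \<in> Obj C" and x: "x \<in> val P c"
    show "plus_arr C J (plus C J Q) (plus_arr C J Q t) c (plus_unit C J (plus C J P) c (plus_unit C J P c x)) =
      plus_unit C J (plus C J Q) c (plus_unit C J Q c (t c x))"
      using 2(2) c psh_morD(1)[OF P.psh_mor_unit c x] 1(2) x unfolding psh_eq_def psh_comp_def by metis
  qed
qed

section \<open>Pullbacks of sheaves as local isomorphisms\<close>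

lemma fibre_prod_simps:
  "(x, y) \<in> val (fibre_prod A B f g) c \<longleftrightarrow> x \<in> val A c \<and> y \<in> val B c \<and> f c x = g c y"
  "res (fibre_prod A B f g) h (x, y) = (res A h x, res B h y)"
  by (simp_all add: fibre_prod_def)

lemma presheaf_fibre_prod:
  assumes "presheaf C A" "presheaf C B" "psh_mor C A E f" "psh_mor C B E g"
  shows "presheaf C (fibre_prod A B f g)"
proof -
  interpret A: presheaf C A by fact
  interpret B: presheaf C B by fact
  show ?thesis
    by unfold_locales (use psh_morD(2)[OF assms(3)] psh_morD(2)[OF assms(4)] A.res_val B.res_val A.res_id B.res_id
      A.res_comp B.res_comp in \<open>auto simp: fibre_prod_def\<close>)
qed

context site begin

text \<open>Sheafification preserves fibre products: the pairs \<open>(x, y)\<close> on the right are locally images of pairs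
  on the left, which agree in \<open>E\<close> after a further localization because \<open>e\<close> is locally injective.\<close>

lemma local_iso_fibre_prod:
  assumes P: "presheaf C A" "presheaf C B" "presheaf C E" "presheaf C A'" "presheaf C B'"
    and m: "psh_mor C A E f" "psh_mor C B E g" "psh_mor C A' E' f'" "psh_mor C B' E' g'"
    and ab: "psh_mor C A A' a" "psh_mor C B B' b"
    and eq: "psh_eq C A (psh_comp e f) (psh_comp f' a)" "psh_eq C B (psh_comp e g) (psh_comp g' b)"
    and L: "local_iso C J A A' a" "local_iso C J B B' b" "locally_inj C J E e"
  shows "psh_mor C (fibre_prod A B f g) (fibre_prod A' B' f' g') (\<lambda>c (x, y). (a c x, b c y))"
    and "local_iso C J (fibre_prod A B f g) (fibre_prod A' B' f' g') (\<lambda>c (x, y). (a c x, b c y))"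
proof -
  interpret A: presheaf C A by fact
  interpret B: presheaf C B by fact
  interpret A': presheaf C A' by fact
  interpret B': presheaf C B' by fact
  have eqD: "e c (f c x) = f' c (a c x)" if "c \<in> Obj C" "x \<in> val A c" for c x
    using eq(1) that by (simp add: psh_eq_def psh_comp_def)
  have eqD': "e c (g c x) = g' c (b c x)" if "c \<in> Obj C" "x \<in> val B c" for c x
    using eq(2) that by (simp add: psh_eq_def psh_comp_def)
  show "psh_mor C (fibre_prod A B f g) (fibre_prod A' B' f' g') (\<lambda>c (x, y). (a c x, b c y))"
    unfolding psh_mor_def
  proof (intro conjI ballI)
    fix c z assume c: "c \<in> Obj C" and z: "z \<in> val (fibre_prod A B f g) c"
    obtain x y where "z = (x, y)" by (cases z)
    then show "(case z of (x, y) \<Rightarrow> (a c x, b c y)) \<in> val (fibre_prod A' B' f' g') c"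
      using z psh_morD(1)[OF ab(1) c] psh_morD(1)[OF ab(2) c] eqD[OF c, of x] eqD'[OF c, of y] by (simp add: fibre_prod_simps)
  next
    fix h z assume h: "h \<in> Arr C" and z: "z \<in> val (fibre_prod A B f g) (Cod C h)"
    obtain x y where "z = (x, y)" by (cases z)
    then show "(case res (fibre_prod A B f g) h z of (x, y) \<Rightarrow> (a (Dom C h) x, b (Dom C h) y)) =
      res (fibre_prod A' B' f' g') h (case z of (x, y) \<Rightarrow> (a (Cod C h) x, b (Cod C h) y))"
      using z psh_morD(2)[OF ab(1) h] psh_morD(2)[OF ab(2) h] by (simp add: fibre_prod_simps)
  qed
  have "locally_inj C J (fibre_prod A B f g) (\<lambda>c (x, y). (a c x, b c y))" unfolding locally_inj_def
  proof (intro ballI impI)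
    fix c z z' assume c: "c \<in> Obj C" and z: "z \<in> val (fibre_prod A B f g) c" "z' \<in> val (fibre_prod A B f g) c"
      and e: "(case z of (x, y) \<Rightarrow> (a c x, b c y)) = (case z' of (x, y) \<Rightarrow> (a c x, b c y))"
    obtain x y x' y' where zz: "z = (x, y)" "z' = (x', y')" by (cases z, cases z')
    have "locally C J c (\<lambda>h. res A h x = res A h x')" "locally C J c (\<lambda>h. res B h y = res B h y')"
      using L(1,2) z e by (auto simp: zz fibre_prod_simps local_iso_def intro: locally_injD[OF _ c])
    from locally_conj[OF c this]
    show "locally C J c (\<lambda>h. res (fibre_prod A B f g) h z = res (fibre_prod A B f g) h z')"
      by (simp add: zz fibre_prod_simps)
  qed
  moreover have "locally_surj C J (fibre_prod A B f g) (fibre_prod A' B' f' g') (\<lambda>c (x, y). (a c x, b c y))"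
    unfolding locally_surj_def
  proof (intro ballI)
    fix c z assume c: "c \<in> Obj C" and z: "z \<in> val (fibre_prod A' B' f' g') c"
    obtain x y where zz: "z = (x, y)" by (cases z)
    have xy: "x \<in> val A' c" "y \<in> val B' c" "f' c x = g' c y" using z by (auto simp: zz fibre_prod_simps)
    have S: "locally_surj C J A A' a" "locally_surj C J B B' b" using L(1,2) by (auto simp: local_iso_def)
    show "locally C J c (\<lambda>h. res (fibre_prod A' B' f' g') h z \<in>
      (\<lambda>(x, y). (a (Dom C h) x, b (Dom C h) y)) ` val (fibre_prod A B f g) (Dom C h))"
    proof (rule locally_trans[OF c locally_conj[OF c locally_surjD[OF S(1) c xy(1)] locally_surjD[OF S(2) c xy(2)]]], elim conjE imageE)
      fix h u v assume h: "h \<in> Arr C" "Cod C h = c" 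
        and u: "res A' h x = a (Dom C h) u" "u \<in> val A (Dom C h)" and v: "res B' h y = b (Dom C h) v" "v \<in> val B (Dom C h)"
      note d = dom_obj[OF h(1)]
      have "f' (Dom C h) (res A' h x) = g' (Dom C h) (res B' h y)"
        using psh_morD(2)[OF m(3) h(1)] psh_morD(2)[OF m(4) h(1)] h xy by simp
      then have "e (Dom C h) (f (Dom C h) u) = e (Dom C h) (g (Dom C h) v)" using eqD[OF d u(2)] eqD'[OF d v(2)] u v by simp
      then show "locally C J (Dom C h) (\<lambda>k. res (fibre_prod A' B' f' g') (h \<cdot> k) z \<in>
        (\<lambda>(x, y). (a (Dom C (h \<cdot> k)) x, b (Dom C (h \<cdot> k)) y)) ` val (fibre_prod A B f g) (Dom C (h \<cdot> k)))"
      proof (rule locally_mono[OF d locally_injD[OF L(3) d psh_morD(1)[OF m(1) d u(2)] psh_morD(1)[OF m(2) d v(2)]]])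
        fix k assume k: "k \<in> Arr C" "Cod C k = Dom C h"
           and e: "res E k (f (Dom C h) u) = res E k (g (Dom C h) v)"
        note hk = comp_simps[OF h(1) k]
        have "(res A k u, res B k v) \<in> val (fibre_prod A B f g) (Dom C k)"
          using e A.res_val[OF k(1)] B.res_val[OF k(1)] psh_morD(2)[OF m(1) k(1)] psh_morD(2)[OF m(2) k(1)] u v k
          by (simp add: fibre_prod_simps)
        moreover have "res A' (h \<cdot> k) x = a (Dom C k) (res A k u)" "res B' (h \<cdot> k) y = b (Dom C k) (res B k v)"
          using A'.res_comp[OF h(1) k] B'.res_comp[OF h(1) k] psh_morD(2)[OF ab(1) k(1)] psh_morD(2)[OF ab(2) k(1)] u v k xy h by simp_all
        ultimately show "res (fibre_prod A' B' f' g') (h \<cdot> k) z \<in>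
          (\<lambda>(x, y). (a (Dom C (h \<cdot> k)) x, b (Dom C (h \<cdot> k)) y)) ` val (fibre_prod A B f g) (Dom C (h \<cdot> k))"
          unfolding hk(2) zz fibre_prod_simps(2) by (intro image_eqI[of _ _ "(res A k u, res B k v)"]) auto
      qed
    qed
  qed
  ultimately show "local_iso C J (fibre_prod A B f g) (fibre_prod A' B' f' g') (\<lambda>c (x, y). (a c x, b c y))"
    by (simp add: local_iso_def)
qed

lemma psh_mor_fibre_prod_pair:
  assumes "psh_mor C P A a" "psh_mor C P B b" "psh_eq C P (psh_comp f a) (psh_comp g b)"
  shows "psh_mor C P (fibre_prod A B f g) (\<lambda>c x. (a c x, b c x))"
  using assms by (auto simp: psh_mor_def fibre_prod_simps psh_eq_def psh_comp_def)

text \<open>The fibre product is itself a sheaf. The universal property tested on it gives a map back to \<open>P\<close>, and the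
  uniqueness part tested on \<open>P\<close> shows that this map is inverse to the comparison.\<close>

lemma sheaf_pullback_iff_bij:
  assumes S: "sheaf C J P" "sheaf C J A" "sheaf C J B" "sheaf C J E"
    and m: "psh_mor C P A a" "psh_mor C P B b" "psh_mor C A E f" "psh_mor C B E g"
    and e: "psh_eq C P (psh_comp f a) (psh_comp g b)"
  shows "sheaf_pullback C J P A B E a b f g \<longleftrightarrow>
    (\<forall>c\<in>Obj C. bij_betw (\<lambda>x. (a c x, b c x)) (val P c) (val (fibre_prod A B f g) c))"
proof
  interpret P: sheaf C J P by (rule S(1))
  have cat: "category C" by unfold_locales
  let ?Q = "fibre_prod A B f g"
  let ?w = "\<lambda>c x. (a c x, b c x)"
  note w = psh_mor_fibre_prod_pair[OF m(1,2) e]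
  have Q: "sheaf C J ?Q" by (rule sheaf_fibre_prod[OF S(2-4) m(3,4)])
  interpret Q: sheaf C J ?Q by (rule Q)
  { assume pb: "sheaf_pullback C J P A B E a b f g"
    have "psh_mor C ?Q A (\<lambda>c. fst)" "psh_mor C ?Q B (\<lambda>c. snd)" "psh_eq C ?Q (psh_comp f (\<lambda>c. fst)) (psh_comp g (\<lambda>c. snd))"
      by (auto simp: psh_mor_def fibre_prod_def psh_eq_def psh_comp_def)
    from sheaf_pullback_universal[OF pb Q this] obtain q where q: "psh_mor C ?Q P q"
      "psh_eq C ?Q (psh_comp a q) (\<lambda>c. fst)" "psh_eq C ?Q (psh_comp b q) (\<lambda>c. snd)" by blast
    have wq: "?w c (q c z) = z" if "c \<in> Obj C" "z \<in> val ?Q c" for c z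
      using q(2,3) that by (simp add: psh_eq_def psh_comp_def)
    from sheaf_pullback_universal[OF pb S(1) m(1,2) e] obtain r where
      r: "\<And>r'. psh_mor C P P r' \<Longrightarrow> psh_eq C P (psh_comp a r') a \<Longrightarrow> psh_eq C P (psh_comp b r') b \<Longrightarrow> psh_eq C P r' r" by blast
    have "psh_eq C P (\<lambda>c x. x) r" by (rule r) (auto simp: psh_mor_def psh_eq_def psh_comp_def)
    moreover have "psh_eq C P (psh_comp q ?w) r"
    proof (rule r)
      show "psh_mor C P P (psh_comp q ?w)" by (rule psh_mor_comp[OF cat P.presheaf_axioms w q(1)])
      show "psh_eq C P (psh_comp a (psh_comp q ?w)) a" "psh_eq C P (psh_comp b (psh_comp q ?w)) b"
        using wq psh_morD(1)[OF w] by (auto simp: psh_eq_def psh_comp_def)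
    qed
    ultimately have qw: "q c (?w c x) = x" if "c \<in> Obj C" "x \<in> val P c" for c x
      using that by (auto simp: psh_eq_def psh_comp_def)
    show "\<forall>c\<in>Obj C. bij_betw (?w c) (val P c) (val ?Q c)"
    proof
      fix c assume c: "c \<in> Obj C"
      show "bij_betw (?w c) (val P c) (val ?Q c)"
        using wq[OF c] qw[OF c] psh_morD(1)[OF w c] psh_morD(1)[OF q(1) c]
        by (intro bij_betw_byWitness[of _ "q c"]) auto
    qed
  }
  assume B: "\<forall>c\<in>Obj C. bij_betw (?w c) (val P c) (val ?Q c)"
  then have "psh_iso C P ?Q ?w" using psh_iso_iff_bij[OF P.presheaf_axioms w] by simp
  then obtain q where q: "psh_mor C ?Q P q" "psh_eq C P (psh_comp q ?w) (\<lambda>c x. x)" "psh_eq C ?Q (psh_comp ?w q) (\<lambda>c x. x)"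
    by (auto simp: psh_iso_def)
  have qw: "q c (?w c x) = x" if "c \<in> Obj C" "x \<in> val P c" for c x
    using q(2) that by (simp add: psh_eq_def psh_comp_def)
  have wq: "a c (q c z) = fst z" "b c (q c z) = snd z" if "c \<in> Obj C" "z \<in> val ?Q c" for c z
  proof -
    have "?w c (q c z) = z" using q(3) that by (simp add: psh_eq_def psh_comp_def)
    then show "a c (q c z) = fst z" "b c (q c z) = snd z" by (metis fst_conv, metis snd_conv)
  qed
  show "sheaf_pullback C J P A B E a b f g" unfolding sheaf_pullback_def
  proof (intro conjI allI impI S m e, elim conjE)
    fix Z s t
    assume Z: "sheaf C J Z" and s: "psh_mor C Z A s" and t: "psh_mor C Z B t" and st: "psh_eq C Z (psh_comp f s) (psh_comp g t)"
    interpret Z: sheaf C J Z by (rule Z)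
    note z = psh_mor_fibre_prod_pair[OF s t st]
    let ?r = "psh_comp q (\<lambda>c x. (s c x, t c x))"
    show "\<exists>r. psh_mor C Z P r \<and> psh_eq C Z (psh_comp a r) s \<and> psh_eq C Z (psh_comp b r) t \<and>
          (\<forall>r'. psh_mor C Z P r' \<and> psh_eq C Z (psh_comp a r') s \<and> psh_eq C Z (psh_comp b r') t \<longrightarrow> psh_eq C Z r' r)"
    proof (intro exI[of _ ?r] conjI allI impI)
      show "psh_mor C Z P ?r" by (rule psh_mor_comp[OF cat Z.presheaf_axioms z q(1)])
      show "psh_eq C Z (psh_comp a ?r) s" "psh_eq C Z (psh_comp b ?r) t"
        using wq psh_morD(1)[OF z] by (auto simp: psh_eq_def psh_comp_def)
      fix r' assume r': "psh_mor C Z P r' \<and> psh_eq C Z (psh_comp a r') s \<and> psh_eq C Z (psh_comp b r') t"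
      show "psh_eq C Z r' ?r" unfolding psh_eq_def
      proof (intro ballI)
        fix c x assume c: "c \<in> Obj C" and x: "x \<in> val Z c"
        have "r' c x \<in> val P c" "a c (r' c x) = s c x" "b c (r' c x) = t c x"
          using r' c x by (auto simp: psh_mor_def psh_eq_def psh_comp_def)
        then show "r' c x = ?r c x" using qw[OF c, of "r' c x"] by (simp add: psh_comp_def)
      qed
    qed
  qed
qed

lemma psh_eq_sheafI:
  assumes E: "sheaf C J E" and m: "psh_mor C P' E s" "psh_mor C P' E t" and u: "psh_mor C P P' u" "locally_surj C J P P' u"
    and e: "psh_eq C P (psh_comp s u) (psh_comp t u)"
  shows "psh_eq C P' s t"
  unfolding psh_eq_def
proof (intro ballI)
  interpret E: sheaf C J E by fact
  fix c x assume c: "c \<in> Obj C" and x: "x \<in> val P' c"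
  obtain R where R: "R \<in> J c" "\<forall>f\<in>R. res P' f x \<in> u (Dom C f) ` val P (Dom C f)"
    using locally_surjD[OF u(2) c x] unfolding locally_def by blast
  note ca = cover_arr[OF c R(1)]
  show "s c x = t c x"
  proof (rule E.separated[OF c R(1) psh_morD(1)[OF m(1) c x] psh_morD(1)[OF m(2) c x]])
    fix f assume f: "f \<in> R"
    obtain y where "y \<in> val P (Dom C f)" "res P' f x = u (Dom C f) y" using R(2) f by blast
    then have "s (Dom C f) (res P' f x) = t (Dom C f) (res P' f x)"
      using e ca(3)[OF f] by (simp add: psh_eq_def psh_comp_def)
    then show "res E f (s c x) = res E f (t c x)"
      using psh_morD(2)[OF m(1) ca(1)[OF f]] psh_morD(2)[OF m(2) ca(1)[OF f]] ca(2)[OF f] x by simp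
  qed
qed

text \<open>The local isomorphisms \<open>uP\<close>, \<open>uA\<close>, \<open>uB\<close>, \<open>uE\<close> present a square of sheaves by a square of presheaves. They induce
  a local isomorphism between the two fibre products, which connects the comparison morphism of the
  presheaves with that of the sheaves; the latter is a local isomorphism only if it is bijective.\<close>

lemma sheaf_pullback_iff_local_iso:
  assumes P: "presheaf C P" "presheaf C A" "presheaf C B" "presheaf C E"
    and m: "psh_mor C P A a" "psh_mor C P B b" "psh_mor C A E f" "psh_mor C B E g"
    and sq: "psh_eq C P (psh_comp f a) (psh_comp g b)"
    and S: "sheaf C J P'" "sheaf C J A'" "sheaf C J B'" "sheaf C J E'"
    and m': "psh_mor C P' A' a'" "psh_mor C P' B' b'" "psh_mor C A' E' f'" "psh_mor C B' E' g'"
    and u: "psh_mor C P P' uP" "psh_mor C A A' uA" "psh_mor C B B' uB" "psh_mor C E E' uE"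
    and L: "local_iso C J P P' uP" "local_iso C J A A' uA" "local_iso C J B B' uB" "local_iso C J E E' uE"
    and c: "psh_eq C P (psh_comp uA a) (psh_comp a' uP)" "psh_eq C P (psh_comp uB b) (psh_comp b' uP)"
      "psh_eq C A (psh_comp uE f) (psh_comp f' uA)" "psh_eq C B (psh_comp uE g) (psh_comp g' uB)"
  shows "sheaf_pullback C J P' A' B' E' a' b' f' g' \<longleftrightarrow>
    local_iso C J P (fibre_prod A B f g) (\<lambda>c x. (a c x, b c x))"
proof -
  interpret P': sheaf C J P' by (rule S(1))
  interpret A': sheaf C J A' by (rule S(2))
  interpret B': sheaf C J B' by (rule S(3))
  have cat: "category C" by unfold_locales
  have sq': "psh_eq C P' (psh_comp f' a') (psh_comp g' b')"
  proof (rule psh_eq_sheafI[OF S(4) _ _ u(1)])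
    show "psh_mor C P' E' (psh_comp f' a')" "psh_mor C P' E' (psh_comp g' b')"
      using psh_mor_comp[OF cat P'.presheaf_axioms] m' by blast+
    show "locally_surj C J P P' uP" using L(1) by (simp add: local_iso_def)
    show "psh_eq C P (psh_comp (psh_comp f' a') uP) (psh_comp (psh_comp g' b') uP)"
      unfolding psh_eq_def psh_comp_def
    proof (intro ballI)
      fix d x assume d: "d \<in> Obj C" and x: "x \<in> val P d"
      have "f' d (a' d (uP d x)) = uE d (f d (a d x))"
        using c(1,3) d x psh_morD(1)[OF m(1) d x] by (simp add: psh_eq_def psh_comp_def)
      also have "\<dots> = uE d (g d (b d x))" using sq d x by (simp add: psh_eq_def psh_comp_def)
      also have "\<dots> = g' d (b' d (uP d x))"
        using c(2,4) d x psh_morD(1)[OF m(2) d x] by (simp add: psh_eq_def psh_comp_def)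
      finally show "f' d (a' d (uP d x)) = g' d (b' d (uP d x))" .
    qed
  qed
  let ?Q = "fibre_prod A B f g" and ?Q' = "fibre_prod A' B' f' g'"
  have Q': "sheaf C J ?Q'" by (rule sheaf_fibre_prod[OF S(2-4) m'(3,4)])
  interpret Q': sheaf C J ?Q' by (rule Q')
  note w = psh_mor_fibre_prod_pair[OF m(1,2) sq] and w' = psh_mor_fibre_prod_pair[OF m'(1,2) sq']
  have iE: "locally_inj C J E uE" using L(4) by (simp add: local_iso_def)
  note v = local_iso_fibre_prod[OF P(2-4) A'.presheaf_axioms B'.presheaf_axioms m(3,4) m'(3,4) u(2,3) c(3,4) L(2,3) iE]
  have "sheaf_pullback C J P' A' B' E' a' b' f' g' \<longleftrightarrow> local_iso C J P' ?Q' (\<lambda>c x. (a' c x, b' c x))"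
    using sheaf_pullback_iff_bij[OF S m' sq'] local_iso_sheaves_iff_bij[OF S(1) Q' w'] by simp
  also have "\<dots> \<longleftrightarrow> local_iso C J P ?Q (\<lambda>c x. (a c x, b c x))"
  proof (rule local_iso_square[symmetric, OF P(1) _ P'.presheaf_axioms Q'.presheaf_axioms w w' u(1) v(1) _ L(1) v(2)])
    show "presheaf C ?Q" by (rule presheaf_fibre_prod[OF P(2,3) m(3,4)])
    show "psh_eq C P (psh_comp (\<lambda>c (x, y). (uA c x, uB c y)) (\<lambda>c x. (a c x, b c x))) (psh_comp (\<lambda>c x. (a' c x, b' c x)) uP)"
      using c(1,2) by (simp add: psh_eq_def psh_comp_def)
  qed
  finally show ?thesis .
qed

end

section \<open>Arrows inverted by sheafification\<close>

lemma yo_simps: "val (yo C d) c = hom C c d" "res (yo C d) f h = h \<cdot>\<^bsub>C\<^esub> f"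
  by (simp_all add: yo_def)

context category begin

lemma presheaf_yo: "presheaf C (yo C d)"
  by unfold_locales (use comp_simps id_right assoc in \<open>auto simp: yo_def hom_def\<close>)

lemma psh_mor_yo_arr:
  assumes "g \<in> Arr C"
  shows "psh_mor C (yo C (Dom C g)) (yo C (Cod C g)) (yo_arr C g)"
  using assms comp_simps assoc by (auto simp: psh_mor_def yo_def yo_arr_def hom_def)

lemma iso_arr_cancel:
  assumes f: "iso_arr C f" and g: "g \<in> hom C e (Dom C f)" and h: "h \<in> hom C e (Dom C f)" and eq: "f \<cdot> g = f \<cdot> h"
  shows "g = h"
proof -
  have i: "inverse_arrows C f (inv_arr C f)" using inv_arrI[OF f] .
  let ?i = "inv_arr C f"
  have ii: "f \<in> Arr C" "?i \<in> Arr C" "Dom C ?i = Cod C f" "Cod C ?i = Dom C f" "?i \<cdot> f = Idn C (Dom C f)"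
    using i by (auto simp: inverse_arrows_def hom_def)
  have "?i \<cdot> (f \<cdot> k) = k" if "k \<in> hom C e (Dom C f)" for k
    using that assoc[OF ii(2,1), of k] id_left[of k] ii by (auto simp: hom_def)
  then show ?thesis using g h eq by metis
qed

end

context site begin

lemma presheaf_on_site_yo: "presheaf_on_site C J (yo C d)"
  using presheaf_yo by (simp add: presheaf_on_site_def site_axioms)

lemma l_obj_properties:
  shows "sheaf C J (l_obj C J d)"
    and "psh_mor C (yo C d) (l_obj C J d) (sheafify_unit C J (yo C d))"
    and "local_iso C J (yo C d) (l_obj C J d) (sheafify_unit C J (yo C d))"
  using presheaf_on_site.sheaf_sheafify[OF presheaf_on_site_yo] presheaf_on_site.sheafify_unit_properties[OF presheaf_on_site_yo]
  by (simp_all add: l_obj_def)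

lemma l_arr_properties:
  assumes "g \<in> Arr C"
  shows "psh_mor C (l_obj C J (Dom C g)) (l_obj C J (Cod C g)) (l_arr C J g)"
    and "psh_eq C (yo C (Dom C g)) (psh_comp (l_arr C J g) (sheafify_unit C J (yo C (Dom C g))))
      (psh_comp (sheafify_unit C J (yo C (Cod C g))) (yo_arr C g))"
  using sheafify_arr_properties[OF presheaf_on_site_yo presheaf_on_site_yo psh_mor_yo_arr[OF assms]]
  by (simp_all add: l_obj_def l_arr_def)

lemma l_iso_iff_local_iso:
  assumes g: "g \<in> Arr C"
  shows "l_iso C J g \<longleftrightarrow> local_iso C J (yo C (Dom C g)) (yo C (Cod C g)) (yo_arr C g)"
proof -
  interpret S: sheaf C J "l_obj C J (Dom C g)" by (rule l_obj_properties(1))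
  interpret T: sheaf C J "l_obj C J (Cod C g)" by (rule l_obj_properties(1))
  have "l_iso C J g \<longleftrightarrow> local_iso C J (l_obj C J (Dom C g)) (l_obj C J (Cod C g)) (l_arr C J g)"
    unfolding l_iso_def psh_iso_iff_bij[OF S.presheaf_axioms l_arr_properties(1)[OF g]]
      local_iso_sheaves_iff_bij[OF l_obj_properties(1) l_obj_properties(1) l_arr_properties(1)[OF g]] ..
  also have "\<dots> \<longleftrightarrow> local_iso C J (yo C (Dom C g)) (yo C (Cod C g)) (yo_arr C g)"
  proof (rule local_iso_square[symmetric, OF presheaf_yo presheaf_yo S.presheaf_axioms T.presheaf_axioms psh_mor_yo_arr[OF g]
        l_arr_properties(1)[OF g] l_obj_properties(2) l_obj_properties(2) _ l_obj_properties(3) l_obj_properties(3)])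
    show "psh_eq C (yo C (Dom C g)) (psh_comp (sheafify_unit C J (yo C (Cod C g))) (yo_arr C g))
      (psh_comp (l_arr C J g) (sheafify_unit C J (yo C (Dom C g))))"
      using l_arr_properties(2)[OF g] by (simp add: psh_eq_def)
  qed
  finally show ?thesis .
qed

lemma l_iso_iff:
  assumes g: "g \<in> Arr C"
  shows "l_iso C J g \<longleftrightarrow>
    (\<forall>e\<in>Obj C. \<forall>h\<in>hom C e (Dom C g). \<forall>h'\<in>hom C e (Dom C g). g \<cdot> h = g \<cdot> h' \<longrightarrow> locally C J e (\<lambda>r. h \<cdot> r = h' \<cdot> r)) \<and>
    (\<forall>e\<in>Obj C. \<forall>h\<in>hom C e (Cod C g). locally C J e (\<lambda>r. \<exists>k\<in>hom C (Dom C r) (Dom C g). h \<cdot> r = g \<cdot> k))"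
  unfolding l_iso_iff_local_iso[OF g] local_iso_def locally_inj_def locally_surj_def
  by (simp add: yo_simps yo_arr_def image_iff)

lemma l_iso_injD:
  assumes "l_iso C J g" "g \<in> Arr C" "h \<in> hom C e (Dom C g)" "h' \<in> hom C e (Dom C g)" "g \<cdot> h = g \<cdot> h'"
  shows "locally C J e (\<lambda>r. h \<cdot> r = h' \<cdot> r)"
  using assms l_iso_iff[OF assms(2)] dom_obj[of h] by (auto simp: hom_def)

lemma l_iso_surjD:
  assumes "l_iso C J g" "g \<in> Arr C" "h \<in> hom C e (Cod C g)"
  shows "locally C J e (\<lambda>r. \<exists>k\<in>hom C (Dom C r) (Dom C g). h \<cdot> r = g \<cdot> k)"
  using assms l_iso_iff[OF assms(2)] dom_obj[of h] by (auto simp: hom_def)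

lemma iso_arr_l_iso:
  assumes "iso_arr C g" shows "l_iso C J g"
proof -
  have i: "inverse_arrows C g (inv_arr C g)" using inv_arrI[OF assms] .
  let ?i = "inv_arr C g"
  have ii: "g \<in> Arr C" "?i \<in> Arr C" "Dom C ?i = Cod C g" "Cod C ?i = Dom C g" "g \<cdot> ?i = Idn C (Cod C g)"
    using i by (auto simp: inverse_arrows_def hom_def)
  show ?thesis unfolding l_iso_iff[OF ii(1)]
  proof (intro conjI ballI impI)
    fix e h h' assume "e \<in> Obj C" "h \<in> hom C e (Dom C g)" "h' \<in> hom C e (Dom C g)" "g \<cdot> h = g \<cdot> h'"
    then show "locally C J e (\<lambda>r. h \<cdot> r = h' \<cdot> r)" using iso_arr_cancel[OF assms, of h e h'] by (intro locally_everywhere) auto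
  next
    fix e h assume e: "e \<in> Obj C" and h: "h \<in> hom C e (Cod C g)"
    show "locally C J e (\<lambda>r. \<exists>k\<in>hom C (Dom C r) (Dom C g). h \<cdot> r = g \<cdot> k)"
    proof (rule locally_everywhere[OF e])
      fix r assume r: "r \<in> Arr C" "Cod C r = e"
      have hr: "h \<cdot> r \<in> Arr C" "Dom C (h \<cdot> r) = Dom C r" "Cod C (h \<cdot> r) = Cod C g"
        using comp_simps[of h r] h r by (auto simp: hom_def)
      have "g \<cdot> (?i \<cdot> (h \<cdot> r)) = h \<cdot> r" using assoc[OF ii(1,2) hr(1)] ii hr id_left[OF hr(1)] by simp
      moreover have "?i \<cdot> (h \<cdot> r) \<in> hom C (Dom C r) (Dom C g)" using comp_simps[OF ii(2) hr(1)] ii hr by (simp add: hom_def)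
      ultimately show "\<exists>k\<in>hom C (Dom C r) (Dom C g). h \<cdot> r = g \<cdot> k" by metis
    qed
  qed
qed

text \<open>A section \<open>z\<close> over the source of \<open>g\<close> is extended along \<open>g\<close> by gluing: locally an arrow \<open>r\<close> into the target
  of \<open>g\<close> has the form \<open>g \<cdot> k\<close>, and the restriction of \<open>z\<close> along \<open>k\<close> does not depend on the choice of \<open>k\<close> because two
  choices agree locally.\<close>

lemma l_iso_res_bij:
  assumes l: "l_iso C J g" and g: "g \<in> Arr C" and Q: "sheaf C J Q"
  shows "bij_betw (res Q g) (val Q (Cod C g)) (val Q (Dom C g))"
proof -
  interpret Q: sheaf C J Q by fact
  let ?d = "Cod C g" and ?d' = "Dom C g"
  have d: "?d \<in> Obj C" "?d' \<in> Obj C" using g dom_obj cod_obj by auto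
  note I = id_simps[OF d(1)]
  have "locally C J ?d (\<lambda>r. \<exists>k\<in>hom C (Dom C r) ?d'. Idn C ?d \<cdot> r = g \<cdot> k)"
    by (rule l_iso_surjD[OF l g id_hom[OF d(1)]])
  then obtain R where R: "R \<in> J ?d" "\<forall>r\<in>R. \<exists>k\<in>hom C (Dom C r) ?d'. Idn C ?d \<cdot> r = g \<cdot> k" by (auto simp: locally_def)
  note ra = cover_arr[OF d(1) R(1)]
  have "\<forall>r\<in>R. \<exists>k. k \<in> hom C (Dom C r) ?d' \<and> r = g \<cdot> k" using R(2) ra id_left by metis
  then obtain k where k: "\<And>r. r \<in> R \<Longrightarrow> k r \<in> hom C (Dom C r) ?d'" "\<And>r. r \<in> R \<Longrightarrow> g \<cdot> k r = r" by metis
  have kk: "k r \<in> Arr C" "Dom C (k r) = Dom C r" "Cod C (k r) = ?d'" if "r \<in> R" for r using k(1)[OF that] by (auto simp: hom_def)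
  have indep: "res Q h z = res Q h' z" if z: "z \<in> val Q ?d'" and h: "h \<in> hom C e ?d'" "h' \<in> hom C e ?d'" "g \<cdot> h = g \<cdot> h'" for z e h h'
  proof -
    have hh: "h \<in> Arr C" "h' \<in> Arr C" "Dom C h = e" "Dom C h' = e" "Cod C h = ?d'" "Cod C h' = ?d'" "e \<in> Obj C"
      using h dom_obj by (auto simp: hom_def)
    obtain S where S: "S \<in> J e" "\<forall>r\<in>S. h \<cdot> r = h' \<cdot> r" using l_iso_injD[OF l g h] by (auto simp: locally_def)
    note sa = cover_arr[OF hh(7) S(1)]
    show ?thesis
    proof (rule Q.separated[OF hh(7) S(1)])
      show "res Q h z \<in> val Q e" "res Q h' z \<in> val Q e" using Q.res_val[of h z] Q.res_val[of h' z] hh z by auto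
      fix r assume r: "r \<in> S"
      show "res Q r (res Q h z) = res Q r (res Q h' z)"
        using Q.res_comp[of h r z] Q.res_comp[of h' r z] hh sa[OF r] S(2) r z by simp
    qed
  qed
  have "inj_on (res Q g) (val Q ?d)"
  proof (rule inj_onI)
    fix x y assume x: "x \<in> val Q ?d" and y: "y \<in> val Q ?d" and e: "res Q g x = res Q g y"
    show "x = y"
    proof (rule Q.separated[OF d(1) R(1) x y])
      fix r assume r: "r \<in> R"
      have "res Q (g \<cdot> k r) x = res Q (g \<cdot> k r) y"
        using Q.res_comp[OF g kk(1)[OF r] kk(3)[OF r]] x y e by simp
      then show "res Q r x = res Q r y" using k(2)[OF r] by simp
    qed
  qed
  moreover have "\<exists>x\<in>val Q ?d. res Q g x = z" if z: "z \<in> val Q ?d'" for z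
  proof -
    define m where "m r = (if r \<in> R then Some (res Q (k r) z) else None)" for r
    have dm: "dom m = R" by (auto simp: m_def dom_def)
    have "matching C Q m" unfolding matching_def dm
    proof (intro conjI ballI impI)
      fix r assume r: "r \<in> R"
      show "the (m r) \<in> val Q (Dom C r)" using Q.res_val[OF kk(1)[OF r], of z] kk[OF r] z r by (simp add: m_def)
      fix s assume s: "s \<in> Arr C" "Cod C s = Dom C r"
      note rs = cover_comp[OF d(1) R(1) r s] comp_simps[OF ra(1)[OF r] s]
      have ks: "k r \<cdot> s \<in> hom C (Dom C s) ?d'" using comp_simps[OF kk(1)[OF r] s(1)] kk[OF r] s by (simp add: hom_def)
      have "g \<cdot> k (r \<cdot> s) = g \<cdot> (k r \<cdot> s)"
        using assoc[OF g kk(1)[OF r] s(1)] kk[OF r] s k(2)[OF r] k(2)[OF rs(1)] by simp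
      then have "res Q (k (r \<cdot> s)) z = res Q (k r \<cdot> s) z"
        using indep[OF z _ ks] k(1)[OF rs(1)] rs by simp
      then show "m (r \<cdot> s) = map_option (res Q s) (m r)"
        using r rs Q.res_comp[OF kk(1)[OF r] s(1)] kk[OF r] s z by (simp add: m_def)
    qed
    then obtain x where x: "x \<in> val Q ?d" "\<And>r. r \<in> R \<Longrightarrow> m r = Some (res Q r x)"
      using Q.glue_obtain[OF d(1), of m, unfolded dm, OF R(1)] by blast
    have gR: "pull_sieve C g R \<in> J ?d'" by (rule cover_pull[OF g R(1)])
    have "res Q g x = z"
    proof (rule Q.separated[OF d(2) gR Q.res_val[OF g x(1)] z])
      fix s assume "s \<in> pull_sieve C g R"
      then have s: "s \<in> Arr C" "Cod C s = ?d'" "g \<cdot> s \<in> R" by (auto simp: pull_sieve_def)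
      have "Dom C (g \<cdot> s) = Dom C s" using comp_simps[OF g s(1,2)] by simp
      then have "res Q (k (g \<cdot> s)) z = res Q s z"
        using indep[OF z k(1)[OF s(3)], of s] k(2)[OF s(3)] s by (simp add: hom_def)
      then show "res Q s (res Q g x) = res Q s z"
        using Q.res_comp[OF g s(1,2) x(1)] x(2)[OF s(3)] s(3) by (simp add: m_def)
    qed
    then show ?thesis using x(1) by blast
  qed
  ultimately show ?thesis using Q.res_val[OF g] by (auto simp: bij_betw_def)
qed

text \<open>The Yoneda argument: extending the universal section of \<open>l_obj C J (Dom C g)\<close> along \<open>g\<close> gives a section \<open>x\<close>
  over \<open>Cod C g\<close>, which corresponds to the inverse of \<open>l_arr C J g\<close>.\<close>

lemma l_isoI_res_bij:
  assumes g: "g \<in> Arr C"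
    and dom_bij: "bij_betw (res (l_obj C J (Dom C g)) g) (val (l_obj C J (Dom C g)) (Cod C g)) (val (l_obj C J (Dom C g)) (Dom C g))"
    and cod_bij: "bij_betw (res (l_obj C J (Cod C g)) g) (val (l_obj C J (Cod C g)) (Cod C g)) (val (l_obj C J (Cod C g)) (Dom C g))"
  shows "l_iso C J g"
proof -
  let ?d = "Cod C g" and ?d' = "Dom C g"
  have d: "?d \<in> Obj C" "?d' \<in> Obj C" using g dom_obj cod_obj by auto
  let ?P = "l_obj C J ?d'" and ?Q = "l_obj C J ?d"
  interpret P: sheaf C J ?P by (rule l_obj_properties(1))
  interpret Q: sheaf C J ?Q by (rule l_obj_properties(1))
  define \<eta> where "\<eta> b = sheafify_unit C J (yo C b)" for b
  have eta_val: "\<eta> b e h \<in> val (l_obj C J b) e" if "h \<in> hom C e b" "e \<in> Obj C" for b e h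
    using psh_morD(1)[OF l_obj_properties(2) that(2)] that(1) by (simp add: \<eta>_def yo_simps)
  have eta_res: "res (l_obj C J b) r (\<eta> b e h) = \<eta> b (Dom C r) (h \<cdot> r)" if "h \<in> hom C e b" "r \<in> Arr C" "Cod C r = e" for b e h r
    using psh_morD(2)[OF l_obj_properties(2) that(2), of h b] that by (simp add: \<eta>_def yo_simps)
  have eta_inj: "locally C J e (\<lambda>r. h \<cdot> r = h' \<cdot> r)" if "h \<in> hom C e b" "h' \<in> hom C e b" "e \<in> Obj C" "\<eta> b e h = \<eta> b e h'" for b e h h'
  proof -
    have "locally_inj C J (yo C b) (\<eta> b)" using l_obj_properties(3)[of b] by (simp add: local_iso_def \<eta>_def)
    from locally_injD[OF this that(3) _ _ that(4)] show ?thesis using that(1,2) by (simp add: yo_simps)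
  qed
  have eta_surj: "locally C J e (\<lambda>r. \<exists>k\<in>hom C (Dom C r) b. res (l_obj C J b) r y = \<eta> b (Dom C r) k)"
    if "y \<in> val (l_obj C J b) e" "e \<in> Obj C" for b e y
  proof -
    have "locally_surj C J (yo C b) (l_obj C J b) (\<eta> b)" using l_obj_properties(3)[of b] by (simp add: local_iso_def \<eta>_def)
    from locally_surjD[OF this that(2,1)] show ?thesis by (simp add: yo_simps image_iff)
  qed
  have l_eta: "l_arr C J g e (\<eta> ?d' e h) = \<eta> ?d e (g \<cdot> h)" if "h \<in> hom C e ?d'" "e \<in> Obj C" for e h
    using l_arr_properties(2)[OF g] that by (simp add: psh_eq_def psh_comp_def \<eta>_def yo_simps yo_arr_def)
  note lD = psh_morD[OF l_arr_properties(1)[OF g]]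
  note i = id_hom[OF d(1)] and i' = id_hom[OF d(2)]
  obtain x where x: "x \<in> val ?P ?d" "res ?P g x = \<eta> ?d' ?d' (Idn C ?d')"
  proof -
    have "\<eta> ?d' ?d' (Idn C ?d') \<in> res ?P g ` val ?P ?d"
      using eta_val[OF i' d(2)] bij_betw_imp_surj_on[OF dom_bij] by simp
    then show ?thesis by (elim imageE) (rule that, auto)
  qed
  have "res ?Q g (l_arr C J g ?d x) = \<eta> ?d ?d' (g \<cdot> Idn C ?d')" using lD(2)[OF g x(1)] x(2) l_eta[OF i' d(2)] by simp
  also have "\<dots> = res ?Q g (\<eta> ?d ?d (Idn C ?d))" using eta_res[OF i g refl] id_left[OF g] id_right[OF g] by simp
  finally have lx: "l_arr C J g ?d x = \<eta> ?d ?d (Idn C ?d)"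
    by (rule inj_onD[OF bij_betw_imp_inj_on[OF cod_bij] _ lD(1)[OF d(1) x(1)] eta_val[OF i d(1)]])
  have res_x: "\<eta> ?d' e h = res ?P (g \<cdot> h) x" if h: "h \<in> hom C e ?d'" for e h
  proof -
    have hh: "h \<in> Arr C" "Dom C h = e" "Cod C h = ?d'" using h by (auto simp: hom_def)
    have "\<eta> ?d' e h = \<eta> ?d' e (Idn C ?d' \<cdot> h)" using id_left[OF hh(1)] hh by simp
    then show ?thesis using eta_res[OF i' hh(1,3)] P.res_comp[OF g hh(1,3) x(1)] x(2) hh by simp
  qed
  show ?thesis unfolding l_iso_iff[OF g]
  proof (intro conjI ballI impI)
    fix e h h' assume e: "e \<in> Obj C" and h: "h \<in> hom C e ?d'" "h' \<in> hom C e ?d'" and eq: "g \<cdot> h = g \<cdot> h'"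
    show "locally C J e (\<lambda>r. h \<cdot> r = h' \<cdot> r)" by (rule eta_inj[OF h e]) (use res_x[OF h(1)] res_x[OF h(2)] eq in simp)
  next
    fix e h assume e: "e \<in> Obj C" and h: "h \<in> hom C e ?d"
    have hh: "h \<in> Arr C" "Dom C h = e" "Cod C h = ?d" using h by (auto simp: hom_def)
    have hx: "res ?P h x \<in> val ?P e" using P.res_val[OF hh(1)] hh x by simp
    show "locally C J e (\<lambda>r. \<exists>k\<in>hom C (Dom C r) ?d'. h \<cdot> r = g \<cdot> k)"
    proof (rule locally_trans[OF e eta_surj[OF hx e]], elim bexE)
      fix r k assume r: "r \<in> Arr C" "Cod C r = e" and k: "k \<in> hom C (Dom C r) ?d'" "res ?P r (res ?P h x) = \<eta> ?d' (Dom C r) k"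
      have kk: "k \<in> Arr C" "Dom C k = Dom C r" "Cod C k = ?d'" using k by (auto simp: hom_def)
      have rc: "Cod C r = Dom C h" using r hh by simp
      note er = dom_obj[OF r(1)]
      note hr = comp_simps[OF hh(1) r(1) rc] and gk = comp_simps[OF g kk(1,3)]
      have hrd: "h \<cdot> r \<in> hom C (Dom C r) ?d" "g \<cdot> k \<in> hom C (Dom C r) ?d" using hr gk hh kk by (auto simp: hom_def)
      have "\<eta> ?d (Dom C r) (g \<cdot> k) = l_arr C J g (Dom C r) (res ?P (h \<cdot> r) x)"
        using l_eta[OF k(1) er] k(2) P.res_comp[OF hh(1) r(1) rc] x hh by simp
      also have "\<dots> = res ?Q (h \<cdot> r) (\<eta> ?d ?d (Idn C ?d))" using lD(2)[OF hr(1), of x] x hr hh lx by simp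
      also have "\<dots> = \<eta> ?d (Dom C r) (h \<cdot> r)" using eta_res[OF i hr(1)] hr hh id_left[OF hr(1)] by simp
      finally have e: "\<eta> ?d (Dom C r) (h \<cdot> r) = \<eta> ?d (Dom C r) (g \<cdot> k)" ..
      show "locally C J (Dom C r) (\<lambda>s. \<exists>k\<in>hom C (Dom C (r \<cdot> s)) ?d'. h \<cdot> (r \<cdot> s) = g \<cdot> k)"
      proof (rule locally_mono[OF er eta_inj[OF hrd er e]])
        fix s assume s: "s \<in> Arr C" "Cod C s = Dom C r" "h \<cdot> r \<cdot> s = g \<cdot> k \<cdot> s"
        have "h \<cdot> (r \<cdot> s) = g \<cdot> (k \<cdot> s)"
          using assoc[OF hh(1) r(1) s(1) rc s(2)] assoc[OF g kk(1) s(1)] kk s by simp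
        moreover have "k \<cdot> s \<in> hom C (Dom C (r \<cdot> s)) ?d'"
          using comp_simps[OF kk(1) s(1)] comp_simps[OF r(1) s(1,2)] kk s by (simp add: hom_def)
        ultimately show "\<exists>k\<in>hom C (Dom C (r \<cdot> s)) ?d'. h \<cdot> (r \<cdot> s) = g \<cdot> k" by blast
      qed
    qed
  qed
qed

end

text \<open>Precomposition with a continuous functor \<open>A\<close> turns the sheaves that test \<open>far A g\<close> into sheaves that test \<open>g\<close>.\<close>

lemma continuous_ftr_l_iso:
  assumes S: "site C J" "site D K" and F: "functor_between C D A" and c: "continuous_ftr C J D K A"
    and g: "g \<in> Arr C" and l: "l_iso C J g"
  shows "l_iso D K (far A g)"
proof -
  interpret C: site C J by fact
  interpret D: site D K by fact
  interpret A: functor_between C D A by fact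
  have ag: "far A g \<in> Arr D" "Dom D (far A g) = fob A (Dom C g)" "Cod D (far A g) = fob A (Cod C g)"
    using A.far_hom[OF g] by (auto simp: hom_def)
  have "bij_betw (res Q (far A g)) (val Q (Cod D (far A g))) (val Q (Dom D (far A g)))" if "sheaf D K Q" for Q :: "('c, 'd, ('d, 'd) shf_val) psh"
    using C.l_iso_res_bij[OF l g continuous_ftr_all[OF S(1) F c that]] ag by (simp add: precomp_def)
  then show ?thesis using D.l_isoI_res_bij[OF ag(1)] D.l_obj_properties(1) by blast
qed

section \<open>Locally cartesian arrows\<close>

locale comorphism_of_sites = base: site C J + total: site G K + functor_between G C p
  for G :: "('g, 'h) cat" and K :: "'g \<Rightarrow> 'h set set" and C :: "('o, 'a) cat" and J :: "'o \<Rightarrow> 'a set set"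
    and p :: "('g, 'h, 'o, 'a) ftr" +
  assumes cover_lifting: "d \<in> Obj G \<Longrightarrow> S \<in> J (fob p d) \<Longrightarrow> {h \<in> max_sieve G d. far p h \<in> S} \<in> K d"
begin

lemma p_simps:
  assumes "h \<in> Arr G"
  shows "far p h \<in> Arr C" "Dom C (far p h) = fob p (Dom G h)" "Cod C (far p h) = fob p (Cod G h)"
  using far_hom[OF assms] by (auto simp: hom_def)

lemma presheaf_precomp_p: "presheaf C P \<Longrightarrow> presheaf G (precomp p P)"
  by (rule presheaf_precomp[OF functor_between_axioms])

lemma psh_mor_precomp_arr:
  assumes "psh_mor C P Q t" shows "psh_mor G (precomp p P) (precomp p Q) (precomp_arr p t)"
  unfolding psh_mor_def
proof (intro conjI ballI)
  fix c x assume "c \<in> Obj G" "x \<in> val (precomp p P) c"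
  then show "precomp_arr p t c x \<in> val (precomp p Q) c"
    using psh_morD(1)[OF assms fob_obj] by (simp add: precomp_def precomp_arr_def)
next
  fix h x assume "h \<in> Arr G" "x \<in> val (precomp p P) (Cod G h)"
  then show "precomp_arr p t (Dom G h) (res (precomp p P) h x) = res (precomp p Q) h (precomp_arr p t (Cod G h) x)"
    using psh_morD(2)[OF assms p_simps(1)[of h], of x] p_simps(2,3)[of h] by (simp add: precomp_def precomp_arr_def)
qed

lemma locally_precomp:
  assumes "d \<in> Obj G" "locally C J (fob p d) \<phi>" shows "locally G K d (\<lambda>h. \<phi> (far p h))"
proof -
  obtain S where S: "S \<in> J (fob p d)" "\<forall>f\<in>S. \<phi> f" using assms(2) by (auto simp: locally_def)
  then have "\<forall>h\<in>{h \<in> max_sieve G d. far p h \<in> S}. \<phi> (far p h)" by simp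
  then show ?thesis using cover_lifting[OF assms(1) S(1)] unfolding locally_def by (rule bexI)
qed

lemma local_iso_precomp:
  assumes "local_iso C J P Q t" shows "local_iso G K (precomp p P) (precomp p Q) (precomp_arr p t)"
proof -
  have t: "locally_inj C J P t" "locally_surj C J P Q t" using assms by (auto simp: local_iso_def)
  have "locally_inj G K (precomp p P) (precomp_arr p t)" unfolding locally_inj_def
  proof (intro ballI impI)
    fix c x y assume c: "c \<in> Obj G" and x: "x \<in> val (precomp p P) c" and y: "y \<in> val (precomp p P) c"
      and e: "precomp_arr p t c x = precomp_arr p t c y"
    have "locally C J (fob p c) (\<lambda>f. res P f x = res P f y)"
      using x y e by (intro locally_injD[OF t(1) fob_obj[OF c]]) (simp_all add: precomp_def precomp_arr_def)
    from locally_precomp[OF c this] show "locally G K c (\<lambda>f. res (precomp p P) f x = res (precomp p P) f y)"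
      by (simp add: precomp_def)
  qed
  moreover have "locally_surj G K (precomp p P) (precomp p Q) (precomp_arr p t)" unfolding locally_surj_def
  proof (intro ballI)
    fix c y assume c: "c \<in> Obj G" and y: "y \<in> val (precomp p Q) c"
    have "locally C J (fob p c) (\<lambda>f. res Q f y \<in> t (Dom C f) ` val P (Dom C f))"
      using y by (intro locally_surjD[OF t(2) fob_obj[OF c]]) (simp add: precomp_def)
    from locally_precomp[OF c this]
    show "locally G K c (\<lambda>f. res (precomp p Q) f y \<in> precomp_arr p t (Dom G f) ` val (precomp p P) (Dom G f))"
      by (rule total.locally_mono[OF c]) (simp add: precomp_def precomp_arr_def p_simps)
  qed
  ultimately show ?thesis by (simp add: local_iso_def)
qed

text \<open>The inverse image of \<open>l_obj C J c\<close> is presented by \<open>Hom(p(-), c)\<close>, because precomposition with a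
  comorphism preserves local isomorphisms.\<close>

definition inv_img_unit :: "'o \<Rightarrow> 'g \<Rightarrow> 'a \<Rightarrow> ('h, ('a, 'a) shf_val) shf_val" where
  "inv_img_unit c = psh_comp (sheafify_unit G K (precomp p (l_obj C J c))) (precomp_arr p (sheafify_unit C J (yo C c)))"

lemma presheaf_on_site_precomp: "presheaf C P \<Longrightarrow> presheaf_on_site G K (precomp p P)"
  by (rule presheaf_on_site.intro[OF total.site_axioms presheaf_precomp_p])

lemma presheaf_l_obj: "presheaf C (l_obj C J c)"
  by (rule sheaf.axioms(2)[OF base.l_obj_properties(1)])

lemma inv_img_properties:
  shows "sheaf G K (inv_img G K p (l_obj C J c))"
    and "psh_mor G (precomp p (yo C c)) (inv_img G K p (l_obj C J c)) (inv_img_unit c)"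
    and "local_iso G K (precomp p (yo C c)) (inv_img G K p (l_obj C J c)) (inv_img_unit c)"
proof -
  interpret L: presheaf_on_site G K "precomp p (l_obj C J c)" by (rule presheaf_on_site_precomp[OF presheaf_l_obj])
  show s: "sheaf G K (inv_img G K p (l_obj C J c))" unfolding inv_img_def by (rule L.sheaf_sheafify)
  then interpret I: sheaf G K "inv_img G K p (l_obj C J c)" .
  have cat: "category G" by unfold_locales
  note u = psh_mor_precomp_arr[OF base.l_obj_properties(2)] local_iso_precomp[OF base.l_obj_properties(3)]
  note v = L.sheafify_unit_properties[folded inv_img_def]
  show "psh_mor G (precomp p (yo C c)) (inv_img G K p (l_obj C J c)) (inv_img_unit c)"
    unfolding inv_img_unit_def by (rule psh_mor_comp[OF cat presheaf_precomp_p[OF base.presheaf_yo] u(1) v(1)])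
  show "local_iso G K (precomp p (yo C c)) (inv_img G K p (l_obj C J c)) (inv_img_unit c)"
    unfolding inv_img_unit_def
    by (rule total.local_iso_comp[OF presheaf_precomp_p[OF base.presheaf_yo] L.presheaf_axioms I.presheaf_axioms u(1) v(1) u(2) v(2)])
qed

lemma inv_img_arr_properties:
  assumes f: "f \<in> Arr C"
  shows "psh_mor G (inv_img G K p (l_obj C J (Dom C f))) (inv_img G K p (l_obj C J (Cod C f)))
      (inv_img_arr G K p (l_obj C J (Cod C f)) (l_arr C J f))"
    and "psh_eq G (precomp p (yo C (Dom C f))) (psh_comp (inv_img_unit (Cod C f)) (precomp_arr p (yo_arr C f)))
      (psh_comp (inv_img_arr G K p (l_obj C J (Cod C f)) (l_arr C J f)) (inv_img_unit (Dom C f)))"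
proof -
  note s = sheafify_arr_properties[OF presheaf_on_site_precomp[OF presheaf_l_obj] presheaf_on_site_precomp[OF presheaf_l_obj]
     psh_mor_precomp_arr[OF base.l_arr_properties(1)[OF f]]]
  show "psh_mor G (inv_img G K p (l_obj C J (Dom C f))) (inv_img G K p (l_obj C J (Cod C f)))
      (inv_img_arr G K p (l_obj C J (Cod C f)) (l_arr C J f))"
    using s(1) by (simp add: inv_img_def inv_img_arr_def)
  show "psh_eq G (precomp p (yo C (Dom C f))) (psh_comp (inv_img_unit (Cod C f)) (precomp_arr p (yo_arr C f)))
      (psh_comp (inv_img_arr G K p (l_obj C J (Cod C f)) (l_arr C J f)) (inv_img_unit (Dom C f)))"
    unfolding psh_eq_def psh_comp_def inv_img_unit_def inv_img_arr_def
  proof (intro ballI)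
    fix d x assume d: "d \<in> Obj G" and x: "x \<in> val (precomp p (yo C (Dom C f))) d"
    let ?u = "\<lambda>c. sheafify_unit C J (yo C c)" and ?U = "\<lambda>c. sheafify_unit G K (precomp p (l_obj C J c))"
    have x': "x \<in> val (yo C (Dom C f)) (fob p d)" using x by (simp add: precomp_def)
    have "precomp_arr p (?u (Dom C f)) d x \<in> val (precomp p (l_obj C J (Dom C f))) d"
      by (rule psh_morD(1)[OF psh_mor_precomp_arr[OF base.l_obj_properties(2)] d x])
    then have "sheafify_arr G K (precomp p (l_obj C J (Cod C f))) (precomp_arr p (l_arr C J f)) d (?U (Dom C f) d (precomp_arr p (?u (Dom C f)) d x))
      = ?U (Cod C f) d (precomp_arr p (l_arr C J f) d (precomp_arr p (?u (Dom C f)) d x))"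
      using s(2) d unfolding psh_eq_def psh_comp_def by blast
    also have "precomp_arr p (l_arr C J f) d (precomp_arr p (?u (Dom C f)) d x) = precomp_arr p (?u (Cod C f)) d (precomp_arr p (yo_arr C f) d x)"
      using base.l_arr_properties(2)[OF f] fob_obj[OF d] x' unfolding psh_eq_def psh_comp_def precomp_arr_def by blast
    finally show "?U (Cod C f) d (precomp_arr p (?u (Cod C f)) d (precomp_arr p (yo_arr C f) d x)) =
      sheafify_arr G K (precomp p (l_obj C J (Cod C f))) (precomp_arr p (l_arr C J f)) d (?U (Dom C f) d (precomp_arr p (?u (Dom C f)) d x))" ..
  qed
qed

lemma psh_mor_far: "psh_mor G (yo G d) (precomp p (yo C (fob p d))) (\<lambda>e h. far p h)"
  unfolding psh_mor_def
proof (intro conjI ballI)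
  fix e h assume "h \<in> val (yo G d) e"
  then show "far p h \<in> val (precomp p (yo C (fob p d))) e"
    using p_simps[of h] by (auto simp: precomp_def yo_def hom_def)
next
  fix f h assume "f \<in> Arr G" "h \<in> val (yo G d) (Cod G f)"
  then show "far p (res (yo G d) f h) = res (precomp p (yo C (fob p d))) f (far p h)"
    using far_comp[of h f] by (auto simp: precomp_def yo_def hom_def)
qed

lemma eta_properties:
  assumes d: "d \<in> Obj G"
  shows "psh_mor G (l_obj G K d) (inv_img G K p (l_obj C J (fob p d))) (eta G K C J p d)"
    and "psh_eq G (yo G d) (psh_comp (inv_img_unit (fob p d)) (\<lambda>e h. far p h))
      (psh_comp (eta G K C J p d) (sheafify_unit G K (yo G d)))"
proof -
  let ?c = "fob p d"
  have cat: "category G" by unfold_locales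
  note P = total.presheaf_on_site_yo[of d] and Q = presheaf_on_site_precomp[OF base.presheaf_yo[of ?c]]
    and R = presheaf_on_site_precomp[OF presheaf_l_obj[of ?c]]
  note m = psh_mor_precomp_arr[OF base.l_obj_properties(2)[of ?c]]
  note s = sheafify_arr_properties[OF P Q psh_mor_far] and t = sheafify_arr_properties[OF Q R m]
  interpret L: sheaf G K "l_obj G K d" by (rule total.l_obj_properties(1))
  show "psh_mor G (l_obj G K d) (inv_img G K p (l_obj C J ?c)) (eta G K C J p d)"
    unfolding eta_def inv_img_arr_def inv_img_def
    using psh_mor_comp[OF cat L.presheaf_axioms[unfolded l_obj_def] s(1) t(1)] by (simp add: l_obj_def)
  show "psh_eq G (yo G d) (psh_comp (inv_img_unit ?c) (\<lambda>e h. far p h)) (psh_comp (eta G K C J p d) (sheafify_unit G K (yo G d)))"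
    unfolding psh_eq_def
  proof (intro ballI)
    fix e h assume e: "e \<in> Obj G" and h: "h \<in> val (yo G d) e"
    let ?u = "precomp_arr p (sheafify_unit C J (yo C ?c))"
    have "inv_img_arr G K p (l_obj C J ?c) (sheafify_unit C J (yo C ?c)) e (sheafify_unit G K (precomp p (yo C ?c)) e (far p h))
      = sheafify_unit G K (precomp p (l_obj C J ?c)) e (?u e (far p h))"
      using t(2) e psh_morD(1)[OF psh_mor_far e h] unfolding inv_img_arr_def psh_eq_def psh_comp_def by blast
    moreover have "sheafify_arr G K (precomp p (yo C ?c)) (\<lambda>e h. far p h) e (sheafify_unit G K (yo G d) e h)
      = sheafify_unit G K (precomp p (yo C ?c)) e (far p h)"
      using s(2) e h unfolding psh_eq_def psh_comp_def by blast
    ultimately show "psh_comp (inv_img_unit ?c) (\<lambda>e h. far p h) e h = psh_comp (eta G K C J p d) (sheafify_unit G K (yo G d)) e h"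
      unfolding eta_def inv_img_unit_def psh_comp_def by metis
  qed
qed

lemma locally_cartesian_iff_local_iso:
  assumes g: "g \<in> Arr G"
  shows "locally_cartesian G K C J p g \<longleftrightarrow>
    local_iso G K (yo G (Dom G g))
      (fibre_prod (yo G (Cod G g)) (precomp p (yo C (fob p (Dom G g)))) (\<lambda>e h. far p h) (precomp_arr p (yo_arr C (far p g))))
      (\<lambda>e h. (yo_arr G g e h, far p h))"
proof -
  note d = total.dom_obj[OF g] and c = total.cod_obj[OF g]
  note pg = p_simps[OF g]
  note I = inv_img_arr_properties[OF pg(1), unfolded pg]
  have psh_sq: "psh_eq G (yo G (Dom G g)) (psh_comp (\<lambda>e h. far p h) (yo_arr G g)) (psh_comp (precomp_arr p (yo_arr C (far p g))) (\<lambda>e h. far p h))"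
    using far_comp[OF g] by (simp add: psh_eq_def psh_comp_def yo_simps yo_arr_def precomp_arr_def hom_def)
  have far_mor: "psh_mor G (precomp p (yo C (fob p (Dom G g)))) (precomp p (yo C (fob p (Cod G g)))) (precomp_arr p (yo_arr C (far p g)))"
    using psh_mor_precomp_arr[OF base.psh_mor_yo_arr[OF pg(1)]] pg by simp
  have l: "psh_eq G (yo G (Dom G g)) (psh_comp (sheafify_unit G K (yo G (Cod G g))) (yo_arr G g))
    (psh_comp (l_arr G K g) (sheafify_unit G K (yo G (Dom G g))))"
    using total.l_arr_properties(2)[OF g] by (simp add: psh_eq_def)
  have "sheaf_pullback G K
       (l_obj G K (Dom G g)) (l_obj G K (Cod G g))
       (inv_img G K p (l_obj C J (fob p (Dom G g)))) (inv_img G K p (l_obj C J (fob p (Cod G g))))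
       (l_arr G K g) (eta G K C J p (Dom G g))
       (eta G K C J p (Cod G g)) (inv_img_arr G K p (l_obj C J (fob p (Cod G g))) (l_arr C J (far p g))) \<longleftrightarrow>
    local_iso G K (yo G (Dom G g))
      (fibre_prod (yo G (Cod G g)) (precomp p (yo C (fob p (Dom G g)))) (\<lambda>e h. far p h) (precomp_arr p (yo_arr C (far p g))))
      (\<lambda>e h. (yo_arr G g e h, far p h))"
    by (rule total.sheaf_pullback_iff_local_iso[where a = "yo_arr G g" and b = "\<lambda>e h. far p h",
      OF total.presheaf_yo total.presheaf_yo
      presheaf_precomp_p[OF base.presheaf_yo] presheaf_precomp_p[OF base.presheaf_yo]
      total.psh_mor_yo_arr[OF g] psh_mor_far psh_mor_far far_mor psh_sq
      total.l_obj_properties(1) total.l_obj_properties(1) inv_img_properties(1) inv_img_properties(1)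
      total.l_arr_properties(1)[OF g] eta_properties(1)[OF d] eta_properties(1)[OF c] I(1)
      total.l_obj_properties(2) total.l_obj_properties(2) inv_img_properties(2) inv_img_properties(2)
      total.l_obj_properties(3) total.l_obj_properties(3) inv_img_properties(3) inv_img_properties(3)
      l eta_properties(2)[OF d] eta_properties(2)[OF c] I(2)])
  then show ?thesis unfolding locally_cartesian_def using g by blast
qed

lemma locally_cartesian_iff:
  assumes g: "g \<in> Arr G"
  shows "locally_cartesian G K C J p g \<longleftrightarrow>
    (\<forall>e\<in>Obj G. \<forall>h\<in>hom G e (Dom G g). \<forall>h'\<in>hom G e (Dom G g). g \<cdot>\<^bsub>G\<^esub> h = g \<cdot>\<^bsub>G\<^esub> h' \<and> far p h = far p h' \<longrightarrow>
      locally G K e (\<lambda>r. h \<cdot>\<^bsub>G\<^esub> r = h' \<cdot>\<^bsub>G\<^esub> r)) \<and>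
    (\<forall>e\<in>Obj G. \<forall>h\<in>hom G e (Cod G g). \<forall>k\<in>hom C (fob p e) (fob p (Dom G g)). far p h = far p g \<cdot>\<^bsub>C\<^esub> k \<longrightarrow>
      locally G K e (\<lambda>r. \<exists>h'\<in>hom G (Dom G r) (Dom G g). h \<cdot>\<^bsub>G\<^esub> r = g \<cdot>\<^bsub>G\<^esub> h' \<and> k \<cdot>\<^bsub>C\<^esub> far p r = far p h'))"
proof -
  let ?Y = "yo G (Dom G g)"
  let ?F = "fibre_prod (yo G (Cod G g)) (precomp p (yo C (fob p (Dom G g)))) (\<lambda>e h. far p h) (precomp_arr p (yo_arr C (far p g)))"
  let ?w = "\<lambda>e h. (yo_arr G g e h, far p h)"
  have vF: "(h, k) \<in> val ?F e \<longleftrightarrow> h \<in> hom G e (Cod G g) \<and> k \<in> hom C (fob p e) (fob p (Dom G g)) \<and> far p h = far p g \<cdot>\<^bsub>C\<^esub> k"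
    and rF: "res ?F r (h, k) = (h \<cdot>\<^bsub>G\<^esub> r, k \<cdot>\<^bsub>C\<^esub> far p r)" for e h k r
    unfolding fibre_prod_simps by (auto simp: yo_def yo_arr_def precomp_def precomp_arr_def)
  have im: "(x, y) \<in> ?w e ` val ?Y e \<longleftrightarrow> (\<exists>h'\<in>hom G e (Dom G g). x = g \<cdot>\<^bsub>G\<^esub> h' \<and> y = far p h')" for x y e
    by (auto simp: yo_simps yo_arr_def)
  have "locally_inj G K ?Y ?w \<longleftrightarrow>
    (\<forall>e\<in>Obj G. \<forall>h\<in>hom G e (Dom G g). \<forall>h'\<in>hom G e (Dom G g). g \<cdot>\<^bsub>G\<^esub> h = g \<cdot>\<^bsub>G\<^esub> h' \<and> far p h = far p h' \<longrightarrow>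
      locally G K e (\<lambda>r. h \<cdot>\<^bsub>G\<^esub> r = h' \<cdot>\<^bsub>G\<^esub> r))"
    unfolding locally_inj_def by (simp only: yo_simps yo_arr_def prod.inject)
  moreover have "locally_surj G K ?Y ?F ?w \<longleftrightarrow>
    (\<forall>e\<in>Obj G. \<forall>h\<in>hom G e (Cod G g). \<forall>k\<in>hom C (fob p e) (fob p (Dom G g)). far p h = far p g \<cdot>\<^bsub>C\<^esub> k \<longrightarrow>
      locally G K e (\<lambda>r. \<exists>h'\<in>hom G (Dom G r) (Dom G g). h \<cdot>\<^bsub>G\<^esub> r = g \<cdot>\<^bsub>G\<^esub> h' \<and> k \<cdot>\<^bsub>C\<^esub> far p r = far p h'))"
  proof -
    have "(\<forall>z\<in>val ?F e. locally G K e (\<lambda>r. res ?F r z \<in> ?w (Dom G r) ` val ?Y (Dom G r))) \<longleftrightarrow>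
      (\<forall>h k. (h, k) \<in> val ?F e \<longrightarrow> locally G K e (\<lambda>r. res ?F r (h, k) \<in> ?w (Dom G r) ` val ?Y (Dom G r)))" for e
      by (simp only: Ball_def split_paired_All)
    then show ?thesis unfolding locally_surj_def vF rF im by blast
  qed
  ultimately show ?thesis unfolding locally_cartesian_iff_local_iso[OF g] local_iso_def by simp
qed

end

section \<open>Composition of locally cartesian arrows\<close>

lemma (in category) iso_arr_right_factor:
  assumes a: "iso_arr C a" and b: "iso_arr C b" and x: "x \<in> hom C (Dom C b) (Dom C a)" and ab: "Cod C b = Cod C a" and eq: "a \<cdot> x = b"
  shows "iso_arr C x"
proof -
  let ?j = "inv_arr C b"
  have i: "inverse_arrows C b ?j" using inv_arrI[OF b] .
  have bb: "b \<in> Arr C" "?j \<in> Arr C" "Dom C ?j = Cod C b" "Cod C ?j = Dom C b" "b \<cdot> ?j = Idn C (Cod C b)" "?j \<cdot> b = Idn C (Dom C b)"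
    using i by (auto simp: inverse_arrows_def hom_def)
  have aa: "a \<in> Arr C" using a by (auto simp: iso_arr_def inverse_arrows_def)
  have xx: "x \<in> Arr C" "Dom C x = Dom C b" "Cod C x = Dom C a" using x by (auto simp: hom_def)
  have ja: "?j \<cdot> a \<in> Arr C" "Dom C (?j \<cdot> a) = Dom C a" "Cod C (?j \<cdot> a) = Dom C b"
    using comp_simps[OF bb(2) aa] bb ab by auto
  have xja: "x \<cdot> (?j \<cdot> a) \<in> hom C (Dom C a) (Dom C a)" using comp_simps[OF xx(1) ja(1)] xx ja by (simp add: hom_def)
  have "a \<cdot> (x \<cdot> (?j \<cdot> a)) = b \<cdot> (?j \<cdot> a)" using assoc[OF aa xx(1) ja(1)] xx ja eq by simp
  also have "\<dots> = a" using assoc[OF bb(1,2) aa] bb ab id_left[OF aa] by simp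
  finally have "x \<cdot> (?j \<cdot> a) = Idn C (Dom C a)"
    using iso_arr_cancel[OF a xja id_hom[OF dom_obj[OF aa]]] id_right[OF aa] by simp
  moreover have "(?j \<cdot> a) \<cdot> x = Idn C (Dom C b)" using assoc[OF bb(2) aa xx(1)] bb xx ab eq by simp
  ultimately have "inverse_arrows C x (?j \<cdot> a)" using xx ja by (simp add: inverse_arrows_def hom_def)
  then show ?thesis by (auto simp: iso_arr_def)
qed

lemma (in functor_between) iso_arr_far:
  assumes "iso_arr A g" shows "iso_arr B (far F g)"
proof -
  obtain i where i: "g \<in> Arr A" "i \<in> Arr A" "Dom A i = Cod A g" "Cod A i = Dom A g" "g \<cdot>\<^bsub>A\<^esub> i = Idn A (Cod A g)" "i \<cdot>\<^bsub>A\<^esub> g = Idn A (Dom A g)"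
    using assms by (auto simp: iso_arr_def inverse_arrows_def hom_def)
  have "inverse_arrows B (far F g) (far F i)"
    using far_hom[OF i(1)] far_hom[OF i(2)] far_comp[OF i(1,2)] far_comp[OF i(2,1)] i
      far_id[OF source.dom_obj[OF i(1)]] far_id[OF source.cod_obj[OF i(1)]]
    by (simp add: inverse_arrows_def hom_def)
  then show ?thesis by (auto simp: iso_arr_def)
qed

context comorphism_of_sites begin

abbreviation "loc_cart \<equiv> locally_cartesian G K C J p"

lemma loc_cart_arr: "loc_cart g \<Longrightarrow> g \<in> Arr G"
  by (simp add: locally_cartesian_def)

lemma loc_cart_injD:
  assumes "loc_cart g" "h \<in> hom G e (Dom G g)" "h' \<in> hom G e (Dom G g)" "g \<cdot>\<^bsub>G\<^esub> h = g \<cdot>\<^bsub>G\<^esub> h'" "far p h = far p h'"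
  shows "locally G K e (\<lambda>r. h \<cdot>\<^bsub>G\<^esub> r = h' \<cdot>\<^bsub>G\<^esub> r)"
  using assms locally_cartesian_iff[OF loc_cart_arr[OF assms(1)]] total.dom_obj[of h] by (auto simp: hom_def)

lemma loc_cart_surjD:
  assumes "loc_cart g" "h \<in> hom G e (Cod G g)" "k \<in> hom C (fob p e) (fob p (Dom G g))" "far p h = far p g \<cdot>\<^bsub>C\<^esub> k"
  shows "locally G K e (\<lambda>r. \<exists>h'\<in>hom G (Dom G r) (Dom G g). h \<cdot>\<^bsub>G\<^esub> r = g \<cdot>\<^bsub>G\<^esub> h' \<and> k \<cdot>\<^bsub>C\<^esub> far p r = far p h')"
proof -
  have e: "e \<in> Obj G" using assms(2) total.dom_obj[of h] by (auto simp: hom_def)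
  show ?thesis using assms(1)[unfolded locally_cartesian_iff[OF loc_cart_arr[OF assms(1)]]] assms(2-) e by blast
qed

lemma far_comp_hom:
  assumes "h \<in> hom G e d" "r \<in> Arr G" "Cod G r = e"
  shows "far p (h \<cdot>\<^bsub>G\<^esub> r) = far p h \<cdot>\<^bsub>C\<^esub> far p r" "h \<cdot>\<^bsub>G\<^esub> r \<in> hom G (Dom G r) d"
  using far_comp[of h r] total.comp_simps[of h r] assms by (auto simp: hom_def)

text \<open>A square with one side invertible is a pullback if and only if the opposite side is invertible. In terms of
  arrows: if \<open>far p g\<close> can be cancelled, the projection of a lift along \<open>g\<close> is determined by the arrow that is lifted.\<close>

lemma loc_cart_iff_l_iso:
  assumes g: "g \<in> Arr G" and i: "iso_arr C (far p g)"
  shows "loc_cart g \<longleftrightarrow> l_iso G K g"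
proof
  note pg = p_simps[OF g]
  have cancel: "x = y" if "x \<in> hom C e (fob p (Dom G g))" "y \<in> hom C e (fob p (Dom G g))" "far p g \<cdot>\<^bsub>C\<^esub> x = far p g \<cdot>\<^bsub>C\<^esub> y" for x y e
    using base.iso_arr_cancel[OF i] that pg by simp
  have ph: "far p h \<in> hom C (fob p e) (fob p d)" if "h \<in> hom G e d" for h e d
    using that p_simps[of h] by (auto simp: hom_def)
  { assume l: "loc_cart g"
    let ?i = "inv_arr C (far p g)"
    have ii: "?i \<in> Arr C" "Dom C ?i = fob p (Cod G g)" "Cod C ?i = fob p (Dom G g)" "far p g \<cdot>\<^bsub>C\<^esub> ?i = Idn C (fob p (Cod G g))"
      using base.inv_arrI[OF i] pg by (auto simp: inverse_arrows_def hom_def)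
    show "l_iso G K g" unfolding total.l_iso_iff[OF g]
    proof (intro conjI ballI impI)
      fix e h h' assume h: "h \<in> hom G e (Dom G g)" "h' \<in> hom G e (Dom G g)" and eq: "g \<cdot>\<^bsub>G\<^esub> h = g \<cdot>\<^bsub>G\<^esub> h'"
      have "far p g \<cdot>\<^bsub>C\<^esub> far p h = far p g \<cdot>\<^bsub>C\<^esub> far p h'"
        using far_comp[OF g, of h] far_comp[OF g, of h'] h eq by (simp add: hom_def)
      then have "far p h = far p h'" by (rule cancel[OF ph[OF h(1)] ph[OF h(2)]])
      then show "locally G K e (\<lambda>r. h \<cdot>\<^bsub>G\<^esub> r = h' \<cdot>\<^bsub>G\<^esub> r)" by (rule loc_cart_injD[OF l h eq])
    next
      fix e h assume e: "e \<in> Obj G" and h: "h \<in> hom G e (Cod G g)"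
      have phh: "far p h \<in> Arr C" "Dom C (far p h) = fob p e" "Cod C (far p h) = fob p (Cod G g)" using ph[OF h] by (auto simp: hom_def)
      have k: "?i \<cdot>\<^bsub>C\<^esub> far p h \<in> hom C (fob p e) (fob p (Dom G g))"
        using base.comp_simps[OF ii(1) phh(1)] ii phh by (simp add: hom_def)
      have "far p g \<cdot>\<^bsub>C\<^esub> (?i \<cdot>\<^bsub>C\<^esub> far p h) = far p h"
        using base.assoc[OF pg(1) ii(1) phh(1)] pg ii phh base.id_left[OF phh(1)] by simp
      from loc_cart_surjD[OF l h k this[symmetric]]
      show "locally G K e (\<lambda>r. \<exists>k\<in>hom G (Dom G r) (Dom G g). h \<cdot>\<^bsub>G\<^esub> r = g \<cdot>\<^bsub>G\<^esub> k)"
        by (rule total.locally_mono[OF e]) blast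
    qed
  }
  assume l: "l_iso G K g"
  show "loc_cart g" unfolding locally_cartesian_iff[OF g]
  proof (intro conjI ballI impI)
    fix e h h' assume "h \<in> hom G e (Dom G g)" "h' \<in> hom G e (Dom G g)" "g \<cdot>\<^bsub>G\<^esub> h = g \<cdot>\<^bsub>G\<^esub> h' \<and> far p h = far p h'"
    then show "locally G K e (\<lambda>r. h \<cdot>\<^bsub>G\<^esub> r = h' \<cdot>\<^bsub>G\<^esub> r)" using total.l_iso_injD[OF l g] by blast
  next
    fix e h k assume e: "e \<in> Obj G" and h: "h \<in> hom G e (Cod G g)" and k: "k \<in> hom C (fob p e) (fob p (Dom G g))"
      and eq: "far p h = far p g \<cdot>\<^bsub>C\<^esub> k"
    show "locally G K e (\<lambda>r. \<exists>h'\<in>hom G (Dom G r) (Dom G g). h \<cdot>\<^bsub>G\<^esub> r = g \<cdot>\<^bsub>G\<^esub> h' \<and> k \<cdot>\<^bsub>C\<^esub> far p r = far p h')"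
    proof (rule total.locally_mono[OF e total.l_iso_surjD[OF l g h]], elim bexE)
      fix r h' assume r: "r \<in> Arr G" "Cod G r = e" and h': "h' \<in> hom G (Dom G r) (Dom G g)" "h \<cdot>\<^bsub>G\<^esub> r = g \<cdot>\<^bsub>G\<^esub> h'"
      note pr = p_simps[OF r(1)]
      have kk: "k \<in> Arr C" "Dom C k = fob p e" "Cod C k = fob p (Dom G g)" using k by (auto simp: hom_def)
      have kr: "k \<cdot>\<^bsub>C\<^esub> far p r \<in> hom C (fob p (Dom G r)) (fob p (Dom G g))"
        using base.comp_simps[OF kk(1) pr(1)] kk pr r by (simp add: hom_def)
      have "far p g \<cdot>\<^bsub>C\<^esub> (k \<cdot>\<^bsub>C\<^esub> far p r) = far p (h \<cdot>\<^bsub>G\<^esub> r)"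
        using base.assoc[OF pg(1) kk(1) pr(1)] pg kk pr r eq far_comp_hom(1)[OF h r] by simp
      also have "\<dots> = far p g \<cdot>\<^bsub>C\<^esub> far p h'" using far_comp[OF g, of h'] h' by (simp add: hom_def)
      finally have "k \<cdot>\<^bsub>C\<^esub> far p r = far p h'" by (rule cancel[OF kr ph[OF h'(1)]])
      then show "\<exists>h'\<in>hom G (Dom G r) (Dom G g). h \<cdot>\<^bsub>G\<^esub> r = g \<cdot>\<^bsub>G\<^esub> h' \<and> k \<cdot>\<^bsub>C\<^esub> far p r = far p h'"
        using h' by blast
    qed
  qed
qed

lemma loc_cart_iso: "iso_arr G g \<Longrightarrow> loc_cart g"
  using loc_cart_iff_l_iso[of g] iso_arr_far[of g] total.iso_arr_l_iso[of g] by (auto simp: iso_arr_def inverse_arrows_def)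

text \<open>The lifts that are required locally exist globally and are unique.\<close>

lemma cartesian_loc_cart:
  assumes "cartesian G C p g" shows "loc_cart g"
proof -
  have g: "g \<in> Arr G" using assms by (simp add: cartesian_def)
  have U: "\<exists>!h'. h' \<in> hom G (Dom G h) (Dom G g) \<and> far p h' = k \<and> g \<cdot>\<^bsub>G\<^esub> h' = h"
    if "h \<in> Arr G" "k \<in> hom C (fob p (Dom G h)) (fob p (Dom G g))" "Cod G h = Cod G g" "far p g \<cdot>\<^bsub>C\<^esub> k = far p h" for h k
    using assms that unfolding cartesian_def by blast
  show ?thesis unfolding locally_cartesian_iff[OF g]
  proof (intro conjI ballI impI)
    fix e h h' assume e: "e \<in> Obj G" and h: "h \<in> hom G e (Dom G g)" "h' \<in> hom G e (Dom G g)"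
      and eq: "g \<cdot>\<^bsub>G\<^esub> h = g \<cdot>\<^bsub>G\<^esub> h' \<and> far p h = far p h'"
    have hh: "h \<in> Arr G" "Dom G h = e" "Cod G h = Dom G g" using h by (auto simp: hom_def)
    note gh = total.comp_simps[OF g hh(1,3)]
    have "\<exists>!h''. h'' \<in> hom G (Dom G (g \<cdot>\<^bsub>G\<^esub> h)) (Dom G g) \<and> far p h'' = far p h \<and> g \<cdot>\<^bsub>G\<^esub> h'' = g \<cdot>\<^bsub>G\<^esub> h"
      by (rule U[OF gh(1)]) (use gh hh p_simps[OF hh(1)] far_comp[OF g hh(1,3)] in \<open>auto simp: hom_def\<close>)
    then have "h = h'" using h eq gh hh by metis
    then show "locally G K e (\<lambda>r. h \<cdot>\<^bsub>G\<^esub> r = h' \<cdot>\<^bsub>G\<^esub> r)" using total.locally_everywhere[OF e] by simp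
  next
    fix e h k assume e: "e \<in> Obj G" and h: "h \<in> hom G e (Cod G g)" and k: "k \<in> hom C (fob p e) (fob p (Dom G g))"
      and eq: "far p h = far p g \<cdot>\<^bsub>C\<^esub> k"
    obtain h' where h': "h' \<in> hom G e (Dom G g)" "far p h' = k" "g \<cdot>\<^bsub>G\<^esub> h' = h"
      using U[of h k] h k eq by (auto simp: hom_def)
    show "locally G K e (\<lambda>r. \<exists>h'\<in>hom G (Dom G r) (Dom G g). h \<cdot>\<^bsub>G\<^esub> r = g \<cdot>\<^bsub>G\<^esub> h' \<and> k \<cdot>\<^bsub>C\<^esub> far p r = far p h')"
    proof (rule total.locally_everywhere[OF e])
      fix r assume r: "r \<in> Arr G" "Cod G r = e"
      have "h \<cdot>\<^bsub>G\<^esub> r = g \<cdot>\<^bsub>G\<^esub> (h' \<cdot>\<^bsub>G\<^esub> r)" using total.assoc[OF g, of h' r] h' r by (auto simp: hom_def)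
      then show "\<exists>h'\<in>hom G (Dom G r) (Dom G g). h \<cdot>\<^bsub>G\<^esub> r = g \<cdot>\<^bsub>G\<^esub> h' \<and> k \<cdot>\<^bsub>C\<^esub> far p r = far p h'"
        using far_comp_hom[OF h'(1) r] h'(2) by metis
    qed
  qed
qed

text \<open>The pasting law of pullback squares: a lift through \<open>f \<cdot> g\<close> is found by lifting through \<open>f\<close> and then, on a finer
  cover, through \<open>g\<close>. Conversely, in \<open>loc_cart_cancel\<close>, a local lift \<open>m\<close> of \<open>f \<cdot> h\<close> through \<open>f \<cdot> g\<close> makes
  \<open>g \<cdot> m\<close> and \<open>h\<close> agree after composition with \<open>f\<close> and after projection, hence locally.\<close>

lemma loc_cart_comp:
  assumes f: "loc_cart f" and g: "loc_cart g" and fg: "Cod G g = Dom G f"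
  shows "loc_cart (f \<cdot>\<^bsub>G\<^esub> g)"
proof -
  note fa = loc_cart_arr[OF f] and ga = loc_cart_arr[OF g]
  note c = total.comp_simps[OF fa ga fg]
  note pf = p_simps[OF fa] and pg = p_simps[OF ga]
  show ?thesis unfolding locally_cartesian_iff[OF c(1)] c(2,3)
  proof (intro conjI ballI impI)
    fix e h h' assume e: "e \<in> Obj G" and h: "h \<in> hom G e (Dom G g)" "h' \<in> hom G e (Dom G g)"
      and eq: "f \<cdot>\<^bsub>G\<^esub> g \<cdot>\<^bsub>G\<^esub> h = f \<cdot>\<^bsub>G\<^esub> g \<cdot>\<^bsub>G\<^esub> h' \<and> far p h = far p h'"
    have hh: "h \<in> Arr G" "Dom G h = e" "Cod G h = Dom G g" "h' \<in> Arr G" "Dom G h' = e" "Cod G h' = Dom G g"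
      using h by (auto simp: hom_def)
    have gh: "g \<cdot>\<^bsub>G\<^esub> h \<in> hom G e (Dom G f)" "g \<cdot>\<^bsub>G\<^esub> h' \<in> hom G e (Dom G f)"
      using total.comp_simps[OF ga hh(1,3)] total.comp_simps[OF ga hh(4,6)] hh fg by (auto simp: hom_def)
    have "f \<cdot>\<^bsub>G\<^esub> (g \<cdot>\<^bsub>G\<^esub> h) = f \<cdot>\<^bsub>G\<^esub> (g \<cdot>\<^bsub>G\<^esub> h')"
      using eq total.assoc[OF fa ga hh(1) fg hh(3)] total.assoc[OF fa ga hh(4) fg hh(6)] by simp
    moreover have "far p (g \<cdot>\<^bsub>G\<^esub> h) = far p (g \<cdot>\<^bsub>G\<^esub> h')" using eq far_comp[OF ga hh(1,3)] far_comp[OF ga hh(4,6)] by simp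
    ultimately have "locally G K e (\<lambda>r. g \<cdot>\<^bsub>G\<^esub> h \<cdot>\<^bsub>G\<^esub> r = g \<cdot>\<^bsub>G\<^esub> h' \<cdot>\<^bsub>G\<^esub> r)" by (rule loc_cart_injD[OF f gh])
    then show "locally G K e (\<lambda>r. h \<cdot>\<^bsub>G\<^esub> r = h' \<cdot>\<^bsub>G\<^esub> r)"
    proof (rule total.locally_trans[OF e])
      fix r assume r: "r \<in> Arr G" "Cod G r = e" and q: "g \<cdot>\<^bsub>G\<^esub> h \<cdot>\<^bsub>G\<^esub> r = g \<cdot>\<^bsub>G\<^esub> h' \<cdot>\<^bsub>G\<^esub> r"
      note hr = far_comp_hom[OF h(1) r] and hr' = far_comp_hom[OF h(2) r]
      have "g \<cdot>\<^bsub>G\<^esub> (h \<cdot>\<^bsub>G\<^esub> r) = g \<cdot>\<^bsub>G\<^esub> (h' \<cdot>\<^bsub>G\<^esub> r)"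
        using q total.assoc[OF ga hh(1) r(1)] total.assoc[OF ga hh(4) r(1)] hh r by simp
      moreover have "far p (h \<cdot>\<^bsub>G\<^esub> r) = far p (h' \<cdot>\<^bsub>G\<^esub> r)" using hr hr' eq by simp
      ultimately have "locally G K (Dom G r) (\<lambda>s. h \<cdot>\<^bsub>G\<^esub> r \<cdot>\<^bsub>G\<^esub> s = h' \<cdot>\<^bsub>G\<^esub> r \<cdot>\<^bsub>G\<^esub> s)"
        by (rule loc_cart_injD[OF g hr(2) hr'(2)])
      then show "locally G K (Dom G r) (\<lambda>s. h \<cdot>\<^bsub>G\<^esub> (r \<cdot>\<^bsub>G\<^esub> s) = h' \<cdot>\<^bsub>G\<^esub> (r \<cdot>\<^bsub>G\<^esub> s))"
        by (rule total.locally_mono[OF total.dom_obj[OF r(1)]])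
          (use total.assoc[OF hh(1) r(1)] total.assoc[OF hh(4) r(1)] hh r in simp)
    qed
  next
    fix e h k assume e: "e \<in> Obj G" and h: "h \<in> hom G e (Cod G f)" and k: "k \<in> hom C (fob p e) (fob p (Dom G g))"
      and eq: "far p h = far p (f \<cdot>\<^bsub>G\<^esub> g) \<cdot>\<^bsub>C\<^esub> k"
    have hh: "h \<in> Arr G" "Dom G h = e" "Cod G h = Cod G f" using h by (auto simp: hom_def)
    have kk: "k \<in> Arr C" "Dom C k = fob p e" "Cod C k = fob p (Dom G g)" using k by (auto simp: hom_def)
    have gk: "far p g \<cdot>\<^bsub>C\<^esub> k \<in> hom C (fob p e) (fob p (Dom G f))"
      using base.comp_simps[OF pg(1) kk(1)] pg kk fg by (simp add: hom_def)
    have hf: "far p h = far p f \<cdot>\<^bsub>C\<^esub> (far p g \<cdot>\<^bsub>C\<^esub> k)"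
      using eq far_comp[OF fa ga fg] base.assoc[OF pf(1) pg(1) kk(1)] pf pg kk fg by simp
    show "locally G K e (\<lambda>r. \<exists>h'\<in>hom G (Dom G r) (Dom G g). h \<cdot>\<^bsub>G\<^esub> r = f \<cdot>\<^bsub>G\<^esub> g \<cdot>\<^bsub>G\<^esub> h' \<and> k \<cdot>\<^bsub>C\<^esub> far p r = far p h')"
    proof (rule total.locally_trans[OF e loc_cart_surjD[OF f h gk hf]], elim bexE conjE)
      fix r l assume r: "r \<in> Arr G" "Cod G r = e" and l: "l \<in> hom G (Dom G r) (Dom G f)" "h \<cdot>\<^bsub>G\<^esub> r = f \<cdot>\<^bsub>G\<^esub> l"
        "far p g \<cdot>\<^bsub>C\<^esub> k \<cdot>\<^bsub>C\<^esub> far p r = far p l"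
      note pr = p_simps[OF r(1)]
      have ll: "l \<in> Arr G" "Dom G l = Dom G r" "Cod G l = Dom G f" using l by (auto simp: hom_def)
      have lg: "l \<in> hom G (Dom G r) (Cod G g)" using l fg by simp
      have kr: "k \<cdot>\<^bsub>C\<^esub> far p r \<in> hom C (fob p (Dom G r)) (fob p (Dom G g))"
        using base.comp_simps[OF kk(1) pr(1)] pr kk r by (simp add: hom_def)
      have lk: "far p l = far p g \<cdot>\<^bsub>C\<^esub> (k \<cdot>\<^bsub>C\<^esub> far p r)"
        using l(3) base.assoc[OF pg(1) kk(1) pr(1)] pg kk pr r by simp
      show "locally G K (Dom G r) (\<lambda>s. \<exists>h'\<in>hom G (Dom G (r \<cdot>\<^bsub>G\<^esub> s)) (Dom G g).
        h \<cdot>\<^bsub>G\<^esub> (r \<cdot>\<^bsub>G\<^esub> s) = f \<cdot>\<^bsub>G\<^esub> g \<cdot>\<^bsub>G\<^esub> h' \<and> k \<cdot>\<^bsub>C\<^esub> far p (r \<cdot>\<^bsub>G\<^esub> s) = far p h')"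
      proof (rule total.locally_mono[OF total.dom_obj[OF r(1)] loc_cart_surjD[OF g lg kr lk]], elim bexE conjE)
        fix s m assume s: "s \<in> Arr G" "Cod G s = Dom G r" and m: "m \<in> hom G (Dom G s) (Dom G g)" "l \<cdot>\<^bsub>G\<^esub> s = g \<cdot>\<^bsub>G\<^esub> m"
          "k \<cdot>\<^bsub>C\<^esub> far p r \<cdot>\<^bsub>C\<^esub> far p s = far p m"
        note ps = p_simps[OF s(1)] and rs = total.comp_simps[OF r(1) s]
        have mm: "m \<in> Arr G" "Cod G m = Dom G g" using m by (auto simp: hom_def)
        have "h \<cdot>\<^bsub>G\<^esub> (r \<cdot>\<^bsub>G\<^esub> s) = f \<cdot>\<^bsub>G\<^esub> (l \<cdot>\<^bsub>G\<^esub> s)"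
          using total.assoc[OF hh(1) r(1) s(1)] total.assoc[OF fa ll(1) s(1)] hh r s ll l(2) by simp
        also have "\<dots> = f \<cdot>\<^bsub>G\<^esub> g \<cdot>\<^bsub>G\<^esub> m" using m(2) total.assoc[OF fa ga mm(1) fg mm(2)] by simp
        finally have "h \<cdot>\<^bsub>G\<^esub> (r \<cdot>\<^bsub>G\<^esub> s) = f \<cdot>\<^bsub>G\<^esub> g \<cdot>\<^bsub>G\<^esub> m" .
        moreover have "k \<cdot>\<^bsub>C\<^esub> far p (r \<cdot>\<^bsub>G\<^esub> s) = far p m"
          using far_comp[OF r(1) s] base.assoc[OF kk(1) pr(1) ps(1)] kk pr ps r s m(3) by simp
        ultimately show "\<exists>h'\<in>hom G (Dom G (r \<cdot>\<^bsub>G\<^esub> s)) (Dom G g).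
          h \<cdot>\<^bsub>G\<^esub> (r \<cdot>\<^bsub>G\<^esub> s) = f \<cdot>\<^bsub>G\<^esub> g \<cdot>\<^bsub>G\<^esub> h' \<and> k \<cdot>\<^bsub>C\<^esub> far p (r \<cdot>\<^bsub>G\<^esub> s) = far p h'" using m(1) rs(2) by auto
      qed
    qed
  qed
qed

lemma loc_cart_cancel:
  assumes f: "loc_cart f" and ga: "g \<in> Arr G" and fg: "Cod G g = Dom G f" and l: "loc_cart (f \<cdot>\<^bsub>G\<^esub> g)"
  shows "loc_cart g"
proof -
  note fa = loc_cart_arr[OF f]
  note c = total.comp_simps[OF fa ga fg]
  note pf = p_simps[OF fa] and pg = p_simps[OF ga]
  show ?thesis unfolding locally_cartesian_iff[OF ga]
  proof (intro conjI ballI impI)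
    fix e h h' assume h: "h \<in> hom G e (Dom G g)" "h' \<in> hom G e (Dom G g)"
      and eq: "g \<cdot>\<^bsub>G\<^esub> h = g \<cdot>\<^bsub>G\<^esub> h' \<and> far p h = far p h'"
    have "f \<cdot>\<^bsub>G\<^esub> g \<cdot>\<^bsub>G\<^esub> h = f \<cdot>\<^bsub>G\<^esub> g \<cdot>\<^bsub>G\<^esub> h'"
      using eq total.assoc[OF fa ga _ fg, of h] total.assoc[OF fa ga _ fg, of h'] h by (simp add: hom_def)
    then show "locally G K e (\<lambda>r. h \<cdot>\<^bsub>G\<^esub> r = h' \<cdot>\<^bsub>G\<^esub> r)" using loc_cart_injD[OF l, of h e h'] h eq c by simp
  next
    fix e h k assume e: "e \<in> Obj G" and h: "h \<in> hom G e (Cod G g)" and k: "k \<in> hom C (fob p e) (fob p (Dom G g))"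
      and eq: "far p h = far p g \<cdot>\<^bsub>C\<^esub> k"
    have hh: "h \<in> Arr G" "Dom G h = e" "Cod G h = Dom G f" using h fg by (auto simp: hom_def)
    have kk: "k \<in> Arr C" "Dom C k = fob p e" "Cod C k = fob p (Dom G g)" using k by (auto simp: hom_def)
    have fh: "f \<cdot>\<^bsub>G\<^esub> h \<in> hom G e (Cod G (f \<cdot>\<^bsub>G\<^esub> g))" using total.comp_simps[OF fa hh(1,3)] hh c by (simp add: hom_def)
    have k': "k \<in> hom C (fob p e) (fob p (Dom G (f \<cdot>\<^bsub>G\<^esub> g)))" using k c by simp
    have fhk: "far p (f \<cdot>\<^bsub>G\<^esub> h) = far p (f \<cdot>\<^bsub>G\<^esub> g) \<cdot>\<^bsub>C\<^esub> k"
      using far_comp[OF fa hh(1,3)] far_comp[OF fa ga fg] eq base.assoc[OF pf(1) pg(1) kk(1)] pf pg kk fg by simp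
    show "locally G K e (\<lambda>r. \<exists>h'\<in>hom G (Dom G r) (Dom G g). h \<cdot>\<^bsub>G\<^esub> r = g \<cdot>\<^bsub>G\<^esub> h' \<and> k \<cdot>\<^bsub>C\<^esub> far p r = far p h')"
    proof (rule total.locally_trans[OF e loc_cart_surjD[OF l fh k' fhk]], elim bexE conjE)
      fix r m assume r: "r \<in> Arr G" "Cod G r = e" and "m \<in> hom G (Dom G r) (Dom G (f \<cdot>\<^bsub>G\<^esub> g))"
        and fm: "f \<cdot>\<^bsub>G\<^esub> h \<cdot>\<^bsub>G\<^esub> r = f \<cdot>\<^bsub>G\<^esub> g \<cdot>\<^bsub>G\<^esub> m" and pm: "k \<cdot>\<^bsub>C\<^esub> far p r = far p m"
      then have m: "m \<in> hom G (Dom G r) (Dom G g)" "m \<in> Arr G" "Dom G m = Dom G r" "Cod G m = Dom G g" using c by (auto simp: hom_def)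
      note pr = p_simps[OF r(1)]
      have h'': "h \<in> hom G e (Dom G f)" using h fg by simp
      note hr = far_comp_hom[OF h'' r]
      have gm: "g \<cdot>\<^bsub>G\<^esub> m \<in> hom G (Dom G r) (Dom G f)" using total.comp_simps[OF ga m(2,4)] m fg by (simp add: hom_def)
      have "f \<cdot>\<^bsub>G\<^esub> (h \<cdot>\<^bsub>G\<^esub> r) = f \<cdot>\<^bsub>G\<^esub> (g \<cdot>\<^bsub>G\<^esub> m)"
        using fm total.assoc[OF fa hh(1) r(1)] total.assoc[OF fa ga m(2) fg m(4)] hh r by simp
      moreover have "far p (h \<cdot>\<^bsub>G\<^esub> r) = far p (g \<cdot>\<^bsub>G\<^esub> m)"
        using hr(1) eq base.assoc[OF pg(1) kk(1) pr(1)] pg kk pr r pm far_comp[OF ga m(2,4)] by simp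
      ultimately have "locally G K (Dom G r) (\<lambda>s. h \<cdot>\<^bsub>G\<^esub> r \<cdot>\<^bsub>G\<^esub> s = g \<cdot>\<^bsub>G\<^esub> m \<cdot>\<^bsub>G\<^esub> s)"
        by (rule loc_cart_injD[OF f hr(2) gm])
      then show "locally G K (Dom G r) (\<lambda>s. \<exists>h'\<in>hom G (Dom G (r \<cdot>\<^bsub>G\<^esub> s)) (Dom G g).
        h \<cdot>\<^bsub>G\<^esub> (r \<cdot>\<^bsub>G\<^esub> s) = g \<cdot>\<^bsub>G\<^esub> h' \<and> k \<cdot>\<^bsub>C\<^esub> far p (r \<cdot>\<^bsub>G\<^esub> s) = far p h')"
      proof (rule total.locally_mono[OF total.dom_obj[OF r(1)]])
        fix s assume s: "s \<in> Arr G" "Cod G s = Dom G r" and q: "h \<cdot>\<^bsub>G\<^esub> r \<cdot>\<^bsub>G\<^esub> s = g \<cdot>\<^bsub>G\<^esub> m \<cdot>\<^bsub>G\<^esub> s"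
        note ps = p_simps[OF s(1)] and rs = total.comp_simps[OF r(1) s] and ms = far_comp_hom[OF m(1) s]
        have "h \<cdot>\<^bsub>G\<^esub> (r \<cdot>\<^bsub>G\<^esub> s) = g \<cdot>\<^bsub>G\<^esub> (m \<cdot>\<^bsub>G\<^esub> s)"
          using q total.assoc[OF hh(1) r(1) s(1)] total.assoc[OF ga m(2) s(1)] hh r s m by simp
        moreover have "k \<cdot>\<^bsub>C\<^esub> far p (r \<cdot>\<^bsub>G\<^esub> s) = far p (m \<cdot>\<^bsub>G\<^esub> s)"
          using far_comp[OF r(1) s] base.assoc[OF kk(1) pr(1) ps(1)] kk pr ps r s pm ms by simp
        ultimately show "\<exists>h'\<in>hom G (Dom G (r \<cdot>\<^bsub>G\<^esub> s)) (Dom G g).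
          h \<cdot>\<^bsub>G\<^esub> (r \<cdot>\<^bsub>G\<^esub> s) = g \<cdot>\<^bsub>G\<^esub> h' \<and> k \<cdot>\<^bsub>C\<^esub> far p (r \<cdot>\<^bsub>G\<^esub> s) = far p h'" using ms(2) rs(2) by auto
      qed
    qed
  qed
qed

lemma loc_cart_conjugate:
  assumes i: "iso_arr G i" and j: "iso_arr G j" and g: "g \<in> hom G (Dom G j) (Dom G i)" and h: "h \<in> hom G (Cod G j) (Cod G i)"
    and eq: "i \<cdot>\<^bsub>G\<^esub> g = h \<cdot>\<^bsub>G\<^esub> j"
  shows "loc_cart g \<longleftrightarrow> loc_cart h"
proof
  let ?k = "inv_arr G j"
  have jk: "inverse_arrows G j ?k" using total.inv_arrI[OF j] .
  have k: "j \<in> Arr G" "?k \<in> Arr G" "Dom G ?k = Cod G j" "Cod G ?k = Dom G j" "j \<cdot>\<^bsub>G\<^esub> ?k = Idn G (Cod G j)" "?k \<cdot>\<^bsub>G\<^esub> j = Idn G (Dom G j)"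
    using jk by (auto simp: inverse_arrows_def hom_def)
  have "inverse_arrows G ?k j" using k by (simp add: inverse_arrows_def hom_def)
  then have ki: "iso_arr G ?k" by (auto simp: iso_arr_def)
  have gh: "g \<in> Arr G" "Dom G g = Dom G j" "Cod G g = Dom G i" "h \<in> Arr G" "Dom G h = Cod G j" "Cod G h = Cod G i"
    using g h by (auto simp: hom_def)
  { assume "loc_cart g"
    then have l: "loc_cart (h \<cdot>\<^bsub>G\<^esub> j)" using loc_cart_comp[OF loc_cart_iso[OF i]] gh eq by metis
    have hj: "Dom G (h \<cdot>\<^bsub>G\<^esub> j) = Dom G j" using total.comp_simps[OF gh(4) k(1)] gh by simp
    have "loc_cart (h \<cdot>\<^bsub>G\<^esub> j \<cdot>\<^bsub>G\<^esub> ?k)" using loc_cart_comp[OF l loc_cart_iso[OF ki]] hj k by simp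
    moreover have "h \<cdot>\<^bsub>G\<^esub> j \<cdot>\<^bsub>G\<^esub> ?k = h" using total.assoc[OF gh(4) k(1,2)] gh k total.id_right[OF gh(4)] by simp
    ultimately show "loc_cart h" by simp }
  assume "loc_cart h"
  then have "loc_cart (i \<cdot>\<^bsub>G\<^esub> g)" using loc_cart_comp[OF _ loc_cart_iso[OF j]] gh eq by simp
  then show "loc_cart g" using loc_cart_cancel[OF loc_cart_iso[OF i] gh(1,3)] by blast
qed

end

section \<open>Relative sites\<close>

lemma relative_siteD:
  assumes "relative_site C J D K"
  shows "site C J" "indexed_category C D" "site (gcat C D) K" "d \<in> Obj (gcat C D) \<Longrightarrow> giraud C J D d \<subseteq> K d"
  using assms by (auto simp: relative_site_def)

text \<open>The cartesian lifts of the arrows of a \<open>J\<close>-covering sieve \<open>S\<close> on \<open>snd d\<close> witness that the arrows into \<open>d\<close>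
  lying over \<open>S\<close> form a covering sieve of the Giraud topology.\<close>

lemma relative_site_comorphism:
  assumes r: "relative_site C J D K"
  shows "comorphism_of_sites (gcat C D) K C J proj"
proof -
  note R = relative_siteD[OF r]
  interpret J: site C J by (rule R(1))
  interpret D: indexed_category C D by (rule R(2))
  interpret K: site "gcat C D" K by (rule R(3))
  interpret p: functor_between "gcat C D" C proj by (rule D.functor_between_proj)
  show ?thesis
  proof unfold_locales
    fix d S assume d: "d \<in> Obj (gcat C D)" and S: "S \<in> J (fob proj d)"
    obtain x c where dd: "d = (x, c)" by (cases d)
    have xc: "c \<in> Obj C" "x \<in> Obj (fib D c)" using d by (simp_all add: dd D.gcat_simps)
    have S': "S \<in> J c" using S by (simp add: dd proj_def)
    note sa = J.cover_arr[OF xc(1) S'] and sc = J.cover_comp[OF xc(1) S']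
    let ?R = "{h \<in> max_sieve (gcat C D) d. base h \<in> S}"
    let ?T = "(\<lambda>f. cart_arr C D f x) ` S"
    have "sieve (gcat C D) d ?R" unfolding sieve_def
    proof (intro conjI ballI impI)
      fix h g assume h: "h \<in> ?R" and g: "g \<in> Arr (gcat C D)" "Cod (gcat C D) g = Dom (gcat C D) h"
      have h': "h \<in> Arr (gcat C D)" "Cod (gcat C D) h = d" "base h \<in> S" using h by (auto simp: max_sieve_def proj_def)
      have "base g \<in> Arr C" "Cod C (base g) = Dom C (base h)"
        using p.far_hom[OF g(1)] p.far_hom[OF h'(1)] g(2) by (auto simp: hom_def proj_def)
      then have "base (h \<cdot>\<^bsub>gcat C D\<^esub> g) \<in> S" using sc[OF h'(3)] D.base_comp[OF h'(1) g(1)] by simp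
      then show "h \<cdot>\<^bsub>gcat C D\<^esub> g \<in> ?R" using K.comp_simps[OF h'(1) g] h' by (simp add: max_sieve_def proj_def)
    qed (auto simp: max_sieve_def)
    moreover have "?T \<subseteq> ?R"
      using D.cart_arr_arr sa xc by (auto simp: max_sieve_def proj_def hom_def dd)
    moreover have "\<forall>g\<in>?T. cartesian (gcat C D) C proj g" using D.cartesian_cart_arr sa xc by auto
    moreover have "gen_sieve C (base ` ?T) \<in> J (snd d)"
    proof -
      have "base ` ?T = S" by (auto simp: cart_arr_def image_iff)
      moreover have "gen_sieve C S = S"
      proof
        show "gen_sieve C S \<subseteq> S" using sc by (auto simp: gen_sieve_def)
        show "S \<subseteq> gen_sieve C S"
        proof
          fix f assume f: "f \<in> S"
          have "f = f \<cdot>\<^bsub>C\<^esub> Idn C (Dom C f)" using J.id_right[OF sa(1)[OF f]] by simp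
          then show "f \<in> gen_sieve C S" unfolding gen_sieve_def using f J.id_simps[OF sa(3)[OF f]] by blast
        qed
      qed
      ultimately show ?thesis using S' by (simp add: dd)
    qed
    ultimately have "?R \<in> giraud C J D d" unfolding giraud_def by blast
    then have "?R \<in> K d" using R(4)[OF d] by blast
    then show "{h \<in> max_sieve (gcat C D) d. far proj h \<in> S} \<in> K d" by (simp add: proj_def)
  qed
qed

section \<open>Functors over the base\<close>

lemma (in indexed_category) iso_base_vertical:
  assumes "vertical C D g" shows "iso_arr C (base g)"
proof -
  obtain c where c: "c \<in> Obj C" "base g = Idn C c" using assms by (auto simp: vertical_def)
  have "inverse_arrows C (Idn C c) (Idn C c)" using id_simps[OF c(1)] id_hom[OF c(1)] id_left[of "Idn C c"]
    by (simp add: inverse_arrows_def)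
  then show ?thesis using c(2) by (auto simp: iso_arr_def)
qed

text \<open>In the naturality square of \<open>\<theta>\<close> at \<open>g\<close>, the side opposite to \<open>base (far A g)\<close> is the identity \<open>base g\<close>, and the
  other two sides are components of \<open>\<theta>\<close>.\<close>

lemma iso_base_image_vertical:
  assumes D: "indexed_category C D" "indexed_category C D'" and A: "functor_between (gcat C D) (gcat C D') A"
    and th: "natural_iso (gcat C D) C (comp_ftr proj A) proj \<theta>" and g: "vertical C D g"
  shows "iso_arr C (base (far A g))"
proof -
  interpret D: indexed_category C D by (rule D(1))
  interpret D': indexed_category C D' by (rule D(2))
  interpret A: functor_between "gcat C D" "gcat C D'" A by (rule A)
  interpret p: functor_between "gcat C D" C proj by (rule D.functor_between_proj)
  interpret p': functor_between "gcat C D'" C proj by (rule D'.functor_between_proj)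
  obtain c where ga: "g \<in> Arr (gcat C D)" and c: "c \<in> Obj C" "base g = Idn C c" using g by (auto simp: vertical_def)
  let ?d = "Dom (gcat C D) g" and ?e = "Cod (gcat C D) g"
  have de: "?d \<in> Obj (gcat C D)" "?e \<in> Obj (gcat C D)" using A.source.dom_obj[OF ga] A.source.cod_obj[OF ga] by auto
  have sc: "snd ?d = c" "snd ?e = c" using p.far_hom[OF ga] D.id_simps[OF c(1)] c(2) by (auto simp: hom_def proj_def)
  have t: "\<theta> d \<in> hom C (snd (fob A d)) (snd d)" "iso_arr C (\<theta> d)" if "d \<in> Obj (gcat C D)" for d
    using th that by (auto simp: natural_iso_def comp_ftr_def proj_def)
  have td: "\<theta> ?d \<in> Arr C" "Dom C (\<theta> ?d) = snd (fob A ?d)" "Cod C (\<theta> ?d) = c"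
    and te: "Dom C (\<theta> ?e) = snd (fob A ?e)" "Cod C (\<theta> ?e) = c"
    using t(1)[OF de(1)] t(1)[OF de(2)] sc by (auto simp: hom_def)
  have a: "far A g \<in> Arr (gcat C D')" "Dom (gcat C D') (far A g) = fob A ?d" "Cod (gcat C D') (far A g) = fob A ?e"
    using A.far_hom[OF ga] by (auto simp: hom_def)
  have "\<theta> ?e \<cdot>\<^bsub>C\<^esub> base (far A g) = base g \<cdot>\<^bsub>C\<^esub> \<theta> ?d"
    using th ga by (simp add: natural_iso_def comp_ftr_def proj_def)
  then have eq: "\<theta> ?e \<cdot>\<^bsub>C\<^esub> base (far A g) = \<theta> ?d" using D.id_left[OF td(1)] td c by simp
  have b: "base (far A g) \<in> hom C (Dom C (\<theta> ?d)) (Dom C (\<theta> ?e))"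
    using p'.far_hom[OF a(1)] a td te by (simp add: hom_def proj_def)
  show ?thesis by (rule D.iso_arr_right_factor[OF t(2)[OF de(2)] t(2)[OF de(1)] b _ eq]) (use td te in simp)
qed

text \<open>Up to isomorphism \<open>A\<close> sends the cartesian arrow over \<open>f\<close> to the composite of a cartesian arrow over \<open>f\<close>
  with the vertical arrow \<open>v_comp\<close>. A locally cartesian arrow can be cancelled on the left, so that this composite
  is locally cartesian if and only if its vertical factor is.\<close>

lemma loc_cart_image_cart_arr:
  assumes D: "indexed_category C D" and r: "relative_site C J D' K'" and A: "functor_between (gcat C D) (gcat C D') A"
    and th: "natural_iso (gcat C D) C (comp_ftr proj A) proj \<theta>"
    and f: "f \<in> Arr C" "x \<in> Obj (fib D (Cod C f))"
  shows "locally_cartesian (gcat C D') K' C J proj (far A (cart_arr C D f x)) \<longleftrightarrow>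
    l_iso (gcat C D') K' (vert_arr C D' (Dom C f) (v_comp C D D' A \<theta> f x))"
proof -
  interpret D: indexed_category C D by (rule D)
  interpret D': indexed_category C D' by (rule relative_siteD(2)[OF r])
  interpret M: comorphism_of_sites "gcat C D'" K' C J proj by (rule relative_site_comorphism[OF r])
  interpret A: functor_between "gcat C D" "gcat C D'" A by (rule A)
  let ?S = "strictify C D D' A \<theta>" and ?k = "theta_lift C D' A \<theta>" and ?c = "cart_arr C D f x"
  note S = strictify_properties[OF D D'.indexed_category_axioms A th]
  have c: "?c \<in> Arr (gcat C D)" "base ?c = f" using D.cart_arr_arr[OF f] by (auto simp: hom_def)
  let ?d = "Dom (gcat C D) ?c" and ?e = "Cod (gcat C D) ?c"
  have de: "?d \<in> Obj (gcat C D)" "?e \<in> Obj (gcat C D)" using A.source.dom_obj[OF c(1)] A.source.cod_obj[OF c(1)] by auto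
  have k: "?k d \<in> hom (gcat C D') (fob ?S d) (fob A d)" "iso_arr (gcat C D') (?k d)" if "d \<in> Obj (gcat C D)" for d
    using S(4) that by (auto simp: natural_iso_def)
  have nat: "?k ?e \<cdot>\<^bsub>gcat C D'\<^esub> far ?S ?c = far A ?c \<cdot>\<^bsub>gcat C D'\<^esub> ?k ?d"
    using S(4) c(1) unfolding natural_iso_def by blast
  have s: "far ?S ?c \<in> hom (gcat C D') (fob ?S ?d) (fob ?S ?e)" by (rule functor_between.far_hom[OF S(1) c(1)])
  have conj: "M.loc_cart (far A ?c) \<longleftrightarrow> M.loc_cart (far ?S ?c)"
    by (rule M.loc_cart_conjugate[OF k(2)[OF de(2)] k(2)[OF de(1)] _ _ nat, symmetric])
      (use k(1)[OF de(1)] k(1)[OF de(2)] s A.far_hom[OF c(1)] in \<open>simp_all add: hom_def\<close>)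
  define s where "s = far ?S ?c"
  have sa: "s \<in> Arr (gcat C D')" "base s = f" using s S(3)[OF c(1)] c(2) by (simp_all add: s_def hom_def)
  obtain u y where G: "s = GArr f u y" using sa(2) by (cases s) auto
  have uy: "y \<in> Obj (fib D' (Cod C f))" "u \<in> Arr (fib D' (Dom C f))" "Cod (fib D' (Dom C f)) u = fob (reix D' f) y"
    using sa(1) by (auto simp: G D'.gcat_simps)
  have v: "v_comp C D D' A \<theta> f x = u" by (simp add: v_comp_def s_def[symmetric] G)
  let ?b = "cart_arr C D' f y" and ?v = "vert_arr C D' (Dom C f) u"
  have fac: "s = ?b \<cdot>\<^bsub>gcat C D'\<^esub> ?v" using D'.factorization[OF sa(1)] by (simp add: G)
  note dom = D.dom_obj[OF f(1)]
  have va: "?v \<in> hom (gcat C D') (Dom (fib D' (Dom C f)) u, Dom C f) (fob (reix D' f) y, Dom C f)" "vertical C D' ?v"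
    using D'.vert_arr_arr[OF dom uy(2)] uy(3) by auto
  have ba: "?b \<in> hom (gcat C D') (fob (reix D' f) y, Dom C f) (y, Cod C f)" using D'.cart_arr_arr(1)[OF f(1) uy(1)] .
  have bl: "M.loc_cart ?b" by (rule M.cartesian_loc_cart[OF D'.cartesian_cart_arr[OF f(1) uy(1)]])
  have vv: "?v \<in> Arr (gcat C D')" "Cod (gcat C D') ?v = Dom (gcat C D') ?b" using va ba by (auto simp: hom_def)
  have "M.loc_cart s \<longleftrightarrow> M.loc_cart ?v"
    unfolding fac using M.loc_cart_comp[OF bl _ vv(2)] M.loc_cart_cancel[OF bl vv] by blast
  also have "\<dots> \<longleftrightarrow> l_iso (gcat C D') K' ?v"
    by (rule M.loc_cart_iff_l_iso[OF vv(1)]) (use D'.iso_base_vertical[OF va(2)] in \<open>simp add: proj_def\<close>)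
  finally show ?thesis using conj v by (simp add: s_def)
qed

theorem proposition4p4p3:
  fixes C :: "('o, 'a) cat" and J :: "'o \<Rightarrow> 'a set set"
    and D :: "('o, 'a, 'x, 'm) indexed" and K :: "'x \<times> 'o \<Rightarrow> ('a, 'm, 'x) garr set set"
    and D' :: "('o, 'a, 'y, 'n) indexed" and K' :: "'y \<times> 'o \<Rightarrow> ('a, 'n, 'y) garr set set"
    and A :: "('x \<times> 'o, ('a, 'm, 'x) garr, 'y \<times> 'o, ('a, 'n, 'y) garr) ftr"
    and \<theta> :: "'x \<times> 'o \<Rightarrow> 'a"
  assumes "relative_site C J D K" and "relative_site C J D' K'"
    and "functor_between (gcat C D) (gcat C D') A"
    and "natural_iso (gcat C D) C (comp_ftr proj A) proj \<theta>"
  shows "(morphism_of_local_fibrations C J D K D' K' A \<longleftrightarrow>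
      (\<forall>g. vertical C D g \<and> l_iso (gcat C D) K g \<longrightarrow> l_iso (gcat C D') K' (far A g)) \<and>
      (\<forall>f\<in>Arr C. \<forall>x\<in>Obj (fib D (Cod C f)).
         l_iso (gcat C D') K' (vert_arr C D' (Dom C f) (v_comp C D D' A \<theta> f x)))) \<and>
    (continuous_ftr (gcat C D) K (gcat C D') K' A \<longrightarrow>
      (\<forall>g. vertical C D g \<and> l_iso (gcat C D) K g \<longrightarrow> l_iso (gcat C D') K' (far A g)) \<and>
      (morphism_of_local_fibrations C J D K D' K' A \<longleftrightarrow>
        (\<forall>f\<in>Arr C. \<forall>x\<in>Obj (fib D (Cod C f)).
           l_iso (gcat C D') K' (vert_arr C D' (Dom C f) (v_comp C D D' A \<theta> f x)))))"

proof -
  note r = assms(1) and r' = assms(2) and A = assms(3) and th = assms(4)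
  note R = relative_siteD[OF r] and R' = relative_siteD[OF r']
  interpret D: indexed_category C D by (rule R(2))
  interpret D': indexed_category C D' by (rule R'(2))
  interpret M: comorphism_of_sites "gcat C D" K C J proj by (rule relative_site_comorphism[OF r])
  interpret M': comorphism_of_sites "gcat C D'" K' C J proj by (rule relative_site_comorphism[OF r'])
  interpret A: functor_between "gcat C D" "gcat C D'" A by (rule A)
  let ?one = "\<forall>g. vertical C D g \<and> l_iso (gcat C D) K g \<longrightarrow> l_iso (gcat C D') K' (far A g)"
  let ?two = "\<forall>f\<in>Arr C. \<forall>x\<in>Obj (fib D (Cod C f)). l_iso (gcat C D') K' (vert_arr C D' (Dom C f) (v_comp C D D' A \<theta> f x))"
  have vertical_iff: "M.loc_cart g \<longleftrightarrow> l_iso (gcat C D) K g" "M'.loc_cart (far A g) \<longleftrightarrow> l_iso (gcat C D') K' (far A g)"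
    if g: "vertical C D g" for g
  proof -
    have ga: "g \<in> Arr (gcat C D)" using g by (simp add: vertical_def)
    have "iso_arr C (far proj g)" using D.iso_base_vertical[OF g] by (simp add: proj_def)
    then show "M.loc_cart g \<longleftrightarrow> l_iso (gcat C D) K g" by (rule M.loc_cart_iff_l_iso[OF ga])
    have "far A g \<in> Arr (gcat C D')" using A.far_hom[OF ga] by (simp add: hom_def)
    moreover have "iso_arr C (far proj (far A g))" using iso_base_image_vertical[OF R(2) R'(2) A th g] by (simp add: proj_def)
    ultimately show "M'.loc_cart (far A g) \<longleftrightarrow> l_iso (gcat C D') K' (far A g)" by (rule M'.loc_cart_iff_l_iso)
  qed
  have cart: "M.loc_cart (cart_arr C D f x)"
    "M'.loc_cart (far A (cart_arr C D f x)) \<longleftrightarrow> l_iso (gcat C D') K' (vert_arr C D' (Dom C f) (v_comp C D D' A \<theta> f x))"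
    if f: "f \<in> Arr C" "x \<in> Obj (fib D (Cod C f))" for f x
    using M.cartesian_loc_cart[OF D.cartesian_cart_arr[OF f]] loc_cart_image_cart_arr[OF R(2) r' A th f] by auto
  have main: "morphism_of_local_fibrations C J D K D' K' A \<longleftrightarrow> ?one \<and> ?two"
  proof
    assume "morphism_of_local_fibrations C J D K D' K' A"
    then have "M'.loc_cart (far A g)" if "M.loc_cart g" for g using that by (simp add: morphism_of_local_fibrations_def)
    then show "?one \<and> ?two" using vertical_iff cart by blast
  next
    assume 12: "?one \<and> ?two"
    have "M'.loc_cart (far A g)" if g: "M.loc_cart g" for g
    proof -
      have ga: "g \<in> Arr (gcat C D)" using M.loc_cart_arr[OF g] .
      let ?c = "cart_arr C D (base g) (tgt g)" and ?v = "vert_arr C D (Dom C (base g)) (fpart g)"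
      obtain f u x where G: "g = GArr f u x" by (cases g)
      have fx: "f \<in> Arr C" "x \<in> Obj (fib D (Cod C f))" "u \<in> Arr (fib D (Dom C f))" "Cod (fib D (Dom C f)) u = fob (reix D f) x"
        using ga by (auto simp: G D.gcat_simps)
      have fac: "g = ?c \<cdot>\<^bsub>gcat C D\<^esub> ?v" by (rule D.factorization[OF ga])
      note va = D.vert_arr_arr[OF D.dom_obj[OF fx(1)] fx(3)]
      have v: "?v \<in> Arr (gcat C D)" "vertical C D ?v" and c: "?c \<in> Arr (gcat C D)"
        and cv: "Cod (gcat C D) ?v = Dom (gcat C D) ?c"
        using va D.cart_arr_arr(1)[OF fx(1,2)] fx(4) by (auto simp: G hom_def)
      have cl: "M.loc_cart ?c" "M'.loc_cart (far A ?c)" using cart[OF fx(1,2)] 12 fx by (simp_all add: G)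
      have "M.loc_cart ?v" using M.loc_cart_cancel[OF cl(1) v(1) cv] g fac by metis
      then have vl: "M'.loc_cart (far A ?v)" using vertical_iff[OF v(2)] 12 v(2) by blast
      have "Cod (gcat C D') (far A ?v) = Dom (gcat C D') (far A ?c)"
        using A.far_hom[OF v(1)] A.far_hom[OF c] cv by (simp add: hom_def)
      then have "M'.loc_cart (far A ?c \<cdot>\<^bsub>gcat C D'\<^esub> far A ?v)" by (rule M'.loc_cart_comp[OF cl(2) vl])
      then show ?thesis using A.far_comp[OF c v(1) cv] fac by metis
    qed
    then show "morphism_of_local_fibrations C J D K D' K' A"
      unfolding morphism_of_local_fibrations_def using A th by blast
  qed
  have "?one" if "continuous_ftr (gcat C D) K (gcat C D') K' A"
    using continuous_ftr_l_iso[OF R(3) R'(3) A that] by (auto simp: vertical_def)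
  then show ?thesis using main by blast
qed

end
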